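(* Let $D=(G,\mathcal{O},w)$ be a weighted oriented graph where $G$ is an $SCQ$ graph, with $Q_G$ a set witnessing this. Then $I(D)$ is unmixed if and only if $D$ satisfies: (a) each basic $5$-cycle of $G$ has the $\star$-property; (b) no simplex of $D$ has a generating $\star$-semi-forest; (c) $N_D(b)\subseteq N_D^{+}(a)$ whenever $a\in V^{+}$, $\{b,b'\}\in Q_G$ and $b'\in N_D^{+}(a)$.
   Context: A weighted oriented graph is a triple $D=(G,\mathcal{O},w)$ with $G$ a finite simple graph with vertex set $\{x_1,\dots,x_n\}$, $\mathcal{O}$ an orientation of its edges, $w:V(G)\to\mathbb{N}$; $E(D)$ is the set of oriented edges. $V^{+}=\{x\mid w(x)>1\}$. $I(D)=(x_ix_j^{w(x_j)}\mid (x_i,x_j)\in E(D))\subseteq K[x_1,\dots,x_n]$, $K$ a field; unmixed means all associated primes have the same height. $N_D^{+}(x)=\{y\mid(x,y)\in E(D)\}$, $N_D^{-}(x)=\{y\mid(y,x)\in E(D)\}$, $N_D(x)=N_D^+(x)\cup N_D^-(x)$; for sets, unions. $\deg_G(x)=|N_D(x)|$. A source is a vertex with $N_D^-(x)=\emptyset$; standing convention: sources have weight $1$. A vertex $v$ is simplicial if $G[N_G[v]]$ is complete; then $G[N_G[v]]$ is a simplex; $S_G$ is the set of simplexes; a simplex of $D$ is the induced weighted oriented subgraph of $D$ on the vertex set of a simplex. An induced $5$-cycle of $G$ is basic if it contains no two adjacent vertices both of degree $\ge3$ in $G$; $C_G$ is the set of basic $5$-cycles. An edge $e=\{b,b'\}$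 has property (P) if for all edges $\{a,b\},\{a',b'\}\in E(G)$ we have $\{a,a'\}\in E(G)$; a matching has property (P) if all its edges do. $G$ is $SCQ$ if there is $Q_G$, empty or a matching with property (P), such that $\{V(H)\mid H\in S_G\cup C_G\cup Q_G\}$ is a partition of $V(G)$. An induced $5$-cycle $C$ has the $\star$-property if for each $(a,b)\in E(D)$ that is an edge of $C$ with $a\in V^+$, writing $C=(a',a,b,b',c,a')$: ($\star$.1) $(a',a)\in E(D)$ and $w(a')=1$; ($\star$.2) $N_D^-(a)\subseteq N_D(c)$ and $N_D^-(a)\cap V^+\subseteq N_D^-(c)$; ($\star$.3) $N_D(b')\subseteq N_D(a')\cup N_D^+(a)$ and $N_D^-(b')\cap V^+\subseteq N_D^-(a')$. Weighted oriented subgraph: oriented subgraph of $(G,\mathcal{O})$ with restricted weights; $\deg_H(x)$ = number of neighbours in $H$. Oriented path: distinct $(y_1,\dots,y_m)$ with $(y_i,y_{i+1})\in E(D)$; oriented cycle: such a path closed by $(y_m,y_1)\in E(D)$. Unicycle oriented subgraph: weighted oriented subgraph $B$ with exactly one cycle $C$, $C$ oriented, every vertex off $C$ reached by an oriented path in $B$ from $C$, and $w(x)=1\Rightarrow\deg_B(x)=1$. ROT with parent $v$: acyclic weighted oriented subgraph $T\ni v$, every $x\ne v$ reached by an oriented path in $T$ from $v$, and $w(x)=1$ implies ($\deg_T(x)=1$, $x\ne v$) or ($V(T)=\{v\}=\{x\}$). $\star$-semi-forest: $H=(\bigcup_{i=1}^r T_i)\cup(\bigcup_{j=1}^s B_j)$,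 $T_i$ ROTs with parents $v_i$, $B_j$ unicycle, vertex sets partitioning $V(H)$, with $W=\{w_1,\dots,w_r\}\subseteq V(D)\setminus V(H)$, $w_i\in N_D(v_i)$, and a partition $W_1,W_2$ of $W$ with $W_1$ stable, $W_2\subseteq V^+$, $(w_i,v_i)\in E(D)$ if $w_i\in W_2$, and $N_D^+(W_2\cup\tilde H)\cap W_1=\emptyset$, $\tilde H=\{x\in V(H)\mid\deg_H(x)\ge2\}\cup\{v_i\mid\deg_H(v_i)=1\}$. A generating $\star$-semi-forest of $K$ is a $\star$-semi-forest $H$ of $D$ with $V(H)=V(K)$. *)

theory Defs
  imports
    "HOL-Library.Poly_Mapping"
    "HOL-Library.Disjoint_Sets"
    "HOL-Library.Extended_Nat"
    "HOL-Algebra.Algebraic_Closure_Type"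
begin

section \<open>Associated primes, height, unmixed ideals\<close>

definition associated_primes :: "('a, 'b) ring_scheme \<Rightarrow> 'a set \<Rightarrow> 'a set set" where
  "associated_primes R I =
    {P. primeideal P R \<and> (\<exists>f \<in> carrier R. P = {g \<in> carrier R. g \<otimes>\<^bsub>R\<^esub> f \<in> I})}"

definition height :: "('a, 'b) ring_scheme \<Rightarrow> 'a set \<Rightarrow> enat" where
  "height R P = Sup {enat n | n. \<exists>c :: nat \<Rightarrow> 'a set.
     (\<forall>i\<le>n. primeideal (c i) R) \<and> (\<forall>i<n. c i \<subset> c (Suc i)) \<and> c n = P}"

definition unmixed :: "('a, 'b) ring_scheme \<Rightarrow> 'a set \<Rightarrow> bool" where
  "unmixed R I \<longleftrightarrow>
    (\<forall>P \<in> associated_primes R I. \<forall>P' \<in> associated_primes R I. height R P = height R P')"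


section \<open>Weighted oriented graphs and their edge ideals\<close>

text \<open>
  The vertex set is the type \<open>'v\<close>, an oriented graph is its set \<open>E\<close> of oriented edges, and the
  underlying simple graph is a set of two-element vertex sets. The polynomial ring in the
  variables \<open>x\<^sub>v\<close> is the type \<open>('v \<Rightarrow>\<^sub>0 nat) \<Rightarrow>\<^sub>0 'k\<close>: outer keys are exponent vectors.
\<close>

definition weighted_oriented_graph :: "('v \<times> 'v) set \<Rightarrow> ('v \<Rightarrow> nat) \<Rightarrow> bool" where
  "weighted_oriented_graph E w \<longleftrightarrow> asym E \<and> (\<forall>x. 1 \<le> w x)"

definition underlying :: "('v \<times> 'v) set \<Rightarrow> 'v set set" where
  "underlying E = {{a, b} | a b. (a, b) \<in> E}"

definition outN :: "('v \<times> 'v) set \<Rightarrow> 'v \<Rightarrow> 'v set" where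
  "outN E x = {y. (x, y) \<in> E}"

definition inN :: "('v \<times> 'v) set \<Rightarrow> 'v \<Rightarrow> 'v set" where
  "inN E x = {y. (y, x) \<in> E}"

definition nbrs :: "('v \<times> 'v) set \<Rightarrow> 'v \<Rightarrow> 'v set" where
  "nbrs E x = outN E x \<union> inN E x"

definition is_source :: "('v \<times> 'v) set \<Rightarrow> 'v \<Rightarrow> bool" where
  "is_source E x \<longleftrightarrow> inN E x = {}"

definition Vplus :: "('v \<Rightarrow> nat) \<Rightarrow> 'v set" where
  "Vplus w = {x. w x > 1}"

definition pvar :: "'v \<Rightarrow> (('v \<Rightarrow>\<^sub>0 nat) \<Rightarrow>\<^sub>0 'k::field)" where
  "pvar v = Poly_Mapping.single (Poly_Mapping.single v 1) 1"

definition edge_ideal :: "('v \<times> 'v) set \<Rightarrow> ('v \<Rightarrow> nat) \<Rightarrow> (('v \<Rightarrow>\<^sub>0 nat) \<Rightarrow>\<^sub>0 'k::field) set" where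
  "edge_ideal E w = genideal ring_of_type_algebra {pvar a * pvar b ^ w b | a b. (a, b) \<in> E}"


section \<open>SCQ graphs\<close>

text \<open>
  Simplexes and induced 5-cycles are induced subgraphs, hence represented by their vertex sets.
\<close>

definition gnbrs :: "'v set set \<Rightarrow> 'v \<Rightarrow> 'v set" where
  "gnbrs G x = {y. {x, y} \<in> G}"

definition gdeg :: "'v set set \<Rightarrow> 'v \<Rightarrow> nat" where
  "gdeg G x = card (gnbrs G x)"

definition complete_on :: "'v set set \<Rightarrow> 'v set \<Rightarrow> bool" where
  "complete_on G S \<longleftrightarrow> (\<forall>a\<in>S. \<forall>b\<in>S. a \<noteq> b \<longrightarrow> {a, b} \<in> G)"

definition simplicial :: "'v set set \<Rightarrow> 'v \<Rightarrow> bool" where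
  "simplicial G v \<longleftrightarrow> complete_on G (insert v (gnbrs G v))"

definition simplexes :: "'v set set \<Rightarrow> 'v set set" where
  "simplexes G = {insert v (gnbrs G v) | v. simplicial G v}"

definition induced_C5 :: "'v set set \<Rightarrow> 'v \<Rightarrow> 'v \<Rightarrow> 'v \<Rightarrow> 'v \<Rightarrow> 'v \<Rightarrow> bool" where
  "induced_C5 G a b c d e \<longleftrightarrow> distinct [a, b, c, d, e] \<and>
     {a, b} \<in> G \<and> {b, c} \<in> G \<and> {c, d} \<in> G \<and> {d, e} \<in> G \<and> {e, a} \<in> G \<and>
     {a, c} \<notin> G \<and> {b, d} \<notin> G \<and> {c, e} \<notin> G \<and> {d, a} \<notin> G \<and> {e, b} \<notin> G"

definition basic_C5s :: "'v set set \<Rightarrow> 'v set set" where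
  "basic_C5s G = {{a, b, c, d, e} | a b c d e. induced_C5 G a b c d e \<and>
     \<not> (\<exists>x\<in>{a, b, c, d, e}. \<exists>y\<in>{a, b, c, d, e}. {x, y} \<in> G \<and> gdeg G x \<ge> 3 \<and> gdeg G y \<ge> 3)}"

text \<open>
  In property (P) the vertices \<open>a\<close> and \<open>a'\<close> may coincide; as \<open>{a, a}\<close> is not an edge, an edge
  with property (P) lies in no triangle.
\<close>

definition property_P :: "'v set set \<Rightarrow> 'v set \<Rightarrow> bool" where
  "property_P G e \<longleftrightarrow> (\<forall>b b' a a'. e = {b, b'} \<and> {a, b} \<in> G \<and> {a', b'} \<in> G \<longrightarrow> {a, a'} \<in> G)"

definition matching :: "'v set set \<Rightarrow> 'v set set \<Rightarrow> bool" where
  "matching G M \<longleftrightarrow> M \<subseteq> G \<and> disjoint M"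

definition SCQ_witness :: "'v set set \<Rightarrow> 'v set set \<Rightarrow> bool" where
  "SCQ_witness G Q \<longleftrightarrow> matching G Q \<and> (\<forall>e\<in>Q. property_P G e) \<and>
     partition_on UNIV (simplexes G \<union> basic_C5s G \<union> Q)"


section \<open>The star property of induced 5-cycles\<close>

definition star_property :: "('v \<times> 'v) set \<Rightarrow> ('v \<Rightarrow> nat) \<Rightarrow> 'v set \<Rightarrow> bool" where
  "star_property E w C \<longleftrightarrow> (\<forall>a' a b b' c.
     induced_C5 (underlying E) a' a b b' c \<and> C = {a', a, b, b', c} \<and> (a, b) \<in> E \<and> a \<in> Vplus w \<longrightarrow>
       ((a', a) \<in> E \<and> w a' = 1) \<and>
       (inN E a \<subseteq> nbrs E c \<and> inN E a \<inter> Vplus w \<subseteq> inN E c) \<and>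
       (nbrs E b' \<subseteq> nbrs E a' \<union> outN E a \<and> inN E b' \<inter> Vplus w \<subseteq> inN E a'))"


section \<open>Star-semi-forests\<close>

text \<open>The weights of a weighted oriented subgraph are restrictions, so they are not stored.\<close>

record 'v subgr =
  verts :: "'v set"
  arcs :: "('v \<times> 'v) set"

definition subgraph_of :: "('v \<times> 'v) set \<Rightarrow> 'v subgr \<Rightarrow> bool" where
  "subgraph_of E H \<longleftrightarrow> arcs H \<subseteq> E \<and> arcs H \<subseteq> verts H \<times> verts H"

definition sdeg :: "'v subgr \<Rightarrow> 'v \<Rightarrow> nat" where
  "sdeg H x = card (nbrs (arcs H) x)"

definition oriented_path :: "'v subgr \<Rightarrow> 'v list \<Rightarrow> bool" where
  "oriented_path H ys \<longleftrightarrow> ys \<noteq> [] \<and> distinct ys \<and> set ys \<subseteq> verts H \<and>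
     successively (\<lambda>x y. (x, y) \<in> arcs H) ys"

text \<open>The pairs \<open>(y\<^sub>i, y\<^sub>i\<^sub>+\<^sub>1)\<close> of a list read cyclically.\<close>

definition cyclic_pairs :: "'v list \<Rightarrow> ('v \<times> 'v) set" where
  "cyclic_pairs ys = set (zip ys (rotate1 ys))"

definition oriented_cycle :: "'v subgr \<Rightarrow> 'v list \<Rightarrow> bool" where
  "oriented_cycle H ys \<longleftrightarrow> oriented_path H ys \<and> (last ys, hd ys) \<in> arcs H"

text \<open>
  The cycles of the underlying undirected graph, each given by its edge set, so that rotations
  and reversals of a vertex list are counted as one cycle.
\<close>

definition cycles :: "'v subgr \<Rightarrow> 'v set set set" where
  "cycles H = {underlying (cyclic_pairs ys) | ys.
     length ys \<ge> 3 \<and> distinct ys \<and> underlying (cyclic_pairs ys) \<subseteq> underlying (arcs H)}"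

definition unicycle_oriented :: "('v \<times> 'v) set \<Rightarrow> ('v \<Rightarrow> nat) \<Rightarrow> 'v subgr \<Rightarrow> bool" where
  "unicycle_oriented E w B \<longleftrightarrow> subgraph_of E B \<and>
     (\<exists>ys. oriented_cycle B ys \<and> cycles B = {underlying (cyclic_pairs ys)} \<and>
        (\<forall>x \<in> verts B - set ys. \<exists>p. oriented_path B p \<and> hd p \<in> set ys \<and> last p = x)) \<and>
     (\<forall>x \<in> verts B. w x = 1 \<longrightarrow> sdeg B x = 1)"

definition ROT :: "('v \<times> 'v) set \<Rightarrow> ('v \<Rightarrow> nat) \<Rightarrow> 'v subgr \<Rightarrow> 'v \<Rightarrow> bool" where
  "ROT E w T v \<longleftrightarrow> subgraph_of E T \<and> v \<in> verts T \<and> cycles T = {} \<and>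
     (\<forall>x \<in> verts T. x \<noteq> v \<longrightarrow> (\<exists>p. oriented_path T p \<and> hd p = v \<and> last p = x)) \<and>
     (\<forall>x \<in> verts T. w x = 1 \<longrightarrow> (sdeg T x = 1 \<and> x \<noteq> v) \<or> (verts T = {v} \<and> v = x))"

definition stable :: "('v \<times> 'v) set \<Rightarrow> 'v set \<Rightarrow> bool" where
  "stable E S \<longleftrightarrow> (\<forall>a\<in>S. \<forall>b\<in>S. {a, b} \<notin> underlying E)"

text \<open>
  The trees \<open>T i\<close> with parents \<open>v i\<close> and outer vertices \<open>u i\<close> are indexed by \<open>i < r\<close>, the unicycle
  subgraphs \<open>B j\<close> by \<open>j < s\<close>. The outer vertices \<open>u i\<close> need not be distinct, and each of \<open>r\<close>, \<open>s\<close>,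
  \<open>W1\<close>, \<open>W2\<close> may be zero or empty.
\<close>

definition star_semi_forest :: "('v \<times> 'v) set \<Rightarrow> ('v \<Rightarrow> nat) \<Rightarrow> 'v subgr \<Rightarrow> bool" where
  "star_semi_forest E w H \<longleftrightarrow>
    (\<exists>(r::nat) (s::nat) T v B u W1 W2.
       (\<forall>i<r. ROT E w (T i) (v i)) \<and>
       (\<forall>j<s. unicycle_oriented E w (B j)) \<and>
       verts H = (\<Union>i<r. verts (T i)) \<union> (\<Union>j<s. verts (B j)) \<and>
       arcs H = (\<Union>i<r. arcs (T i)) \<union> (\<Union>j<s. arcs (B j)) \<and>
       disjoint_family_on (\<lambda>i. verts (T i)) {..<r} \<and>
       disjoint_family_on (\<lambda>j. verts (B j)) {..<s} \<and>
       (\<forall>i<r. \<forall>j<s. verts (T i) \<inter> verts (B j) = {}) \<and>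
       (\<forall>i<r. u i \<notin> verts H \<and> u i \<in> nbrs E (v i)) \<and>
       W1 \<union> W2 = u ` {..<r} \<and> W1 \<inter> W2 = {} \<and>
       stable E W1 \<and>
       W2 \<subseteq> Vplus w \<and>
       (\<forall>i<r. u i \<in> W2 \<longrightarrow> (u i, v i) \<in> E) \<and>
       (let Ht = {x \<in> verts H. sdeg H x \<ge> 2} \<union> {v i | i. i < r \<and> sdeg H (v i) = 1}
        in (\<Union>x \<in> W2 \<union> Ht. outN E x) \<inter> W1 = {}))"

definition generating_star_semi_forest ::
    "('v \<times> 'v) set \<Rightarrow> ('v \<Rightarrow> nat) \<Rightarrow> 'v set \<Rightarrow> 'v subgr \<Rightarrow> bool" where
  "generating_star_semi_forest E w K H \<longleftrightarrow> star_semi_forest E w H \<and> verts H = K"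

end

theory Submission
  imports Defs
begin

text \<open>
  The associated primes of \<open>I(D)\<close> are the ideals generated by the variables of a strong vertex cover
  \<open>C\<close>, and such an ideal has height \<open>card C\<close>; so \<open>I(D)\<close> is unmixed iff all strong vertex covers have the
  same size. For the upper bound on heights, a set of variables that is algebraically independent
  modulo a prime can be enlarged whenever the prime is replaced by a strictly smaller one.

  The parts of an \<open>SCQ\<close> partition give a lower bound for the size of every vertex cover, attained by
  the minimal ones. Hence unmixedness says that no strong vertex cover contains a simplex or an edge of
  \<open>Q\<close>, or four vertices of a basic 5-cycle, and these three statements are equivalent to (b), (c) and
  (a) respectively. Strong covers violating them are produced by a single construction: the complement
  of a stable set that is maximal among those avoiding the out-neighbours of a set \<open>A \<subseteq> V\<^sup>+\<close>.
\<close>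

section \<open>Strong vertex covers\<close>

text \<open>Strong covers record when a monomial \<open>m\<close> has \<open>I(D) : m\<close>
  generated by the variables of \<open>C\<close>. If all neighbours of \<open>x\<close> lie in
  \<open>C\<close>, multiplying \<open>m\<close> by \<open>x\<close> must complete a generator whose
  other exponent comes from inside \<open>C\<close>, and this takes a vertex of weight above 1. An
  inclusion-minimal cover has no such \<open>x\<close>, so it is strong for all weights. That it
  attains the bound on 5-cycles and edges of \<open>Q\<close> follows from the same criteria that
  give (a) and (c), applied with all weights 1, where both conditions are void. The obstacle in (b)
  is that following the parents supplied by strongness may run into cycles. Completeness of the
  simplex lets the parents be chosen so that the only cycle is one triangle. For heights, linear
  elimination with multipliers outside the prime takes the place of transcendence degrees.\<close>

lemma edge_underlying_iff: "{a, b} \<in> underlying E \<longleftrightarrow> (a, b) \<in> E \<or> (b, a) \<in> E"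
  by (auto simp: underlying_def doubleton_eq_iff)

lemma mem_nbrs_iff: "y \<in> nbrs E x \<longleftrightarrow> (x, y) \<in> E \<or> (y, x) \<in> E"
  by (auto simp: nbrs_def outN_def inN_def)

lemma gnbrs_underlying: "gnbrs (underlying E) x = nbrs E x"
  by (auto simp: gnbrs_def edge_underlying_iff mem_nbrs_iff)

definition vertex_cover :: "('v \<times> 'v) set \<Rightarrow> 'v set \<Rightarrow> bool" where
  "vertex_cover E C \<longleftrightarrow> (\<forall>a b. (a, b) \<in> E \<longrightarrow> a \<in> C \<or> b \<in> C)"

text \<open>
  In the usual notation, \<open>L\<^sub>1(C)\<close> is the set of \<open>y \<in> C\<close> with \<open>\<not> outN E y \<subseteq> C\<close> and \<open>L\<^sub>3(C)\<close> is the set of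
  \<open>x \<in> C\<close> with \<open>nbrs E x \<subseteq> C\<close>; the \<open>y\<close> below lies in \<open>C\<close> because it is a neighbour of \<open>x\<close>.
\<close>

definition strong_cover :: "('v \<times> 'v) set \<Rightarrow> ('v \<Rightarrow> nat) \<Rightarrow> 'v set \<Rightarrow> bool" where
  "strong_cover E w C \<longleftrightarrow> vertex_cover E C \<and>
     (\<forall>x\<in>C. nbrs E x \<subseteq> C \<longrightarrow> (\<exists>y \<in> inN E x \<inter> Vplus w. outN E y \<subseteq> C))"

lemma strong_coverD:
  assumes "strong_cover E w C" "x \<in> C" "nbrs E x \<subseteq> C"
  obtains y where "(y, x) \<in> E" "y \<in> C" "y \<in> Vplus w" "outN E y \<subseteq> C"
proof -
  obtain y where "(y, x) \<in> E" "y \<in> Vplus w" "outN E y \<subseteq> C"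
    using assms by (auto simp: strong_cover_def inN_def)
  moreover from this have "y \<in> C" using assms(3) by (auto simp: mem_nbrs_iff)
  ultimately show ?thesis using that by blast
qed

lemma vertex_cover_edge:
  "vertex_cover E C \<Longrightarrow> {a, b} \<in> underlying E \<Longrightarrow> a \<in> C \<or> b \<in> C"
  by (auto simp: vertex_cover_def edge_underlying_iff)

text \<open>
  The complement of \<open>C\<close> is a stable set that contains \<open>S\<close> and is maximal among those disjoint from
  the out-neighbourhood of \<open>A\<close>.
\<close>

lemma strong_cover_extension:
  fixes E :: "('v::finite \<times> 'v) set"
  assumes irr: "asym E" and A: "A \<subseteq> Vplus w" and S: "stable E S" "(\<Union>x\<in>A. outN E x) \<inter> S = {}"
  shows "\<exists>C. strong_cover E w C \<and> (\<Union>x\<in>A. outN E x) \<subseteq> C \<and> (\<Union>x\<in>S. nbrs E x) \<subseteq> C"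
proof -
  let ?N = "\<Union>x\<in>A. outN E x"
  let ?F = "{M. stable E M \<and> S \<subseteq> M \<and> ?N \<inter> M = {}}"
  have "finite ?F" "S \<in> ?F"
    using S by (auto intro: finite_subset[OF _ finite])
  then obtain M where M: "M \<in> ?F" and max: "\<And>M'. M' \<in> ?F \<Longrightarrow> M \<subseteq> M' \<Longrightarrow> M = M'"
    using finite_has_maximal[of ?F] by (metis (no_types, lifting) empty_iff)
  have cov: "vertex_cover E (- M)"
    using M by (auto simp: vertex_cover_def stable_def edge_underlying_iff)
  \<comment> \<open>For \<open>x\<close> outside \<open>M\<close> with no neighbour in
    \<open>M\<close>: an out-neighbour of some \<open>y\<close> in \<open>A\<close> has
    \<open>y\<close> itself as witness; any other \<open>x\<close> could be added to
    \<open>M\<close>.\<close>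
  have "\<exists>y \<in> inN E x \<inter> Vplus w. outN E y \<subseteq> - M" if x: "x \<notin> M" "nbrs E x \<subseteq> - M" for x
  proof (cases "x \<in> ?N")
    case True
    then obtain y where y: "y \<in> A" "(y, x) \<in> E" by (auto simp: outN_def)
    with A M show ?thesis by (force simp: inN_def)
  next
    case False
    have "(x, x) \<notin> E" using irr by (meson asymD)
    then have "insert x M \<in> ?F"
      using M False x by (auto simp: stable_def edge_underlying_iff nbrs_def outN_def inN_def)
    then show ?thesis using max[of "insert x M"] x by blast
  qed
  then have "strong_cover E w (- M)" using cov by (auto simp: strong_cover_def)
  moreover have "nbrs E x \<subseteq> - M" if "x \<in> S" for x
    using M that by (auto simp: stable_def edge_underlying_iff mem_nbrs_iff)
  ultimately show ?thesis using M by (intro exI[of _ "- M"]) blast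
qed

lemma stable_singleton:
  assumes "asym E" shows "stable E {c}"
proof -
  have "(c, c) \<notin> E" using assms by (meson asymD)
  then show ?thesis using edge_underlying_iff[of c c E] by (auto simp: stable_def)
qed

text \<open>By property (P) no cover misses a neighbour of \<open>b\<close> and a neighbour of
  \<open>b'\<close> at once, so a cover containing the edge contains all neighbours of one end;
  strongness then applies at both ends in turn. Conversely, a neighbour \<open>c\<close> of one end
  that violates the inclusion gives a cover containing both ends, by the extension with
  \<open>A = {a}\<close> and \<open>S = {c}\<close>.\<close>

lemma edge_strong_cover_iff:
  fixes E :: "('v::finite \<times> 'v) set"
  assumes irr: "asym E" and P: "property_P (underlying E) {b, b'}"
  shows "(\<forall>C. strong_cover E w C \<longrightarrow> \<not> {b, b'} \<subseteq> C) \<longleftrightarrow>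
    (\<forall>a\<in>Vplus w. (b' \<in> outN E a \<longrightarrow> nbrs E b \<subseteq> outN E a) \<and> (b \<in> outN E a \<longrightarrow> nbrs E b' \<subseteq> outN E a))"
proof -
  have ext: "\<exists>C. strong_cover E w C \<and> {p, q} \<subseteq> C"
    if h: "a \<in> Vplus w" "q \<in> outN E a" "\<not> nbrs E p \<subseteq> outN E a" for a p q
  proof -
    obtain c where c: "c \<in> nbrs E p" "c \<notin> outN E a" using h by blast
    have "stable E {c}" by (rule stable_singleton[OF irr])
    then obtain C where "strong_cover E w C" "outN E a \<subseteq> C" "nbrs E c \<subseteq> C"
      using strong_cover_extension[of E "{a}" w "{c}"] irr h(1) c(2) by auto
    moreover have "p \<in> nbrs E c" using c by (auto simp: mem_nbrs_iff)
    ultimately show ?thesis using h by blast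
  qed
  have L3: False
    if C: "strong_cover E w C" "p \<in> C" "q \<in> C" "nbrs E q \<subseteq> C"
      and c: "\<And>a. a \<in> Vplus w \<Longrightarrow> q \<in> outN E a \<Longrightarrow> nbrs E p \<subseteq> outN E a"
        "\<And>a. a \<in> Vplus w \<Longrightarrow> p \<in> outN E a \<Longrightarrow> nbrs E q \<subseteq> outN E a" for C p q
  proof -
    obtain a where a: "(a, q) \<in> E" "a \<in> Vplus w" "outN E a \<subseteq> C"
      using strong_coverD[OF C(1,3,4)] by blast
    then have "nbrs E p \<subseteq> outN E a" using c(1) by (auto simp: outN_def)
    moreover from this obtain a2 where "(a2, p) \<in> E" "a2 \<in> Vplus w" "outN E a2 \<subseteq> C"
      using strong_coverD[OF C(1,2)] a by blast
    moreover from this have "nbrs E q \<subseteq> outN E a2" using c(2) by (auto simp: outN_def)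
    \<comment> \<open>\<open>a\<close> is a neighbour of \<open>q\<close> and \<open>a2\<close> one
      of \<open>p\<close>, so the two inclusions give opposite arcs.\<close>
    ultimately have "(a, a2) \<in> E" "(a2, a) \<in> E"
      using a by (auto simp: outN_def nbrs_def inN_def)
    then show False using irr by (meson asymD)
  qed
  have "nbrs E b \<subseteq> C \<or> nbrs E b' \<subseteq> C" if C: "strong_cover E w C" "b \<in> C" "b' \<in> C" for C
  proof (rule ccontr)
    assume "\<not> ?thesis"
    then obtain a a' where "a \<in> nbrs E b" "a' \<in> nbrs E b'" "a \<notin> C" "a' \<notin> C" by blast
    moreover from this have "{a, a'} \<in> underlying E"
      using P unfolding property_P_def mem_nbrs_iff by (metis edge_underlying_iff)
    ultimately show False using C(1) vertex_cover_edge[of E C a a'] by (simp add: strong_cover_def)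
  qed
  note one = this
  show ?thesis
  proof (intro iffI ballI conjI impI allI notI)
    fix a assume "\<forall>C. strong_cover E w C \<longrightarrow> \<not> {b, b'} \<subseteq> C" "a \<in> Vplus w" "b' \<in> outN E a"
    then show "nbrs E b \<subseteq> outN E a" using ext[of a b' b] by blast
  next
    fix a assume "\<forall>C. strong_cover E w C \<longrightarrow> \<not> {b, b'} \<subseteq> C" "a \<in> Vplus w" "b \<in> outN E a"
    then show "nbrs E b' \<subseteq> outN E a" using ext[of a b b'] by (metis insert_commute)
  next
    fix C assume *: "\<forall>a\<in>Vplus w. (b' \<in> outN E a \<longrightarrow> nbrs E b \<subseteq> outN E a) \<and> (b \<in> outN E a \<longrightarrow> nbrs E b' \<subseteq> outN E a)"
      and C: "strong_cover E w C" "{b, b'} \<subseteq> C"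
    then have "b \<in> C" "b' \<in> C" by auto
    then show False using one[OF C(1)] L3[OF C(1), of b b'] L3[OF C(1), of b' b] * by metis
  qed
qed

section \<open>Basic 5-cycles\<close>

lemma strong_cover_containing:
  fixes E :: "('v::finite \<times> 'v) set"
  assumes "asym E" "A \<subseteq> Vplus w" "stable E S" "(\<Union>x\<in>A. outN E x) \<inter> S = {}"
    and "Y \<subseteq> (\<Union>x\<in>A. outN E x) \<union> (\<Union>x\<in>S. nbrs E x)"
  shows "\<exists>C. strong_cover E w C \<and> Y \<subseteq> C"
proof -
  obtain C where "strong_cover E w C" "(\<Union>x\<in>A. outN E x) \<subseteq> C" "(\<Union>x\<in>S. nbrs E x) \<subseteq> C"
    using strong_cover_extension[OF assms(1-4)] by (elim exE conjE)
  moreover from this have "Y \<subseteq> C" using assms(5) by (meson Un_least order_trans)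
  ultimately show ?thesis by (intro exI conjI)
qed

lemma induced_C5_rotate: "induced_C5 G a b c d e \<Longrightarrow> induced_C5 G b c d e a"
  unfolding induced_C5_def by (elim conjE, intro conjI) (simp_all add: insert_commute, auto)

lemma induced_C5_reverse: "induced_C5 G a b c d e \<Longrightarrow> induced_C5 G e d c b a"
  unfolding induced_C5_def by (elim conjE, intro conjI) (simp_all add: insert_commute, auto)

lemma mem_nbrs_edge: "y \<in> nbrs E x \<longleftrightarrow> {x, y} \<in> underlying E"
  by (simp add: mem_nbrs_iff edge_underlying_iff)

lemma induced_C5_edges:
  assumes "induced_C5 (underlying E) a b c d e"
  shows "distinct [a, b, c, d, e]" "b \<in> nbrs E a" "e \<in> nbrs E a" "a \<in> nbrs E b" "c \<in> nbrs E b"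
    "b \<in> nbrs E c" "d \<in> nbrs E c" "c \<in> nbrs E d" "e \<in> nbrs E d" "a \<in> nbrs E e" "d \<in> nbrs E e"
    "c \<notin> nbrs E a" "d \<notin> nbrs E a" "d \<notin> nbrs E b" "e \<notin> nbrs E b" "e \<notin> nbrs E c"
    "a \<notin> nbrs E c" "a \<notin> nbrs E d" "b \<notin> nbrs E d" "b \<notin> nbrs E e" "c \<notin> nbrs E e"
  using assms by (simp_all add: induced_C5_def mem_nbrs_edge insert_commute)

lemma nbrs_eq_pair:
  fixes E :: "('v::finite \<times> 'v) set"
  assumes "gdeg (underlying E) x < 3" "p \<in> nbrs E x" "q \<in> nbrs E x" "p \<noteq> q"
  shows "nbrs E x = {p, q}"
proof -
  have "card (nbrs E x) \<le> card {p, q}"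
    using assms by (simp add: gdeg_def gnbrs_underlying)
  then show ?thesis using assms card_seteq[of "nbrs E x" "{p, q}"] by simp
qed

lemma stable_pair:
  assumes "asym E" "y \<notin> nbrs E x"
  shows "stable E {x, y}"
proof -
  have "(x, x) \<notin> E" "(y, y) \<notin> E" using assms(1) by (meson asymD)+
  then have "{x, x} \<notin> underlying E" "{y, y} \<notin> underlying E" "{x, y} \<notin> underlying E" "{y, x} \<notin> underlying E"
    using assms(2) unfolding edge_underlying_iff mem_nbrs_iff by simp_all
  then show ?thesis by (auto simp: stable_def)
qed

text \<open>If a clause fails, there are weighted vertices \<open>A\<close> and a stable set
  \<open>S\<close>, on or next to the cycle, that force four vertices of the cycle into a strong
  cover. The convention on sources enters by supplying a vertex \<open>z\<close> with an arc into a
  weighted vertex.\<close>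

lemma C5_strong_cover_imp_star:
  fixes E :: "('v::finite \<times> 'v) set"
  assumes asym: "asym E" and pos: "\<And>x. 1 \<le> w x" and src: "\<And>x. is_source E x \<Longrightarrow> w x = 1"
    and deg: "\<And>x y. x \<in> V \<Longrightarrow> y \<in> V \<Longrightarrow> {x, y} \<in> underlying E \<Longrightarrow>
      gdeg (underlying E) x < 3 \<or> gdeg (underlying E) y < 3"
    and le3: "\<And>C. strong_cover E w C \<Longrightarrow> card (C \<inter> V) \<le> 3"
  shows "star_property E w V"
  unfolding star_property_def
proof (intro allI impI)
  fix a' a b b' c
  assume *: "induced_C5 (underlying E) a' a b b' c \<and> V = {a', a, b, b', c} \<and> (a, b) \<in> E \<and> a \<in> Vplus w"
  then have V: "V = {a', a, b, b', c}" and ab: "(a, b) \<in> E" and a: "a \<in> Vplus w" by auto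
  note cyc = induced_C5_edges[OF conjunct1[OF *]]
  have asymD': "(x, y) \<in> E \<Longrightarrow> (y, x) \<notin> E" for x y using asym by (meson asymD)
  have card4: "card {a, b, a', b'} = 4" "card {a, b, a', c} = 4" "card {a, b, b', c} = 4"
    using cyc(1) by auto
  have no4: False if "strong_cover E w C" "Y \<subseteq> C" "Y \<subseteq> V" "card Y = 4" for Y C
    using le3[OF that(1)] that(2-) card_mono[of "C \<inter> V" Y] by simp
  have no: False
    if "A \<subseteq> Vplus w" "stable E S" "(\<Union>x\<in>A. outN E x) \<inter> S = {}"
      "Y \<subseteq> (\<Union>x\<in>A. outN E x) \<union> (\<Union>x\<in>S. nbrs E x)" "Y \<subseteq> V" "card Y = 4" for A S Y
    using strong_cover_containing[OF asym that(1-4)] no4 that(5,6) by blast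
  have in_nbr: "\<exists>z. (z, x) \<in> E" if "x \<in> Vplus w" for x
    using src[of x] that by (auto simp: Vplus_def is_source_def inN_def)

  have s1a: "(a', a) \<in> E"
  proof (rule ccontr)
    assume "(a', a) \<notin> E"
    then have a'a: "(a, a') \<in> E" using cyc by (auto simp: mem_nbrs_iff)
    obtain z where z: "(z, a) \<in> E" using in_nbr a by blast
    have "(a, z) \<notin> E" using z asymD' by blast
    \<comment> \<open>\<open>b\<close> and \<open>a'\<close> come from \<open>a\<close>, while
      \<open>a\<close> itself comes from \<open>z\<close>; covering the edge between
      \<open>b'\<close> and \<open>c\<close> adds a fourth vertex.\<close>
    then have "\<exists>C. strong_cover E w C \<and> {a, b, a'} \<subseteq> C"
      using strong_cover_containing[OF asym, of "{a}" w "{z}" "{a, b, a'}"] stable_singleton[OF asym, of z]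
        a ab a'a z by (auto simp: outN_def mem_nbrs_iff card4)
    then obtain C where C: "strong_cover E w C" "{a, b, a'} \<subseteq> C" by blast
    then have "b' \<in> C \<or> c \<in> C"
      using vertex_cover_edge[of E C b' c] * unfolding strong_cover_def induced_C5_def by blast
    then show False
    proof
      assume "b' \<in> C" then show False using no4[OF C(1), of "{a, b, a', b'}"] C cyc(1) V by auto
    next
      assume "c \<in> C" then show False using no4[OF C(1), of "{a, b, a', c}"] C cyc(1) V by auto
    qed
  qed
  have s1b: "w a' = 1"
  proof (rule ccontr)
    assume "w a' \<noteq> 1"
    then have a': "a' \<in> Vplus w" using pos[of a'] by (simp add: Vplus_def)
    show False
    proof (cases "(c, a') \<in> E")
      case True
      show False
        using no[of "{a, a'}" "{c}" "{a, b, a', b'}"] stable_singleton[OF asym, of c] asymD'[OF True]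
          a a' ab s1a V cyc by (auto simp: outN_def mem_nbrs_iff card4)
    next
      case False
      then have a'c: "(a', c) \<in> E" using cyc by (auto simp: mem_nbrs_iff)
      obtain z where z: "(z, a') \<in> E" using in_nbr a' by blast
      have zV: "z \<noteq> a" "z \<noteq> c" using z asymD'[OF s1a] asymD'[OF a'c] by auto
      have "z \<in> nbrs E a'" using z by (simp add: mem_nbrs_iff)
      \<comment> \<open>\<open>a'\<close> has the three neighbours \<open>a\<close>,
        \<open>c\<close>, \<open>z\<close>, so \<open>a\<close> has degree two on a basic cycle;
        hence \<open>z\<close> is no out-neighbour of \<open>a\<close> and \<open>S = {z}\<close> is
        allowed.\<close>
      then have "\<not> gdeg (underlying E) a' < 3"
        using nbrs_eq_pair[of E a' a c] zV cyc(2,3) cyc(1) by auto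
      then have "gdeg (underlying E) a < 3"
        using deg[of a a'] V s1a by (auto simp: edge_underlying_iff)
      then have "nbrs E a = {a', b}" using nbrs_eq_pair[of E a a' b] cyc(1,4,5) by auto
      moreover have "z \<noteq> a'" "z \<noteq> b" using z asymD'[OF z] cyc by (auto simp: mem_nbrs_iff)
      ultimately have "(a, z) \<notin> E" using mem_nbrs_iff[of z E a] by auto
      then show False
        using no[of "{a, a'}" "{z}" "{a, b, a', c}"] stable_singleton[OF asym, of z] asymD'[OF z]
          a a' ab s1a a'c z V cyc by (auto simp: outN_def mem_nbrs_iff card4)
    qed
  qed
  \<comment> \<open>In the remaining clauses \<open>b\<close> comes from \<open>a\<close>. For
    in-neighbours \<open>z\<close> of \<open>a\<close>, the stable set contains \<open>c\<close>,
    which yields \<open>a'\<close> and \<open>b'\<close>, while \<open>z\<close> yields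
    \<open>a\<close>. For neighbours \<open>z\<close> of \<open>b'\<close>, it contains
    \<open>a'\<close>, which yields \<open>a\<close> and \<open>c\<close>, while \<open>z\<close>
    yields \<open>b'\<close>.\<close>
  have s2a: "z \<in> nbrs E c" if z: "(z, a) \<in> E" for z
  proof (rule ccontr)
    assume "z \<notin> nbrs E c"
    then show False
      using no[of "{a}" "{c, z}" "{a, b, a', b'}"] stable_pair[OF asym, of z c] asymD'[OF z]
        a ab s1a z V cyc by (auto simp: outN_def mem_nbrs_iff card4)
  qed
  have s2b: "(z, c) \<in> E" if z: "(z, a) \<in> E" "z \<in> Vplus w" for z
  proof (rule ccontr)
    assume "(z, c) \<notin> E"
    then show False
      using no[of "{a, z}" "{c}" "{a, b, a', b'}"] stable_singleton[OF asym, of c]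
        a ab s1a z V cyc by (auto simp: outN_def mem_nbrs_iff card4)
  qed
  have s3a: "z \<in> nbrs E a' \<union> outN E a" if z: "z \<in> nbrs E b'" for z
  proof (rule ccontr)
    assume "z \<notin> nbrs E a' \<union> outN E a"
    then show False
      using no[of "{a}" "{a', z}" "{a, b, b', c}"] stable_pair[OF asym, of z a'] asymD'[OF s1a]
        a ab s1a z V cyc by (auto simp: outN_def mem_nbrs_iff card4)
  qed
  have s3b: "(z, a') \<in> E" if z: "(z, b') \<in> E" "z \<in> Vplus w" for z
  proof (rule ccontr)
    assume "(z, a') \<notin> E"
    then show False
      using no[of "{a, z}" "{a'}" "{a, b, b', c}"] stable_singleton[OF asym, of a'] asymD'[OF s1a]
        a ab s1a z V cyc by (auto simp: outN_def mem_nbrs_iff card4)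
  qed
  show "((a', a) \<in> E \<and> w a' = 1) \<and>
       (inN E a \<subseteq> nbrs E c \<and> inN E a \<inter> Vplus w \<subseteq> inN E c) \<and>
       (nbrs E b' \<subseteq> nbrs E a' \<union> outN E a \<and> inN E b' \<inter> Vplus w \<subseteq> inN E a')"
    using s1a s1b s2a s2b s3a s3b unfolding inN_def by blast
qed

text \<open>If four vertices of the cycle lie in \<open>C\<close>, one of them has degree two and
  both neighbours in \<open>C\<close>, hence a weighted in-neighbour \<open>a\<close> on the cycle
  with all out-neighbours in \<open>C\<close>. The clauses at \<open>a\<close> then put the whole
  cycle into \<open>C\<close>. Now every cycle vertex of degree two needs a weighted in-neighbour on
  the cycle, which contradicts the weights 1 that the property forces.\<close>

lemma C5_star_imp_strong_cover:
  fixes E :: "('v::finite \<times> 'v) set"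
  assumes asym: "asym E"
    and deg: "\<And>x y. x \<in> V \<Longrightarrow> y \<in> V \<Longrightarrow> {x, y} \<in> underlying E \<Longrightarrow>
      gdeg (underlying E) x < 3 \<or> gdeg (underlying E) y < 3"
    and star: "star_property E w V" and C: "strong_cover E w C"
    and cyc0: "induced_C5 (underlying E) v1 v2 v3 v4 v5" "V = {v1, v2, v3, v4, v5}"
  shows "card (C \<inter> V) \<le> 3"
proof (rule ccontr)
  assume "\<not> ?thesis"
  then have ge4: "card (C \<inter> V) \<ge> 4" by simp
  have asymD': "(x, y) \<in> E \<Longrightarrow> (y, x) \<notin> E" for x y using asym by (meson asymD)
  have miss: False if "x \<in> V" "y \<in> V" "x \<noteq> y" "x \<notin> C" "y \<notin> C" for x y
  proof -
    have "card V = 5" using cyc0(2) induced_C5_edges(1)[OF cyc0(1)] by simp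
    moreover have "C \<inter> V \<subseteq> V - {x, y}" using that by auto
    ultimately have "card (C \<inter> V) \<le> 3"
      using card_mono[of "V - {x, y}" "C \<inter> V"] that by (simp add: card_Diff_subset)
    then show False using ge4 by simp
  qed
  let ?I = "induced_C5 (underlying E)"
  have "\<exists>p q r s t. ?I p q r s t \<and> V = {p, q, r, s, t} \<and> {p, q, r, s} \<subseteq> C"
  proof -
    have I: "?I v1 v2 v3 v4 v5" "?I v2 v3 v4 v5 v1" "?I v3 v4 v5 v1 v2" "?I v4 v5 v1 v2 v3" "?I v5 v1 v2 v3 v4"
      using cyc0(1) induced_C5_rotate by metis+
    have V: "V = {v2, v3, v4, v5, v1}" "V = {v3, v4, v5, v1, v2}" "V = {v4, v5, v1, v2, v3}" "V = {v5, v1, v2, v3, v4}"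
      using cyc0(2) by auto
    note d = induced_C5_edges(1)[OF cyc0(1)]
    consider "{v1, v2, v3, v4} \<subseteq> C" | "{v2, v3, v4, v5} \<subseteq> C" | "{v3, v4, v5, v1} \<subseteq> C"
      | "{v4, v5, v1, v2} \<subseteq> C" | "{v5, v1, v2, v3} \<subseteq> C"
      using miss[of v1] miss[of v2] miss[of v3] miss[of v4] d cyc0(2) by auto
    then show ?thesis using I V cyc0(2) by cases blast+
  qed
  then obtain p q r s t where I: "?I p q r s t" and V: "V = {p, q, r, s, t}" and sub: "{p, q, r, s} \<subseteq> C"
    by blast
  \<comment> \<open>Of the adjacent vertices \<open>q\<close> and \<open>r\<close> at most one has
    degree three or more; if it is \<open>q\<close>, the reading of the cycle is shifted by
    one.\<close>
  have "\<exists>p q r s t. ?I p q r s t \<and> V = {p, q, r, s, t} \<and> {p, q, r} \<subseteq> C \<and> gdeg (underlying E) q < 3"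
  proof (cases "gdeg (underlying E) q < 3")
    case True
    then show ?thesis using I V sub by blast
  next
    case False
    then have "gdeg (underlying E) r < 3" using deg[of q r] V I by (auto simp: induced_C5_def)
    moreover have "V = {q, r, s, t, p}" using V by auto
    ultimately show ?thesis using induced_C5_rotate[OF I] sub by blast
  qed
  then obtain p q r s t where I: "?I p q r s t" and V: "V = {p, q, r, s, t}" and sub: "{p, q, r} \<subseteq> C"
    and q: "gdeg (underlying E) q < 3" by blast
  have Nq: "nbrs E q = {p, r}" using nbrs_eq_pair[OF q] induced_C5_edges[OF I] by auto
  then obtain y where y: "(y, q) \<in> E" "y \<in> Vplus w" "outN E y \<subseteq> C"
    using strong_coverD[OF C, of q] sub by (metis insert_subset empty_subsetI)
  then have "y = p \<or> y = r" using Nq by (auto simp: mem_nbrs_iff)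
  have "\<exists>a' a b b' c. ?I a' a b b' c \<and> V = {a', a, b, b', c} \<and> (a, b) \<in> E \<and> a \<in> Vplus w \<and>
     outN E a \<subseteq> C \<and> {a, b, b'} \<subseteq> C"
  proof (cases "y = p")
    case True
    have "?I t p q r s" using I induced_C5_rotate by metis
    moreover have "V = {t, p, q, r, s}" using V by auto
    ultimately show ?thesis using True y sub by blast
  next
    case False
    then have "y = r" using \<open>y = p \<or> y = r\<close> by simp
    have "?I s r q p t" using I induced_C5_rotate induced_C5_reverse by metis
    moreover have "V = {s, r, q, p, t}" using V by auto
    moreover have "{r, q, p} \<subseteq> C" using sub by auto
    ultimately show ?thesis using \<open>y = r\<close> y by blast
  qed
  then obtain a' a b b' c where I: "?I a' a b b' c" and V: "V = {a', a, b, b', c}" and ab: "(a, b) \<in> E"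
    and a: "a \<in> Vplus w" "outN E a \<subseteq> C" and sub: "a \<in> C" "b \<in> C" "b' \<in> C" by blast
  note cyc = induced_C5_edges[OF I]
  have st: "((a', a) \<in> E \<and> w a' = 1) \<and>
       (inN E a \<subseteq> nbrs E c \<and> inN E a \<inter> Vplus w \<subseteq> inN E c) \<and>
       (nbrs E b' \<subseteq> nbrs E a' \<union> outN E a \<and> inN E b' \<inter> Vplus w \<subseteq> inN E a')"
    using star I V ab a(1) unfolding star_property_def by blast
  have "vertex_cover E C" using C by (simp add: strong_cover_def)
  then have out: "nbrs E x \<subseteq> C" if "x \<notin> C" for x
    using that unfolding vertex_cover_def by (meson mem_nbrs_iff subsetI)
  \<comment> \<open>If \<open>c\<close> is missing, all neighbours of \<open>a\<close> lie in
    \<open>C\<close>, and the weighted in-neighbour given by strongness has an arc to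
    \<open>c\<close> by the second clause. The argument for \<open>a'\<close> is the same with
    \<open>b'\<close> and the third clause.\<close>
  have "c \<in> C"
  proof (rule ccontr)
    assume c: "c \<notin> C"
    then have "nbrs E a \<subseteq> C" using out[OF c] st a(2) by (auto simp: nbrs_def)
    then obtain z where "(z, a) \<in> E" "z \<in> Vplus w" "outN E z \<subseteq> C"
      using strong_coverD[OF C sub(1)] by blast
    then show False using st c by (auto simp: inN_def outN_def)
  qed
  have "a' \<in> C"
  proof (rule ccontr)
    assume a': "a' \<notin> C"
    then have "nbrs E b' \<subseteq> C" using out[OF a'] st a(2) by blast
    then obtain z where "(z, b') \<in> E" "z \<in> Vplus w" "outN E z \<subseteq> C"
      using strong_coverD[OF C sub(3)] by blast
    then show False using st a' by (auto simp: inN_def outN_def)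
  qed
  have deg2: "\<exists>z\<in>{p, q}. (z, x) \<in> E \<and> z \<in> Vplus w"
    if h: "gdeg (underlying E) x < 3" "p \<in> nbrs E x" "q \<in> nbrs E x" "p \<noteq> q" "x \<in> V" "p \<in> V" "q \<in> V" for x p q
  proof -
    have VC: "V \<subseteq> C" using V sub \<open>c \<in> C\<close> \<open>a' \<in> C\<close> by auto
    have N: "nbrs E x = {p, q}" by (rule nbrs_eq_pair) (use h in auto)
    have "x \<in> C" "nbrs E x \<subseteq> C" using N VC h by auto
    then obtain z where "(z, x) \<in> E" "z \<in> Vplus w" using strong_coverD[OF C, of x] by metis
    then show ?thesis using N by (auto simp: mem_nbrs_iff)
  qed
  have w1: "w x = 1 \<Longrightarrow> x \<notin> Vplus w" for x by (simp add: Vplus_def)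
  \<comment> \<open>If \<open>a'\<close> has degree two, its weighted in-neighbour is
    \<open>c\<close>, and the property at the arc from \<open>c\<close> to \<open>a'\<close> gives
    \<open>b'\<close> weight 1 and an arc into \<open>c\<close>. If \<open>b'\<close> has degree
    two, then \<open>b\<close> is weighted with an arc to \<open>b'\<close>, which forces
    \<open>w a = 1\<close>; if \<open>c\<close> has degree two, no weighted in-neighbour is left for
    it.\<close>
  show False
  proof (cases "gdeg (underlying E) a' < 3")
    case True
    then have ca: "(c, a') \<in> E" "c \<in> Vplus w"
      using deg2[of a' a c] cyc V st by (auto dest: asymD')
    have "?I b' c a' a b" "V = {b', c, a', a, b}" using I V induced_C5_rotate by (metis, auto)
    then have bc: "(b', c) \<in> E" "w b' = 1" using star ca unfolding star_property_def by blast+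
    consider "gdeg (underlying E) b' < 3" | "gdeg (underlying E) c < 3"
      using deg[of b' c] V bc by (auto simp: edge_underlying_iff)
    then show False
    proof cases
      case 1
      then have b: "(b, b') \<in> E" "b \<in> Vplus w" using deg2[of b' b c] cyc V bc by (auto dest: asymD')
      have "?I a b b' c a'" "V = {a, b, b', c, a'}" using I V induced_C5_rotate by (metis, auto)
      then have "w a = 1" using star b unfolding star_property_def by blast
      then show False using a w1 by blast
    next
      case 2
      then show False using deg2[of c a' b'] cyc V bc st w1 by auto
    qed
  next
    case False
    \<comment> \<open>Now \<open>a\<close> has degree two, but \<open>a'\<close> has weight 1 and
      the edge to \<open>b\<close> leaves \<open>a\<close>.\<close>
    then have "gdeg (underlying E) a < 3" using deg[of a' a] V st by (auto simp: edge_underlying_iff)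
    then show False using deg2[of a a' b] cyc V st w1 ab by (auto dest: asymD')
  qed
qed

section \<open>Star-semi-forests\<close>

text \<open>Used to recognise the predecessor of a vertex as the parent of a tree or as a vertex of
  degree at least two.\<close>

lemma successively_pred:
  assumes "successively P ps" "ps \<noteq> []" "hd ps \<noteq> last ps"
  shows "\<exists>y. P y (last ps) \<and> (y = hd ps \<or> (\<exists>z. P z y))"
proof -
  obtain qs x where ps: "ps = qs @ [x]" using assms(2) by (metis append_butlast_last_id)
  with assms(3) have "qs \<noteq> []" by auto
  then obtain rs y where qs: "qs = rs @ [y]" by (metis append_butlast_last_id)
  have P: "P y x" "rs \<noteq> [] \<Longrightarrow> P (last rs) y"
    using assms(1) by (auto simp: ps qs successively_append_iff)
  show ?thesis
  proof (cases "rs = []")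
    case True
    then show ?thesis using P(1) by (auto simp: ps qs)
  next
    case False
    then show ?thesis using P by (auto simp: ps qs)
  qed
qed

lemma oriented_cycle_pred:
  assumes "oriented_cycle B ys" "x \<in> set ys"
  shows "\<exists>y\<in>set ys. (y, x) \<in> arcs B"
proof -
  obtain ps qs where ys: "ys = ps @ x # qs" using assms(2) by (meson split_list)
  show ?thesis
  proof (cases "ps = []")
    case True
    then have "(last ys, x) \<in> arcs B" using assms(1) by (simp add: ys oriented_cycle_def)
    moreover have "last ys \<in> set ys" by (rule last_in_set) (simp add: ys)
    ultimately show ?thesis by blast
  next
    case False
    then have "(last ps, x) \<in> arcs B"
      using assms(1) by (simp add: ys oriented_cycle_def oriented_path_def successively_append_iff)
    moreover have "last ps \<in> set ys" using False by (simp add: ys)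
    ultimately show ?thesis by blast
  qed
qed

lemma sdeg_ge_2:
  fixes H :: "'v::finite subgr"
  assumes "y \<in> nbrs (arcs H) x" "z \<in> nbrs (arcs H) x" "y \<noteq> z"
  shows "2 \<le> sdeg H x"
proof -
  have "card {y, z} \<le> sdeg H x" unfolding sdeg_def using assms by (intro card_mono) auto
  then show ?thesis using assms by simp
qed

text \<open>The extension is applied with \<open>A = W2 \<union> Ht\<close> and
  \<open>S = W1\<close>. Every vertex of \<open>H\<close> is an out-neighbour of its predecessor,
  which lies in \<open>Ht\<close>, or is the parent of a tree and is covered through its outer
  vertex. \<open>Ht\<close> is weighted because vertices of weight 1 have degree at most 1 and are
  parents only when isolated.\<close>

lemma star_semi_forest_imp_strong_cover:
  fixes E :: "('v::finite \<times> 'v) set"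
  assumes asym: "asym E" and pos: "\<And>x. 1 \<le> w x" and H: "star_semi_forest E w H"
  shows "\<exists>C. strong_cover E w C \<and> verts H \<subseteq> C"
proof -
  obtain r s :: nat and T v B u W1 W2 where
    T: "\<forall>i<r. ROT E w (T i) (v i)" and
    B: "\<forall>j<s. unicycle_oriented E w (B j)" and
    vH: "verts H = (\<Union>i<r. verts (T i)) \<union> (\<Union>j<s. verts (B j))" and
    aH: "arcs H = (\<Union>i<r. arcs (T i)) \<union> (\<Union>j<s. arcs (B j))" and
    dT: "disjoint_family_on (\<lambda>i. verts (T i)) {..<r}" and
    dB: "disjoint_family_on (\<lambda>j. verts (B j)) {..<s}" and
    dTB: "\<forall>i<r. \<forall>j<s. verts (T i) \<inter> verts (B j) = {}" and
    u: "\<forall>i<r. u i \<notin> verts H \<and> u i \<in> nbrs E (v i)" and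
    W: "W1 \<union> W2 = u ` {..<r}" and "W1 \<inter> W2 = {}" and W1: "stable E W1" and W2: "W2 \<subseteq> Vplus w" and
    uW2: "\<forall>i<r. u i \<in> W2 \<longrightarrow> (u i, v i) \<in> E" and
    out: "let Ht = {x \<in> verts H. sdeg H x \<ge> 2} \<union> {v i | i. i < r \<and> sdeg H (v i) = 1}
        in (\<Union>x \<in> W2 \<union> Ht. outN E x) \<inter> W1 = {}"
    using H unfolding star_semi_forest_def by (elim exE conjE)
  define Ht where "Ht = {x \<in> verts H. sdeg H x \<ge> 2} \<union> {v i | i. i < r \<and> sdeg H (v i) = 1}"
  have asymE: "(x, y) \<in> E \<Longrightarrow> (y, x) \<in> E \<Longrightarrow> False" for x y using asym by (meson asymD)
  have subT: "arcs (T i) \<subseteq> E" "arcs (T i) \<subseteq> verts (T i) \<times> verts (T i)" if "i < r" for i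
    using T that unfolding ROT_def subgraph_of_def by auto
  have subB: "arcs (B i) \<subseteq> E" "arcs (B i) \<subseteq> verts (B i) \<times> verts (B i)" if "i < s" for i
    using B that unfolding unicycle_oriented_def subgraph_of_def by auto
  have uT: "i = i'" if "i < r" "i' < r" "x \<in> verts (T i)" "x \<in> verts (T i')" for i i' x
    using disjoint_family_onD[OF dT, of i i'] that by auto
  have uB: "i = i'" if "i < s" "i' < s" "x \<in> verts (B i)" "x \<in> verts (B i')" for i i' x
    using disjoint_family_onD[OF dB, of i i'] that by auto
  have uTB: False if "i < r" "j < s" "x \<in> verts (T i)" "x \<in> verts (B j)" for i j x
    using dTB that by auto
  have degT: "sdeg H x = sdeg (T i) x" if i: "i < r" and x: "x \<in> verts (T i)" for i x
  proof -
    have "(y, z) \<in> arcs (T i)" if yz: "(y, z) \<in> arcs H" "x = y \<or> x = z" for y z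
      using yz(1) unfolding aH
    proof (elim UnE UN_E)
      fix i' assume i': "i' \<in> {..<r}" "(y, z) \<in> arcs (T i')"
      then have "x \<in> verts (T i')" using subT(2)[of i'] yz(2) by auto
      then show ?thesis using uT[of i i' x] i x i' by simp
    next
      fix j assume j: "j \<in> {..<s}" "(y, z) \<in> arcs (B j)"
      then have "x \<in> verts (B j)" using subB(2)[of j] yz(2) by auto
      then show ?thesis using uTB[of i j x] i x j by simp
    qed
    moreover have "arcs (T i) \<subseteq> arcs H" using i by (auto simp: aH)
    ultimately have "nbrs (arcs H) x = nbrs (arcs (T i)) x"
      unfolding nbrs_def inN_def outN_def by auto
    then show ?thesis by (simp add: sdeg_def)
  qed
  have degB: "sdeg H x = sdeg (B j) x" if j: "j < s" and x: "x \<in> verts (B j)" for j x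
  proof -
    have "(y, z) \<in> arcs (B j)" if yz: "(y, z) \<in> arcs H" "x = y \<or> x = z" for y z
      using yz(1) unfolding aH
    proof (elim UnE UN_E)
      fix i assume i: "i \<in> {..<r}" "(y, z) \<in> arcs (T i)"
      then have "x \<in> verts (T i)" using subT(2)[of i] yz(2) by auto
      then show ?thesis using uTB[of i j x] i x j by simp
    next
      fix j' assume j': "j' \<in> {..<s}" "(y, z) \<in> arcs (B j')"
      then have "x \<in> verts (B j')" using subB(2)[of j'] yz(2) by auto
      then show ?thesis using uB[of j j' x] x j j' by simp
    qed
    moreover have "arcs (B j) \<subseteq> arcs H" using j by (auto simp: aH)
    ultimately have "nbrs (arcs H) x = nbrs (arcs (B j)) x"
      unfolding nbrs_def inN_def outN_def by auto
    then show ?thesis by (simp add: sdeg_def)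
  qed
  have w1: "x \<in> Vplus w" if "w x \<noteq> 1" for x using that pos[of x] by (simp add: Vplus_def)
  have isoT: "sdeg (T i) x = 0" if i: "i < r" and x: "verts (T i) = {x}" for i x
  proof -
    have "(y, x) \<notin> arcs (T i) \<and> (x, y) \<notin> arcs (T i)" for y
      using subT[OF i] x asymE[of x x] by auto
    then have "nbrs (arcs (T i)) x = {}" unfolding nbrs_def inN_def outN_def by simp
    then show ?thesis by (simp add: sdeg_def)
  qed
  have ROTw: "w x = 1 \<Longrightarrow> sdeg (T i) x = 1 \<and> x \<noteq> v i \<or> verts (T i) = {x}"
    if "i < r" "x \<in> verts (T i)" for i x
    using T that unfolding ROT_def by blast
  have vT: "v i \<in> verts (T i)" if "i < r" for i using T that unfolding ROT_def by blast
  have Bw: "w x = 1 \<Longrightarrow> sdeg (B i) x = 1" if "i < s" "x \<in> verts (B i)" for i x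
    using B that unfolding unicycle_oriented_def by blast
  have HtV: "Ht \<subseteq> Vplus w"
  proof
    fix x assume "x \<in> Ht"
    then consider i where "i < r" "x \<in> verts (T i)" "sdeg H x \<ge> 2"
      | j where "j < s" "x \<in> verts (B j)" "sdeg H x \<ge> 2" | i where "i < r" "x = v i" "sdeg H x = 1"
      unfolding Ht_def vH by auto
    then show "x \<in> Vplus w"
    proof cases
      case 1
      then show ?thesis using ROTw[OF 1(1,2)] isoT[OF 1(1)] degT[OF 1(1,2)] w1 by fastforce
    next
      case 2
      then show ?thesis using Bw[OF 2(1,2)] degB[OF 2(1,2)] w1 by fastforce
    next
      case 3
      then show ?thesis using ROTw[OF 3(1)] vT[OF 3(1)] isoT[OF 3(1)] degT[OF 3(1)] w1 by fastforce
    qed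
  qed
  \<comment> \<open>A vertex with an arc in and an arc out has two distinct neighbours, since
    opposite arcs are excluded.\<close>
  have Ht2: "y \<in> Ht" if "(z, y) \<in> arcs H" "(y, x) \<in> arcs H" for x y z
  proof -
    have "arcs H \<subseteq> E" using subT subB unfolding aH by blast
    then have "z \<noteq> x" using asymE that by blast
    moreover have "arcs H \<subseteq> verts H \<times> verts H"
      unfolding aH vH using subT(2) subB(2) by (intro Un_least UN_least) fastforce+
    then have "y \<in> verts H" using that by blast
    ultimately show ?thesis using that sdeg_ge_2[of z H y x] by (simp add: Ht_def mem_nbrs_iff)
  qed
  have cover: "verts H \<subseteq> (\<Union>x \<in> W2 \<union> Ht. outN E x) \<union> (\<Union>x\<in>W1. nbrs E x)"
  proof
    fix x assume "x \<in> verts H"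
    then consider i where "i < r" "x \<in> verts (T i)" "x \<noteq> v i" | i where "i < r" "x = v i"
      | j where "j < s" "x \<in> verts (B j)"
      unfolding vH by auto
    then show "x \<in> (\<Union>x \<in> W2 \<union> Ht. outN E x) \<union> (\<Union>x\<in>W1. nbrs E x)"
    proof cases
      case 1
      then obtain ps where "oriented_path (T i) ps" "hd ps = v i" "last ps = x"
        using T unfolding ROT_def by blast
      then obtain y where y: "(y, x) \<in> arcs (T i)" "y = v i \<or> (\<exists>z. (z, y) \<in> arcs (T i))"
        using successively_pred[of "\<lambda>x y. (x, y) \<in> arcs (T i)" ps] 1(3) unfolding oriented_path_def by auto
      have sub: "arcs (T i) \<subseteq> arcs H" using 1 by (auto simp: aH)
      have "y \<in> Ht"
      proof (cases "\<exists>z. (z, y) \<in> arcs (T i)")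
        case True
        then show ?thesis using Ht2 sub y(1) by blast
      next
        case False
        then have yv: "y = v i" using y by simp
        have "x \<in> nbrs (arcs H) y" using y(1) sub by (auto simp: mem_nbrs_iff)
        then have "sdeg H y \<noteq> 0" by (auto simp: sdeg_def)
        then consider "sdeg H y = 1" | "sdeg H y \<ge> 2" by linarith
        moreover have "y \<in> verts H" using yv vT 1(1) by (auto simp: vH)
        ultimately show ?thesis using 1(1) yv by cases (auto simp: Ht_def)
      qed
      then show ?thesis using y(1) subT[OF 1(1)] by (auto simp: outN_def)
    next
      case 2
      then have "u i \<in> W1 \<or> u i \<in> W2" using W by auto
      moreover have "v i \<in> nbrs E (u i)" using u 2 by (auto simp: mem_nbrs_iff)
      ultimately show ?thesis using uW2 2 by (auto simp: outN_def)
    next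
      case 3
      then obtain ys where ys: "oriented_cycle (B j) ys"
        "\<forall>x \<in> verts (B j) - set ys. \<exists>p. oriented_path (B j) p \<and> hd p \<in> set ys \<and> last p = x"
        using B unfolding unicycle_oriented_def by blast
      have sub: "arcs (B j) \<subseteq> arcs H" using 3 by (auto simp: aH)
      have "\<exists>y z. (y, x) \<in> arcs (B j) \<and> (z, y) \<in> arcs (B j)"
      proof (cases "x \<in> set ys")
        case True
        then show ?thesis using oriented_cycle_pred[OF ys(1)] by meson
      next
        case False
        then obtain ps where ps: "oriented_path (B j) ps" "hd ps \<in> set ys" "last ps = x"
          using ys(2) 3 by blast
        then obtain y where "(y, x) \<in> arcs (B j)" "y = hd ps \<or> (\<exists>z. (z, y) \<in> arcs (B j))"
          using successively_pred[of "\<lambda>x y. (x, y) \<in> arcs (B j)" ps] False unfolding oriented_path_def by metis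
        then show ?thesis using oriented_cycle_pred[OF ys(1)] ps(2) by meson
      qed
      then obtain y z where y: "(y, x) \<in> arcs (B j)" "(z, y) \<in> arcs (B j)" by blast
      then have "y \<in> Ht" using Ht2 sub by blast
      then show ?thesis using y(1) subB[OF 3(1)] by (auto simp: outN_def)
    qed
  qed
  have "(\<Union>x \<in> W2 \<union> Ht. outN E x) \<inter> W1 = {}" using out unfolding Ht_def Let_def .
  then show ?thesis
    using strong_cover_containing[OF asym _ W1 _ cover] W2 HtV by (metis Un_least)
qed

section \<open>From strong covers to generating semi-forests\<close>

lemma cyclic_pairs_nth:
  assumes "i < length ys"
  shows "(ys ! i, ys ! (Suc i mod length ys)) \<in> cyclic_pairs ys"
proof -
  have "(ys ! i, rotate1 ys ! i) \<in> set (zip ys (rotate1 ys))"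
    using assms by (auto simp: set_zip)
  then show ?thesis using assms by (simp add: cyclic_pairs_def nth_rotate1)
qed

text \<open>Length at least three keeps the cyclic successor and predecessor of \<open>x\<close>
  apart.\<close>

lemma cyclic_two_nbrs:
  assumes "distinct ys" "length ys \<ge> 3" "x \<in> set ys"
  shows "\<exists>y z. y \<noteq> z \<and> y \<in> set ys \<and> z \<in> set ys \<and>
    {x, y} \<in> underlying (cyclic_pairs ys) \<and> {x, z} \<in> underlying (cyclic_pairs ys)"
proof -
  let ?n = "length ys"
  obtain i where i: "i < ?n" "x = ys ! i" using assms(3) by (auto simp: in_set_conv_nth)
  define j where "j = (if i = 0 then ?n - 1 else i - 1)"
  have j: "j < ?n" "Suc j mod ?n = i" using i assms(2) by (auto simp: j_def)
  define k where "k = Suc i mod ?n"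
  have k: "k < ?n" unfolding k_def using i by (intro mod_less_divisor) auto
  have "k = (if Suc i = ?n then 0 else Suc i)" using i by (auto simp: k_def)
  then have "k \<noteq> j" using i assms(2) by (auto simp: j_def split: if_splits)
  then have "ys ! k \<noteq> ys ! j" using assms(1) j k by (simp add: nth_eq_iff_index_eq)
  moreover have "(x, ys ! k) \<in> cyclic_pairs ys" "(ys ! j, x) \<in> cyclic_pairs ys"
    using cyclic_pairs_nth[of i ys] cyclic_pairs_nth[of j ys] i j by (auto simp: k_def)
  ultimately show ?thesis using j k by (intro exI[of _ "ys ! k"] exI[of _ "ys ! j"]) (auto simp: edge_underlying_iff)
qed

lemma underlying_cyclic_pairs_3:
  "underlying (cyclic_pairs [a, b, c]) = {{a, b}, {b, c}, {c, a}}"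
  by (auto simp: cyclic_pairs_def underlying_def)

text \<open>
  The arcs \<open>(p x, x)\<close> form the semi-forest: \<open>R\<close> consists of the parents of the trees, and \<open>Z\<close> is empty
  or the cycle of the only unicycle component, for which a triangle suffices since \<open>K\<close> is complete.
\<close>

locale parent_map =
  fixes E :: "('v::finite \<times> 'v) set" and w :: "'v \<Rightarrow> nat" and K R Z :: "'v set"
    and p :: "'v \<Rightarrow> 'v" and rank :: "'v \<Rightarrow> nat"
  assumes asym: "asym E" and RK: "R \<subseteq> K" and ZK: "Z \<subseteq> K" and ZR: "Z \<inter> R = {}"
    and p: "\<And>x. x \<in> K \<Longrightarrow> x \<notin> R \<Longrightarrow> p x \<in> K \<and> (p x, x) \<in> E \<and> 1 < w (p x)"
    and rank: "\<And>x. x \<in> K \<Longrightarrow> x \<notin> R \<Longrightarrow> x \<notin> Z \<Longrightarrow> rank (p x) < rank x"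
    and rankZ: "\<And>x. x \<in> Z \<Longrightarrow> rank x = 0"
    and Z: "Z = {} \<or> (\<exists>k m l. Z = {k, m, l} \<and> distinct [k, m, l] \<and> p m = k \<and> p l = m \<and> p k = l)"
begin

definition A where "A = {(p x, x) | x. x \<in> K \<and> x \<notin> R}"

definition comp where "comp S = {x \<in> K. \<exists>r\<in>S. (r, x) \<in> A\<^sup>*}"

definition part where "part S = \<lparr>verts = comp S, arcs = A \<inter> comp S \<times> comp S\<rparr>"

lemma A_iff: "(y, x) \<in> A \<longleftrightarrow> x \<in> K \<and> x \<notin> R \<and> y = p x"
  by (auto simp: A_def)

lemma A_sub: "A \<subseteq> E" using p by (auto simp: A_iff)

lemma pZ: "x \<in> Z \<Longrightarrow> p x \<in> Z" using Z by auto

lemma reach_Z: "(y, x) \<in> A\<^sup>* \<Longrightarrow> x \<in> Z \<Longrightarrow> y \<in> Z"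
  by (induction rule: converse_rtrancl_induct) (auto simp: A_iff pZ)

lemma reach_R: "(y, x) \<in> A\<^sup>* \<Longrightarrow> x \<in> R \<Longrightarrow> y = x"
  by (erule rtranclE) (auto simp: A_iff)

text \<open>Every vertex has at most one incoming arc, so the way back from \<open>x\<close> is
  unique and one of two ancestors is met first.\<close>

lemma reach_linear: "(y, x) \<in> A\<^sup>* \<Longrightarrow> (z, x) \<in> A\<^sup>* \<Longrightarrow> (y, z) \<in> A\<^sup>* \<or> (z, y) \<in> A\<^sup>*"
proof -
  assume "(y, x) \<in> A\<^sup>*" "(z, x) \<in> A\<^sup>*"
  then have "(x, y) \<in> (A\<inverse>)\<^sup>*" "(x, z) \<in> (A\<inverse>)\<^sup>*" by (simp_all add: rtrancl_converse)
  moreover have "single_valued (A\<inverse>)" by (auto simp: single_valued_def A_iff)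
  ultimately have "(y, z) \<in> (A\<inverse>)\<^sup>* \<or> (z, y) \<in> (A\<inverse>)\<^sup>*" by (rule single_valued_confluent[rotated])
  then show ?thesis by (auto simp: rtrancl_converse)
qed

lemma root_unique: "r \<in> R \<Longrightarrow> r' \<in> R \<Longrightarrow> (r, x) \<in> A\<^sup>* \<Longrightarrow> (r', x) \<in> A\<^sup>* \<Longrightarrow> r = r'"
  using reach_linear[of r x r'] reach_R[of r r'] reach_R[of r' r] by metis

lemma root_not_Z: "r \<in> R \<Longrightarrow> z \<in> Z \<Longrightarrow> (r, x) \<in> A\<^sup>* \<Longrightarrow> (z, x) \<in> A\<^sup>* \<Longrightarrow> False"
  using reach_linear[of r x z] reach_R[of z r] reach_Z[of r z] ZR by blast

lemma comp_disjoint: "r \<in> R \<Longrightarrow> r' \<in> R \<Longrightarrow> r \<noteq> r' \<Longrightarrow> comp {r} \<inter> comp {r'} = {}"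
  using root_unique by (auto simp: comp_def)

lemma comp_disjoint_Z: "r \<in> R \<Longrightarrow> comp {r} \<inter> comp Z = {}"
  using root_not_Z by (auto simp: comp_def)

lemma comp_R: "x \<in> comp Z \<Longrightarrow> x \<notin> R"
  using reach_R ZR by (auto simp: comp_def)

lemma sub_comp: "S \<subseteq> K \<Longrightarrow> S \<subseteq> comp S"
  by (auto simp: comp_def)

lemma p_comp:
  assumes x: "x \<in> comp S" "x \<notin> R" and S: "x \<notin> S \<or> S = Z"
  shows "p x \<in> comp S" "(p x, x) \<in> arcs (part S)"
proof -
  have xK: "x \<in> K" using x by (simp add: comp_def)
  then have pK: "p x \<in> K" using p x by blast
  obtain r where r: "r \<in> S" "(r, x) \<in> A\<^sup>*" using x by (auto simp: comp_def)
  show 1: "p x \<in> comp S"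
  proof (cases "r = x")
    case True
    then have "S = Z" "x \<in> Z" using S r by auto
    then show ?thesis using pZ pK by (auto simp: comp_def)
  next
    case False
    then obtain y where "(r, y) \<in> A\<^sup>*" "(y, x) \<in> A" using r(2) by (metis rtranclE)
    then show ?thesis using r(1) pK by (auto simp: comp_def A_iff)
  qed
  show "(p x, x) \<in> arcs (part S)" using 1 x xK by (simp add: part_def A_iff)
qed

text \<open>Induction on the rank. The bound \<open>rank y \<le> rank x\<close> is carried along so
  that \<open>x\<close>, of larger rank than \<open>p x\<close>, cannot occur on the path to
  \<open>p x\<close>; this keeps the list distinct.\<close>

lemma path_exists:
  assumes "x \<in> K"
  shows "\<exists>ps. ps \<noteq> [] \<and> hd ps \<in> R \<union> Z \<and> last ps = x \<and> distinct ps \<and>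
    successively (\<lambda>x y. (x, y) \<in> A) ps \<and> (\<forall>y\<in>set ps. y \<in> K \<and> rank y \<le> rank x \<and> (hd ps, y) \<in> A\<^sup>*)"
  using assms
proof (induction "rank x" arbitrary: x rule: less_induct)
  case less
  show ?case
  proof (cases "x \<in> R \<union> Z")
    case True
    then show ?thesis using less.prems by (intro exI[of _ "[x]"]) simp
  next
    case False
    then have px: "p x \<in> K" "rank (p x) < rank x" "(p x, x) \<in> A"
      using p rank less.prems by (auto simp: A_iff)
    obtain ps where ps: "ps \<noteq> []" "hd ps \<in> R \<union> Z" "last ps = p x" "distinct ps"
      "successively (\<lambda>x y. (x, y) \<in> A) ps" "\<forall>y\<in>set ps. y \<in> K \<and> rank y \<le> rank (p x) \<and> (hd ps, y) \<in> A\<^sup>*"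
      using less.hyps[OF px(2,1)] by blast
    have "p x \<in> set ps" using ps(1,3) last_in_set by metis
    then have "(hd ps, x) \<in> A\<^sup>*" using ps(6) px(3) by (meson rtrancl.rtrancl_into_rtrancl)
    moreover have "x \<notin> set ps" using ps(6) px(2) by auto
    ultimately show ?thesis using ps px less.prems
      by (intro exI[of _ "ps @ [x]"]) (auto simp: successively_append_iff)
  qed
qed

text \<open>A path from \<open>R \<union> Z\<close> to \<open>x\<close> exists; as \<open>x\<close>
  descends from \<open>S\<close>, uniqueness of roots and their separation from \<open>Z\<close>
  force its start into \<open>S\<close>.\<close>

lemma part_path:
  assumes S: "S = Z \<or> (\<exists>r\<in>R. S = {r})" and x: "x \<in> comp S"
  shows "\<exists>ps. oriented_path (part S) ps \<and> hd ps \<in> S \<and> last ps = x"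
proof -
  have "x \<in> K" using x by (simp add: comp_def)
  from path_exists[OF this] obtain ps where ps: "ps \<noteq> []" "hd ps \<in> R \<union> Z" "last ps = x" "distinct ps"
    "successively (\<lambda>x y. (x, y) \<in> A) ps" "\<forall>y\<in>set ps. y \<in> K \<and> rank y \<le> rank x \<and> (hd ps, y) \<in> A\<^sup>*"
    by blast
  then have hx: "(hd ps, x) \<in> A\<^sup>*" by (metis last_in_set)
  obtain r where r: "r \<in> S" "(r, x) \<in> A\<^sup>*" using x by (auto simp: comp_def)
  have h: "hd ps \<in> S"
    using S
  proof
    assume "S = Z"
    then show ?thesis using root_not_Z[of "hd ps" r x] ps(2) hx r by auto
  next
    assume "\<exists>r\<in>R. S = {r}"
    then have "S = {r}" "r \<in> R" using r by auto
    then show ?thesis using root_not_Z[of r "hd ps" x] root_unique[of r "hd ps" x] ps(2) hx r by auto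
  qed
  then have sub: "set ps \<subseteq> comp S" using ps(6) by (auto simp: comp_def)
  have "successively (\<lambda>x y. (x, y) \<in> arcs (part S)) ps"
    using ps(5) by (rule successively_mono) (use sub in \<open>auto simp: part_def\<close>)
  then show ?thesis using ps(1,3,4) sub h by (intro exI[of _ ps]) (simp add: oriented_path_def part_def)
qed

text \<open>A vertex of maximal rank on a cycle would be the parent of one of its two neighbours there.\<close>

lemma cycle_sub_Z:
  assumes ys: "distinct ys" "length ys \<ge> 3" "underlying (cyclic_pairs ys) \<subseteq> underlying A"
  shows "set ys \<subseteq> Z"
proof (rule ccontr)
  assume "\<not> set ys \<subseteq> Z"
  then have "set ys - Z \<noteq> {}" by blast
  then obtain x where x: "x \<in> set ys - Z" and max: "\<And>y. y \<in> set ys - Z \<Longrightarrow> rank y \<le> rank x"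
    using obtains_MAX[of "set ys - Z" rank] Max_ge[of "rank ` (set ys - Z)"] by (metis finite_Diff finite_imageI finite_set imageI)
  obtain y z where yz: "y \<noteq> z" "y \<in> set ys" "z \<in> set ys" "{x, y} \<in> underlying A" "{x, z} \<in> underlying A"
    using cyclic_two_nbrs[OF ys(1,2)] x ys(3) by blast
  then obtain y' where y': "y' \<in> set ys" "(x, y') \<in> A"
    unfolding edge_underlying_iff A_iff by metis
  then have "y' \<notin> Z" using x pZ by (auto simp: A_iff)
  then have "rank x < rank y'" using y' rank by (auto simp: A_iff)
  then show False using max[of y'] y' \<open>y' \<notin> Z\<close> by auto
qed

lemma underlying_mono: "F \<subseteq> F' \<Longrightarrow> underlying F \<subseteq> underlying F'"
  by (auto simp: underlying_def)

lemma part_subgraph: "subgraph_of E (part S)"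
  using A_sub by (auto simp: subgraph_of_def part_def)

lemma part_arcs: "arcs (part S) \<subseteq> A" "verts (part S) = comp S"
  by (auto simp: part_def)

text \<open>Parents have weight above 1, so a vertex of weight 1 has no children and only the arc
  from its own parent remains.\<close>

lemma sdeg_weight_1:
  assumes "F \<subseteq> A" "w x = 1" "(p x, x) \<in> F" "arcs H = F"
  shows "sdeg H x = 1"
proof -
  have "y = p x" if "y \<in> nbrs F x" for y
  proof -
    have "(x, y) \<notin> F" using assms(1,2) p[of y] by (auto simp: A_iff)
    then show ?thesis using that assms(1) by (auto simp: mem_nbrs_iff A_iff)
  qed
  moreover have "p x \<in> nbrs F x" using assms by (auto simp: mem_nbrs_iff)
  ultimately have "nbrs F x = {p x}" by blast
  then show ?thesis using assms by (simp add: sdeg_def)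
qed

lemma part_ROT:
  assumes r: "r \<in> R"
  shows "ROT E w (part {r}) r"
proof -
  have rc: "r \<in> comp {r}" using r RK by (auto simp: comp_def)
  have cyc: "cycles (part {r}) = {}"
  proof (rule ccontr)
    assume "cycles (part {r}) \<noteq> {}"
    then obtain ys where ys: "distinct ys" "length ys \<ge> 3" "underlying (cyclic_pairs ys) \<subseteq> underlying (arcs (part {r}))"
      unfolding cycles_def by blast
    then have "set ys \<subseteq> Z" using cycle_sub_Z underlying_mono[OF part_arcs(1)] by (meson order_trans)
    moreover have h: "hd ys \<in> set ys" using ys(2) by (cases ys) auto
    moreover obtain y where "{hd ys, y} \<in> underlying (arcs (part {r}))"
      using cyclic_two_nbrs[OF ys(1,2) h] ys(3) by blast
    then have "hd ys \<in> comp {r}" unfolding edge_underlying_iff by (auto simp: part_def)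
    moreover have "Z \<subseteq> comp Z" using ZK by (rule sub_comp)
    ultimately show False using comp_disjoint_Z[OF r] by blast
  qed
  have wt: "sdeg (part {r}) x = 1 \<and> x \<noteq> r \<or> verts (part {r}) = {r} \<and> r = x"
    if x: "x \<in> verts (part {r})" and wx: "w x = 1" for x
  proof (cases "x = r")
    case True
    \<comment> \<open>A root of weight 1 has no outgoing arc, so its tree is a single
      vertex.\<close>
    have "y = r" if "(r, y) \<in> A\<^sup>*" for y
      using that
    proof (rule converse_rtranclE)
      fix z assume "(r, z) \<in> A"
      then show "y = r" using p[of z] wx True by (auto simp: A_iff)
    qed simp
    then have "comp {r} \<subseteq> {r}" by (auto simp: comp_def)
    then show ?thesis using rc True by (auto simp: part_arcs)
  next
    case False
    then have x': "x \<in> comp {r}" "x \<notin> R"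
      using x reach_R by (auto simp: part_arcs comp_def)
    then have "(p x, x) \<in> arcs (part {r})" using p_comp(2)[of x "{r}"] False by simp
    then show ?thesis using False sdeg_weight_1[OF part_arcs(1) wx] by blast
  qed
  have "\<exists>ps. oriented_path (part {r}) ps \<and> hd ps = r \<and> last ps = x" if "x \<in> verts (part {r})" for x
    using part_path[of "{r}" x] r that by (auto simp: part_arcs)
  then show ?thesis unfolding ROT_def using part_subgraph rc cyc wt by (simp add: part_arcs)
qed

lemma part_unicycle:
  assumes "Z \<noteq> {}"
  shows "unicycle_oriented E w (part Z)"
proof -
  obtain k m l where kml: "Z = {k, m, l}" "distinct [k, m, l]" "p m = k" "p l = m" "p k = l"
    using Z assms by blast
  have Zc: "Z \<subseteq> comp Z" using ZK by (rule sub_comp)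
  have arc: "(p x, x) \<in> arcs (part Z)" if "x \<in> comp Z" for x
    using p_comp(2)[of x Z] that comp_R by simp
  have arcs3: "(k, m) \<in> arcs (part Z)" "(m, l) \<in> arcs (part Z)" "(l, k) \<in> arcs (part Z)"
    using arc[of k] arc[of m] arc[of l] kml Zc by auto
  have oc: "oriented_cycle (part Z) [k, m, l]"
    using arcs3 kml Zc by (simp add: oriented_cycle_def oriented_path_def part_arcs)
  have cyc: "cycles (part Z) = {underlying (cyclic_pairs [k, m, l])}"
  proof
    show "{underlying (cyclic_pairs [k, m, l])} \<subseteq> cycles (part Z)"
    proof -
      have "underlying (cyclic_pairs [k, m, l]) \<subseteq> underlying (arcs (part Z))"
        unfolding underlying_cyclic_pairs_3 using arcs3 by (simp add: edge_underlying_iff)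
      moreover have "length [k, m, l] \<ge> 3" by simp
      ultimately show ?thesis unfolding cycles_def using kml(2) by blast
    qed
    show "cycles (part Z) \<subseteq> {underlying (cyclic_pairs [k, m, l])}"
    proof
      fix c assume "c \<in> cycles (part Z)"
      then obtain ys where ys: "c = underlying (cyclic_pairs ys)" "distinct ys" "length ys \<ge> 3"
        "underlying (cyclic_pairs ys) \<subseteq> underlying (arcs (part Z))"
        unfolding cycles_def by blast
      then have sub: "set ys \<subseteq> Z" using cycle_sub_Z underlying_mono[OF part_arcs(1)] by (meson order_trans)
      \<comment> \<open>A cycle inside the three-element set \<open>Z\<close> uses all of it, and
        every cyclic order of three vertices has the same three edges.\<close>
      have "length ys = card (set ys)" using ys(2) by (simp add: distinct_card)
      moreover have "card (set ys) \<le> card Z" using sub by (intro card_mono) auto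
      moreover have "card Z = 3" using kml by auto
      ultimately have len: "length ys = 3" "card (set ys) = card Z" using ys(3) by auto
      then have seteq: "set ys = Z" using sub by (intro card_subset_eq) auto
      obtain a b d where abd: "ys = [a, b, d]" using len(1) by (auto simp: length_Suc_conv numeral_3_eq_3)
      have "{{a, b}, {b, d}, {d, a}} = {{k, m}, {m, l}, {l, k}}"
      proof -
        have all: "a \<in> {k, m, l}" "b \<in> {k, m, l}" "d \<in> {k, m, l}" "a \<noteq> b" "b \<noteq> d" "a \<noteq> d"
          using seteq kml(1) ys(2) abd by auto
        then show ?thesis by (elim insertE emptyE; simp; simp add: insert_commute)
      qed
      then show "c \<in> {underlying (cyclic_pairs [k, m, l])}"
        unfolding ys(1) abd by (simp only: underlying_cyclic_pairs_3 singleton_iff)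
    qed
  qed
  have path: "\<exists>ps. oriented_path (part Z) ps \<and> hd ps \<in> set [k, m, l] \<and> last ps = x"
    if "x \<in> verts (part Z)" for x
    using part_path[of Z x] that kml(1) by (simp add: part_arcs)
  have wt: "sdeg (part Z) x = 1" if "x \<in> verts (part Z)" "w x = 1" for x
    using sdeg_weight_1[OF part_arcs(1) that(2) _ refl, of Z] arc[of x] that(1) part_arcs by simp
  show ?thesis unfolding unicycle_oriented_def
    using part_subgraph oc cyc path wt by blast
qed

text \<open>A vertex of degree at least two, or a root of degree one, has an outgoing arc, so it is
  \<open>p x\<close> for some \<open>x\<close> and \<open>outp\<close> controls its out-neighbours.
  The bijection \<open>f\<close> enumerates the roots to index the trees.\<close>

lemma star_semi_forest_exists:
  assumes u: "\<And>r. r \<in> R \<Longrightarrow> u r \<notin> K \<and> u r \<in> nbrs E r"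
    and W: "W1 \<union> W2 = u ` R" "W1 \<inter> W2 = {}" "stable E W1" "W2 \<subseteq> Vplus w"
    and uW2: "\<And>r. r \<in> R \<Longrightarrow> u r \<in> W2 \<Longrightarrow> (u r, r) \<in> E"
    and outW: "\<And>y. y \<in> W2 \<Longrightarrow> outN E y \<inter> W1 = {}"
    and outp: "\<And>x. x \<in> K \<Longrightarrow> x \<notin> R \<Longrightarrow> outN E (p x) \<inter> W1 = {}"
  shows "\<exists>H. generating_star_semi_forest E w K H"
proof -
  obtain f where f: "bij_betw f {..<card R} R"
    using ex_bij_betw_nat_finite[of R] by (auto simp: atLeast0LessThan)
  let ?r = "card R"
  let ?s = "if Z = {} then 0 else 1 :: nat"
  have fR: "f i \<in> R" if "i < ?r" for i using f that by (auto simp: bij_betw_def)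
  have finj: "f i \<noteq> f j" if "i < ?r" "j < ?r" "i \<noteq> j" for i j
    using f that by (auto simp: bij_betw_def inj_on_def)
  have fim: "f ` {..<?r} = R" using f by (simp add: bij_betw_def)
  define H where "H = \<lparr>verts = K, arcs = (\<Union>i<?r. arcs (part {f i})) \<union> (\<Union>j<?s. arcs (part Z))\<rparr>"
  have vH: "verts H = (\<Union>i<?r. verts (part {f i})) \<union> (\<Union>j<?s. verts (part Z))"
  proof -
    have "x \<in> (\<Union>r\<in>R. comp {r}) \<union> comp Z" if x: "x \<in> K" for x
    proof -
      obtain ps where "ps \<noteq> []" "hd ps \<in> R \<union> Z" "last ps = x" "\<forall>y\<in>set ps. (hd ps, y) \<in> A\<^sup>*"
        using path_exists[OF x] by blast
      then have "hd ps \<in> R \<union> Z" "(hd ps, x) \<in> A\<^sup>*" by (auto dest: last_in_set)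
      then show ?thesis using x by (auto simp: comp_def)
    qed
    moreover have "comp S \<subseteq> K" for S by (auto simp: comp_def)
    ultimately have "K = (\<Union>r\<in>R. comp {r}) \<union> comp Z" by blast
    moreover have "(\<Union>j<?s. verts (part Z)) = comp Z" by (auto simp: part_arcs comp_def)
    moreover have "(\<Union>i<?r. verts (part {f i})) = (\<Union>r\<in>R. comp {r})"
    proof -
      have "(\<Union>r\<in>f ` {..<?r}. comp {r}) = (\<Union>i<?r. comp {f i})" by simp
      then show ?thesis unfolding fim part_arcs by simp
    qed
    moreover have "verts H = K" by (simp add: H_def)
    ultimately show ?thesis by metis
  qed
  have aH: "arcs H \<subseteq> A" using part_arcs(1) by (auto simp: H_def)
  let ?Ht = "{x \<in> verts H. sdeg H x \<ge> 2} \<union> {f i | i. i < ?r \<and> sdeg H (f i) = 1}"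
  have Ht: "outN E x \<inter> W1 = {}" if x: "x \<in> ?Ht" for x
  proof -
    have "\<exists>y. (x, y) \<in> A"
    proof (rule ccontr)
      assume "\<nexists>y. (x, y) \<in> A"
      then have N: "nbrs (arcs H) x \<subseteq> {y. (y, x) \<in> A}" using aH unfolding nbrs_def inN_def outN_def by blast
      show False
      proof (cases "x \<in> R")
        case True
        then have "nbrs (arcs H) x = {}" using N by (auto simp: A_iff)
        then show False using x by (auto simp: sdeg_def)
      next
        case False
        then have "sdeg H x \<ge> 2" using x fR by auto
        moreover have "nbrs (arcs H) x \<subseteq> {p x}" using N by (auto simp: A_iff)
        then have "sdeg H x \<le> 1" unfolding sdeg_def using card_mono[of "{p x}" "nbrs (arcs H) x"] by simp
        ultimately show False by simp
      qed
    qed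
    then show ?thesis using outp by (auto simp: A_iff)
  qed
  have "star_semi_forest E w H"
    unfolding star_semi_forest_def
  proof (intro exI conjI)
    show "\<forall>i<?r. ROT E w (part {f i}) (f i)" using part_ROT fR by blast
    show "\<forall>j<?s. unicycle_oriented E w (part Z)" using part_unicycle by auto
    show "verts H = (\<Union>i<?r. verts (part {f i})) \<union> (\<Union>j<?s. verts (part Z))" by (rule vH)
    show "arcs H = (\<Union>i<?r. arcs (part {f i})) \<union> (\<Union>j<?s. arcs (part Z))" by (simp add: H_def)
    show "disjoint_family_on (\<lambda>i. verts (part {f i})) {..<?r}"
      unfolding disjoint_family_on_def part_arcs using comp_disjoint fR finj by simp
    show "disjoint_family_on (\<lambda>j. verts (part Z)) {..<?s}"
      by (auto simp: disjoint_family_on_def)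
    show "\<forall>i<?r. \<forall>j<?s. verts (part {f i}) \<inter> verts (part Z) = {}"
      unfolding part_arcs using comp_disjoint_Z fR by simp
    show "\<forall>i<?r. (u \<circ> f) i \<notin> verts H \<and> (u \<circ> f) i \<in> nbrs E (f i)"
      using u fR by (simp add: H_def)
    show "W1 \<union> W2 = (u \<circ> f) ` {..<?r}" by (metis W(1) fim image_comp)
    show "W1 \<inter> W2 = {}" "stable E W1" "W2 \<subseteq> Vplus w" by (fact W)+
    show "\<forall>i<?r. (u \<circ> f) i \<in> W2 \<longrightarrow> ((u \<circ> f) i, f i) \<in> E" using uW2 fR by simp
    show "let Ht = ?Ht in (\<Union>x \<in> W2 \<union> Ht. outN E x) \<inter> W1 = {}"
      unfolding Let_def using Ht outW by blast
  qed
  then show ?thesis unfolding generating_star_semi_forest_def by (intro exI[of _ H]) (simp add: H_def)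
qed

end

text \<open>Any vertex \<open>k\<close> of maximal out-degree will do.\<close>

lemma tournament_king:
  fixes E :: "('v::finite \<times> 'v) set"
  assumes asym: "asym E" and ne: "S \<noteq> {}"
    and tour: "\<And>x y. x \<in> S \<Longrightarrow> y \<in> S \<Longrightarrow> x \<noteq> y \<Longrightarrow> (x, y) \<in> E \<or> (y, x) \<in> E"
  shows "\<exists>k\<in>S. \<forall>x\<in>S. x \<noteq> k \<longrightarrow> (k, x) \<in> E \<or> (\<exists>m\<in>S. (k, m) \<in> E \<and> (m, x) \<in> E)"
proof -
  let ?d = "\<lambda>x. card (outN E x \<inter> S)"
  obtain k where k: "k \<in> S" and max: "\<And>x. x \<in> S \<Longrightarrow> ?d x \<le> ?d k"
    using obtains_MAX[of S ?d] ne Max_ge[of "?d ` S"] by (metis finite finite_imageI imageI)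
  have "(k, x) \<in> E \<or> (\<exists>m\<in>S. (k, m) \<in> E \<and> (m, x) \<in> E)" if x: "x \<in> S" "x \<noteq> k" for x
  proof (rule ccontr)
    assume no: "\<not> ?thesis"
    then have xk: "(x, k) \<in> E" using tour[OF x(1) k x(2)] by blast
    have "m \<in> outN E x" if "m \<in> outN E k" "m \<in> S" for m
    proof -
      have "(k, m) \<in> E" using that by (simp add: outN_def)
      then have "m \<noteq> x" "(m, x) \<notin> E" using no that by auto
      then show ?thesis using tour[OF that(2) x(1)] by (simp add: outN_def)
    qed
    \<comment> \<open>\<open>x\<close> beats \<open>k\<close> and all that \<open>k\<close> beats,
      so its out-degree is strictly larger.\<close>
    then have "insert k (outN E k \<inter> S) \<subseteq> outN E x \<inter> S" using xk k by (auto simp: outN_def)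
    then have "card (insert k (outN E k \<inter> S)) \<le> ?d x" by (intro card_mono) auto
    moreover have "(k, k) \<notin> E" using asym by (meson asymD)
    then have "k \<notin> outN E k \<inter> S" by (simp add: outN_def)
    ultimately show False using max[OF x(1)] by simp
  qed
  then show ?thesis using k by blast
qed

text \<open>Each vertex of \<open>K\<close> has a suitable outer vertex (these vertices form
  \<open>R\<close>) or, by strongness, a \<open>good\<close> predecessor in \<open>K\<close>. What
  is reached from \<open>R\<close> along such arcs forms trees, by breadth-first distance. Every
  vertex of the rest \<open>U\<close> has a good predecessor in \<open>U\<close>, and
  \<open>U\<close> becomes a single component around a triangle.\<close>

lemma strong_cover_imp_star_semi_forest:
  fixes E :: "('v::finite \<times> 'v) set"
  assumes asym: "asym E" and compl: "complete_on (underlying E) K"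
    and C: "strong_cover E w C" and KC: "K \<subseteq> C"
  shows "\<exists>H. generating_star_semi_forest E w K H"
proof -
  define good where "good y \<longleftrightarrow> y \<in> Vplus w \<and> outN E y \<subseteq> C" for y
  \<comment> \<open>The outer vertex will be a neighbour outside \<open>C\<close>, destined for
    \<open>W1\<close>, or a good in-neighbour outside \<open>K\<close>, destined for
    \<open>W2\<close>.\<close>
  define R where "R = {x \<in> K. \<not> nbrs E x \<subseteq> C \<or> (\<exists>y. y \<notin> K \<and> (y, x) \<in> E \<and> good y)}"
  have pred: "\<exists>y\<in>K. (y, x) \<in> E \<and> good y" if x: "x \<in> K" "x \<notin> R" for x
  proof -
    have "nbrs E x \<subseteq> C" "x \<in> C" using x KC by (auto simp: R_def)
    then obtain y where "(y, x) \<in> E" "good y"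
      using strong_coverD[OF C, of x] unfolding good_def by metis
    then show ?thesis using x by (auto simp: R_def)
  qed
  define F where "F = {(y, x). x \<in> K \<and> x \<notin> R \<and> y \<in> K \<and> (y, x) \<in> E \<and> good y}"
  define Y where "Y = {x \<in> K. \<exists>n. \<exists>r\<in>R. (r, x) \<in> F ^^ n}"
  define dist where "dist x = (LEAST n. \<exists>r\<in>R. (r, x) \<in> F ^^ n)" for x
  have Ypred: "\<exists>y\<in>Y. (y, x) \<in> E \<and> good y \<and> dist y < dist x" if x: "x \<in> Y" "x \<notin> R" for x
  proof -
    have "\<exists>r\<in>R. (r, x) \<in> F ^^ dist x"
      unfolding dist_def by (rule LeastI_ex) (use x in \<open>auto simp: Y_def\<close>)
    then obtain r where r: "r \<in> R" "(r, x) \<in> F ^^ dist x" by blast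
    then obtain n where n: "dist x = Suc n" using x(2) by (cases "dist x") auto
    then obtain y where y: "(r, y) \<in> F ^^ n" "(y, x) \<in> F" using r(2) by auto
    then have "dist y \<le> n" unfolding dist_def using r(1) by (intro Least_le) blast
    moreover have "y \<in> Y" using y r(1) by (auto simp: Y_def F_def)
    ultimately show ?thesis using y(2) n by (intro bexI[of _ y]) (auto simp: F_def)
  qed
  define U where "U = K - Y"
  have RY: "R \<subseteq> Y"
  proof
    fix r assume "r \<in> R"
    then have "(r, r) \<in> F ^^ 0" "r \<in> K" by (auto simp: R_def)
    then show "r \<in> Y" unfolding Y_def using \<open>r \<in> R\<close> by blast
  qed
  have Upred: "\<exists>y\<in>U. (y, x) \<in> E \<and> good y" if x: "x \<in> U" for x
  proof -
    have x': "x \<in> K" "x \<notin> R" "x \<notin> Y" using x RY by (auto simp: U_def)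
    then obtain y where y: "y \<in> K" "(y, x) \<in> E" "good y" using pred by blast
    then have "(y, x) \<in> F" using x' by (simp add: F_def)
    have "y \<notin> Y"
    proof
      assume "y \<in> Y"
      then obtain n r where "r \<in> R" "(r, y) \<in> F ^^ n" by (auto simp: Y_def)
      then have "(r, x) \<in> F ^^ Suc n" using \<open>(y, x) \<in> F\<close> by auto
      then show False using x' \<open>r \<in> R\<close> unfolding Y_def by blast
    qed
    then show ?thesis using y by (auto simp: U_def)
  qed
  have "\<exists>Z rank q. Z \<subseteq> U \<and> (Z = {} \<or> (\<exists>k m l. Z = {k, m, l} \<and> distinct [k, m, l] \<and>
      (k, m) \<in> E \<and> (m, l) \<in> E \<and> (l, k) \<in> E \<and> good k \<and> good m \<and> good l)) \<and> (\<forall>x\<in>Z. rank x = (0::nat)) \<and>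
      (\<forall>x\<in>U - Z. q x \<in> U \<and> (q x, x) \<in> E \<and> good (q x) \<and> rank (q x) < rank x)"
  proof (cases "U = {}")
    case True
    then show ?thesis by (intro exI[of _ "{}"]) simp
  next
    case False
    define S where "S = {x \<in> U. good x}"
    have "S \<noteq> {}" using False Upred by (auto simp: S_def)
    moreover have "(x, y) \<in> E \<or> (y, x) \<in> E" if "x \<in> S" "y \<in> S" "x \<noteq> y" for x y
      using compl that unfolding complete_on_def edge_underlying_iff by (auto simp: S_def U_def)
    ultimately obtain k where k: "k \<in> S"
      and king: "\<And>x. x \<in> S \<Longrightarrow> x \<noteq> k \<Longrightarrow> (k, x) \<in> E \<or> (\<exists>m\<in>S. (k, m) \<in> E \<and> (m, x) \<in> E)"
      using tournament_king[OF asym, of S] by blast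
    \<comment> \<open>\<open>l\<close> beats \<open>k\<close>, so the king reaches \<open>l\<close>
      only through some \<open>m\<close>, which closes the triangle \<open>k\<close>,
      \<open>m\<close>, \<open>l\<close>.\<close>
    obtain l where l: "l \<in> S" "(l, k) \<in> E" using Upred[of k] k by (auto simp: S_def)
    have irr: "(x, x) \<notin> E" for x using asym by (meson asymD)
    have "(k, l) \<notin> E" using l asym by (meson asymD)
    moreover have "l \<noteq> k" using l irr by auto
    ultimately obtain m where m: "m \<in> S" "(k, m) \<in> E" "(m, l) \<in> E" using king[OF l(1)] by blast
    have dist: "distinct [k, m, l]" using \<open>l \<noteq> k\<close> m irr by auto
    \<comment> \<open>Rank 0 is the triangle, rank 1 the good vertices beaten by \<open>k\<close>,
      rank 2 the other good ones, rank 3 the rest of \<open>U\<close>. The parents for ranks 1, 2, 3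
      are \<open>k\<close>, the intermediate vertex of the king property, and any good predecessor
      in \<open>U\<close>.\<close>
    define rank where "rank x = (if x \<in> {k, m, l} then 0 else if x \<in> S \<and> (k, x) \<in> E then 1
       else if x \<in> S then 2 else 3 :: nat)" for x
    have "\<exists>y. y \<in> U \<and> (y, x) \<in> E \<and> good y \<and> rank y < rank x" if x: "x \<in> U - {k, m, l}" for x
    proof -
      consider "x \<in> S" "(k, x) \<in> E" | "x \<in> S" "(k, x) \<notin> E" | "x \<notin> S" by blast
      then show ?thesis
      proof cases
        case 1
        then show ?thesis using k x by (intro exI[of _ k]) (auto simp: S_def rank_def)
      next
        case 2
        then obtain y where "y \<in> S" "(k, y) \<in> E" "(y, x) \<in> E" using king[OF 2(1)] x by blast
        then show ?thesis using 2 x by (intro exI[of _ y]) (auto simp: S_def rank_def)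
      next
        case 3
        obtain y where "y \<in> U" "(y, x) \<in> E" "good y" using Upred x by blast
        then show ?thesis using 3 x by (intro exI[of _ y]) (auto simp: S_def rank_def)
      qed
    qed
    then obtain q where "\<forall>x\<in>U - {k, m, l}. q x \<in> U \<and> (q x, x) \<in> E \<and> good (q x) \<and> rank (q x) < rank x"
      by metis
    moreover have "{k, m, l} \<subseteq> U" "good k" "good m" "good l" using k l m by (auto simp: S_def)
    moreover have "\<forall>x\<in>{k, m, l}. rank x = 0" by (simp add: rank_def)
    ultimately show ?thesis using dist l(2) m(2,3)
      by (intro exI[of _ "{k, m, l}"] exI[of _ rank] exI[of _ q]) blast
  qed
  then obtain Z rank q where ZU: "Z \<subseteq> U"
    and Z: "Z = {} \<or> (\<exists>k m l. Z = {k, m, l} \<and> distinct [k, m, l] \<and>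
      (k, m) \<in> E \<and> (m, l) \<in> E \<and> (l, k) \<in> E \<and> good k \<and> good m \<and> good l)"
    and rankZ: "\<forall>x\<in>Z. rank x = (0::nat)"
    and q: "\<forall>x\<in>U - Z. q x \<in> U \<and> (q x, x) \<in> E \<and> good (q x) \<and> rank (q x) < rank x"
    by blast
  obtain q' where q': "\<forall>x\<in>Y - R. q' x \<in> Y \<and> (q' x, x) \<in> E \<and> good (q' x) \<and> dist (q' x) < dist x"
    using Ypred by (metis DiffD1 DiffD2)
  \<comment> \<open>Parents stay inside \<open>Y\<close> and inside \<open>U\<close>, so the two
    ranks need not be comparable.\<close>
  define rk where "rk x = (if x \<in> Y then dist x else rank x)" for x
  define p0 where "p0 x = (if x \<in> Y then q' x else q x)" for x
  have YK: "Y \<subseteq> K" "U \<inter> Y = {}" "Y \<union> U = K" by (auto simp: Y_def U_def)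
  have p0: "p0 x \<in> K \<and> (p0 x, x) \<in> E \<and> good (p0 x) \<and> rk (p0 x) < rk x" if x: "x \<in> K" "x \<notin> R" "x \<notin> Z" for x
  proof (cases "x \<in> Y")
    case True
    then have "p0 x \<in> Y \<and> (p0 x, x) \<in> E \<and> good (p0 x) \<and> dist (p0 x) < dist x"
      using q' x by (simp add: p0_def)
    then show ?thesis using True YK by (auto simp: rk_def)
  next
    case False
    then have "x \<in> U - Z" using x YK by auto
    then have "p0 x \<in> U \<and> (p0 x, x) \<in> E \<and> good (p0 x) \<and> rank (p0 x) < rank x"
      using q False by (simp add: p0_def)
    moreover from this have "p0 x \<notin> Y" using YK by auto
    ultimately show ?thesis using False YK by (auto simp: rk_def)
  qed
  have ZR: "Z \<inter> R = {}" using ZU RY YK by blast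
  have "\<exists>p. (\<forall>x\<in>K - R. p x \<in> K \<and> (p x, x) \<in> E \<and> good (p x)) \<and> (\<forall>x\<in>K - R - Z. rk (p x) < rk x) \<and>
     (Z = {} \<or> (\<exists>k m l. Z = {k, m, l} \<and> distinct [k, m, l] \<and> p m = k \<and> p l = m \<and> p k = l))"
    using Z
  proof
    assume "Z = {}"
    then show ?thesis using p0 by (intro exI[of _ p0]) simp
  next
    assume "\<exists>k m l. Z = {k, m, l} \<and> distinct [k, m, l] \<and>
      (k, m) \<in> E \<and> (m, l) \<in> E \<and> (l, k) \<in> E \<and> good k \<and> good m \<and> good l"
    then obtain k m l where kml: "Z = {k, m, l}" "distinct [k, m, l]" "(k, m) \<in> E" "(m, l) \<in> E" "(l, k) \<in> E"
      "good k" "good m" "good l" by blast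
    define p where "p = p0(m := k, l := m, k := l)"
    have pZ: "p m = k" "p l = m" "p k = l" using kml(2) by (auto simp: p_def)
    have p1: "p x = p0 x" if "x \<notin> Z" for x using that kml(1) by (simp add: p_def)
    have ZK: "k \<in> K" "m \<in> K" "l \<in> K" using ZU YK kml(1) by auto
    have "p x \<in> K \<and> (p x, x) \<in> E \<and> good (p x)" if "x \<in> K - R" for x
    proof (cases "x \<in> Z")
      case True
      then show ?thesis using kml ZK pZ by auto
    next
      case False
      then show ?thesis using p0 p1 that by simp
    qed
    moreover have "rk (p x) < rk x" if "x \<in> K - R - Z" for x using p0 p1 that by simp
    ultimately show ?thesis using pZ kml(1,2) by (intro exI[of _ p]) blast
  qed
  then obtain p where pG: "\<And>x. x \<in> K - R \<Longrightarrow> p x \<in> K \<and> (p x, x) \<in> E \<and> good (p x)"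
    and prk: "\<And>x. x \<in> K - R - Z \<Longrightarrow> rk (p x) < rk x"
    and pZ: "Z = {} \<or> (\<exists>k m l. Z = {k, m, l} \<and> distinct [k, m, l] \<and> p m = k \<and> p l = m \<and> p k = l)"
    by blast
  interpret parent_map E w K R Z p rk
  proof
    show "asym E" by (fact asym)
    show "R \<subseteq> K" by (auto simp: R_def)
    show "Z \<subseteq> K" using ZU YK by blast
    show "Z \<inter> R = {}" by (fact ZR)
    show "p x \<in> K \<and> (p x, x) \<in> E \<and> 1 < w (p x)" if "x \<in> K" "x \<notin> R" for x
      using pG[of x] that by (simp add: good_def Vplus_def)
    show "rk (p x) < rk x" if "x \<in> K" "x \<notin> R" "x \<notin> Z" for x using prk that by simp
    show "rk x = 0" if "x \<in> Z" for x
    proof -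
      have "x \<notin> Y" using that ZU YK by blast
      then show ?thesis using that rankZ by (simp add: rk_def)
    qed
  qed (fact pZ)
  have "\<exists>y. y \<notin> K \<and> y \<in> nbrs E r \<and> (y \<in> C \<longrightarrow> (y, r) \<in> E \<and> good y)" if r: "r \<in> R" for r
  proof (cases "nbrs E r \<subseteq> C")
    case True
    then obtain y where "y \<notin> K" "(y, r) \<in> E" "good y" using r by (auto simp: R_def)
    then show ?thesis by (auto simp: mem_nbrs_iff)
  next
    case False
    then show ?thesis using KC by blast
  qed
  then obtain u where u: "\<And>r. r \<in> R \<Longrightarrow> u r \<notin> K \<and> u r \<in> nbrs E r \<and> (u r \<in> C \<longrightarrow> (u r, r) \<in> E \<and> good (u r))"
    by metis
  have cov: "vertex_cover E C" using C by (simp add: strong_cover_def)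
  show ?thesis
  \<comment> \<open>The outer vertices are split by membership in \<open>C\<close>: those outside
    are stable since \<open>C\<close> is a cover, and no good vertex has an arc to them.\<close>
  proof (rule star_semi_forest_exists[of u "u ` R - C" "u ` R \<inter> C"])
    show "u r \<notin> K \<and> u r \<in> nbrs E r" if "r \<in> R" for r using u that by simp
    show "u ` R - C \<union> u ` R \<inter> C = u ` R" "(u ` R - C) \<inter> (u ` R \<inter> C) = {}" by auto
    show "stable E (u ` R - C)"
      unfolding stable_def using vertex_cover_edge[OF cov] by blast
    show "u ` R \<inter> C \<subseteq> Vplus w" using u by (auto simp: good_def)
    show "(u r, r) \<in> E" if "r \<in> R" "u r \<in> u ` R \<inter> C" for r using u[OF that(1)] that(2) by simp
    show "outN E y \<inter> (u ` R - C) = {}" if "y \<in> u ` R \<inter> C" for y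
      using that u by (auto simp: good_def)
    show "outN E (p x) \<inter> (u ` R - C) = {}" if "x \<in> K" "x \<notin> R" for x
      using pG[of x] that by (auto simp: good_def)
  qed
qed

section \<open>Strong vertex covers of SCQ graphs\<close>

lemma complete_on_vertex_cover:
  fixes E :: "('v::finite \<times> 'v) set"
  assumes "complete_on (underlying E) Y" "vertex_cover E C"
  shows "card Y \<le> Suc (card (C \<inter> Y))"
proof -
  have "card (Y - C) \<le> 1"
  proof (rule ccontr)
    assume "\<not> ?thesis"
    then obtain x y where "x \<in> Y - C" "y \<in> Y - C" "x \<noteq> y"
      by (metis One_nat_def card_le_Suc0_iff_eq finite)
    then show False using assms vertex_cover_edge[of E C x y] by (auto simp: complete_on_def)
  qed
  moreover have "card Y = card (C \<inter> Y) + card (Y - C)"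
    by (metis card_Int_Diff finite inf_commute)
  ultimately show ?thesis by simp
qed

lemma C5_vertex_cover:
  fixes E :: "('v::finite \<times> 'v) set"
  assumes I: "induced_C5 (underlying E) a b c d e" and C: "vertex_cover E C"
  shows "3 \<le> card (C \<inter> {a, b, c, d, e})"
proof -
  have edges: "a \<in> C \<or> b \<in> C" "b \<in> C \<or> c \<in> C" "c \<in> C \<or> d \<in> C" "d \<in> C \<or> e \<in> C" "e \<in> C \<or> a \<in> C"
    using I vertex_cover_edge[OF C] unfolding induced_C5_def by blast+
  have d: "distinct [a, b, c, d, e]" using I by (simp add: induced_C5_def)
  have three: ?thesis if "{x, y, z} \<subseteq> C \<inter> {a, b, c, d, e}" "distinct [x, y, z]" for x y z
    using card_mono[OF _ that(1)] that(2) by simp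
  show ?thesis
  proof (cases "a \<in> C")
    case True
    then consider "b \<in> C" "d \<in> C" | "b \<in> C" "e \<in> C" | "c \<in> C" "d \<in> C" | "c \<in> C" "e \<in> C" using edges by blast
    then show ?thesis
      using True d three[of a b d] three[of a b e] three[of a c d] three[of a c e] by cases auto
  next
    case False
    then have "b \<in> C" "e \<in> C" "c \<in> C \<or> d \<in> C" using edges by auto
    then show ?thesis using d three[of b c e] three[of b d e] by auto
  qed
qed

text \<open>An inclusion-minimal cover cannot spare any vertex.\<close>

lemma exists_minimal_vertex_cover:
  fixes E :: "('v::finite \<times> 'v) set"
  assumes asym: "asym E"
  shows "\<exists>M. vertex_cover E M \<and> (\<forall>x\<in>M. \<not> nbrs E x \<subseteq> M)"
proof -
  have "finite {M. vertex_cover E M}" "UNIV \<in> {M. vertex_cover E M}"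
    by (auto simp: vertex_cover_def)
  then obtain M where M: "vertex_cover E M" and min: "\<And>M'. vertex_cover E M' \<Longrightarrow> M' \<subseteq> M \<Longrightarrow> M = M'"
    using finite_has_minimal[of "{M. vertex_cover E M}"] by (metis empty_iff mem_Collect_eq)
  have "\<not> nbrs E x \<subseteq> M" if x: "x \<in> M" for x
  proof
    assume nb: "nbrs E x \<subseteq> M"
    have irr: "(x, x) \<notin> E" using asym by (meson asymD)
    have "vertex_cover E (M - {x})"
      unfolding vertex_cover_def
    proof (intro allI impI)
      fix a b assume ab: "(a, b) \<in> E"
      then have "a \<in> M \<or> b \<in> M" using M unfolding vertex_cover_def by blast
      moreover have "a = x \<Longrightarrow> b \<in> M" "b = x \<Longrightarrow> a \<in> M"
        using nb ab by (auto simp: nbrs_def outN_def inN_def)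
      ultimately show "a \<in> M - {x} \<or> b \<in> M - {x}" using irr ab by auto
    qed
    then show False using min[of "M - {x}"] x by blast
  qed
  then show ?thesis using M by blast
qed

text \<open>For a vertex cover this means meeting the part in as few vertices as any cover can: all
  but one in a complete part, three in a 5-cycle.\<close>

definition tight :: "'v set set \<Rightarrow> 'v set set \<Rightarrow> 'v set \<Rightarrow> 'v set \<Rightarrow> bool" where
  "tight G Q C Y \<longleftrightarrow> (Y \<in> simplexes G \<union> Q \<longrightarrow> \<not> Y \<subseteq> C) \<and> (Y \<in> basic_C5s G \<longrightarrow> card (C \<inter> Y) \<le> 3)"

lemma basic_C5sD:
  assumes "V \<in> basic_C5s G"
  shows "\<exists>a b c d e. induced_C5 G a b c d e \<and> V = {a, b, c, d, e}"
    "x \<in> V \<Longrightarrow> y \<in> V \<Longrightarrow> {x, y} \<in> G \<Longrightarrow> gdeg G x < 3 \<or> gdeg G y < 3"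
proof -
  obtain a b c d e where *: "induced_C5 G a b c d e" "V = {a, b, c, d, e}"
    "\<not> (\<exists>x\<in>V. \<exists>y\<in>V. {x, y} \<in> G \<and> gdeg G x \<ge> 3 \<and> gdeg G y \<ge> 3)"
    using assms unfolding basic_C5s_def by blast
  show "\<exists>a b c d e. induced_C5 G a b c d e \<and> V = {a, b, c, d, e}" using *(1,2) by blast
  show "x \<in> V \<Longrightarrow> y \<in> V \<Longrightarrow> {x, y} \<in> G \<Longrightarrow> gdeg G x < 3 \<or> gdeg G y < 3"
    using *(3) not_less by blast
qed

lemma basic_C5_strong_cover:
  fixes E :: "('v::finite \<times> 'v) set"
  assumes "asym E" "V \<in> basic_C5s (underlying E)" "star_property E w V" "strong_cover E w C"
  shows "card (C \<inter> V) \<le> 3"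
proof -
  obtain a b c d e where V: "induced_C5 (underlying E) a b c d e" "V = {a, b, c, d, e}"
    using basic_C5sD(1)[OF assms(2)] by metis
  show ?thesis
    by (rule C5_star_imp_strong_cover[OF assms(1) _ assms(3,4) V]) (rule basic_C5sD(2)[OF assms(2)])
qed

lemma simplex_or_edge_complete:
  assumes "matching G Q" "Y \<in> simplexes G \<union> Q" "\<And>e. e \<in> G \<Longrightarrow> \<exists>a b. e = {a, b}"
  shows "complete_on G Y"
  using assms(2)
proof
  assume "Y \<in> simplexes G"
  then show ?thesis by (auto simp: simplexes_def simplicial_def)
next
  assume "Y \<in> Q"
  then have "Y \<in> G" using assms(1) by (auto simp: matching_def)
  moreover from this obtain a b where "Y = {a, b}" using assms(3) by blast
  ultimately show ?thesis by (auto simp: complete_on_def insert_commute)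
qed

lemma tight_minimal:
  fixes E :: "('v::finite \<times> 'v) set"
  assumes Q: "matching (underlying E) Q" and Y: "Y \<in> simplexes (underlying E) \<union> basic_C5s (underlying E) \<union> Q"
    and C: "tight (underlying E) Q C Y" and C': "vertex_cover E C'"
  shows "card (C \<inter> Y) \<le> card (C' \<inter> Y)"
proof (cases "Y \<in> basic_C5s (underlying E)")
  case True
  then have "card (C \<inter> Y) \<le> 3" using C by (simp add: tight_def)
  also have "3 \<le> card (C' \<inter> Y)" using basic_C5sD(1)[OF True] C5_vertex_cover[OF _ C'] by metis
  finally show ?thesis .
next
  case False
  then have Y': "Y \<in> simplexes (underlying E) \<union> Q" using Y by blast
  have "complete_on (underlying E) Y"
    by (rule simplex_or_edge_complete[OF Q Y']) (auto simp: underlying_def)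
  then have "card Y \<le> Suc (card (C' \<inter> Y))" using C' by (rule complete_on_vertex_cover)
  moreover have "C \<inter> Y \<subset> Y" using C Y' by (auto simp: tight_def)
  then have "card (C \<inter> Y) < card Y" by (intro psubset_card_mono) auto
  ultimately show ?thesis by simp
qed

lemma card_partition:
  fixes C :: "'v::finite set"
  assumes "partition_on UNIV P"
  shows "card C = (\<Sum>Y\<in>P. card (C \<inter> Y))"
proof -
  have "C = (\<Union>Y\<in>P. C \<inter> Y)" using assms by (auto simp: partition_on_def)
  also have "card \<dots> = (\<Sum>Y\<in>P. card (C \<inter> Y))"
  proof (rule card_UN_disjoint)
    show "\<forall>Y\<in>P. \<forall>Y'\<in>P. Y \<noteq> Y' \<longrightarrow> (C \<inter> Y) \<inter> (C \<inter> Y') = {}"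
      using assms unfolding partition_on_def disjoint_def by blast
  qed auto
  finally show ?thesis .
qed

text \<open>A minimal cover \<open>M\<close> is strong and tight on every part, so it serves as the
  reference: a strong cover of the same size cannot exceed \<open>M\<close> on any part.\<close>

lemma same_card_iff_tight:
  fixes E :: "('v::finite \<times> 'v) set"
  assumes asym: "asym E" and scq: "SCQ_witness (underlying E) Q"
  shows "(\<forall>C C'. strong_cover E w C \<longrightarrow> strong_cover E w C' \<longrightarrow> card C = card C') \<longleftrightarrow>
    (\<forall>C. strong_cover E w C \<longrightarrow> (\<forall>Y \<in> simplexes (underlying E) \<union> basic_C5s (underlying E) \<union> Q.
       tight (underlying E) Q C Y))"
proof -
  define P where "P = simplexes (underlying E) \<union> basic_C5s (underlying E) \<union> Q"
  have Q: "matching (underlying E) Q" and QP: "\<And>e. e \<in> Q \<Longrightarrow> property_P (underlying E) e"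
    and P: "partition_on UNIV P"
    using scq by (auto simp: SCQ_witness_def P_def)
  obtain M where M: "vertex_cover E M" "\<forall>x\<in>M. \<not> nbrs E x \<subseteq> M"
    using exists_minimal_vertex_cover[OF asym] by blast
  then have strong: "strong_cover E w' M" for w' by (auto simp: strong_cover_def)
  \<comment> \<open>With constant weight 1 no vertex is weighted, so the conditions of the edge and
    5-cycle criteria hold vacuously and their conclusions apply to \<open>M\<close>.\<close>
  have one: "Vplus (\<lambda>_. 1) = {}" by (simp add: Vplus_def)
  have tightM: "tight (underlying E) Q M Y" if Y: "Y \<in> P" for Y
    unfolding tight_def
  proof (intro conjI impI)
    assume "Y \<in> simplexes (underlying E) \<union> Q"
    then show "\<not> Y \<subseteq> M"
    proof
      assume "Y \<in> simplexes (underlying E)"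
      then obtain v where "Y = insert v (nbrs E v)" by (auto simp: simplexes_def gnbrs_underlying)
      then show ?thesis using M(2) by auto
    next
      assume YQ: "Y \<in> Q"
      then have "Y \<in> underlying E" using Q by (auto simp: matching_def)
      moreover from this obtain b b' where b: "Y = {b, b'}" by (auto simp: underlying_def)
      ultimately have "\<forall>C. strong_cover E (\<lambda>_. 1) C \<longrightarrow> \<not> {b, b'} \<subseteq> C"
        using QP[OF YQ] edge_strong_cover_iff[OF asym, of b b' "\<lambda>_. 1"] unfolding one by blast
      then show ?thesis using b strong by blast
    qed
  next
    assume Y: "Y \<in> basic_C5s (underlying E)"
    have "star_property E (\<lambda>_. 1) Y" unfolding star_property_def one by blast
    then show "card (M \<inter> Y) \<le> 3" using basic_C5_strong_cover[OF asym Y] strong by blast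
  qed
  show ?thesis
    unfolding P_def[symmetric]
  proof (intro iffI allI impI ballI)
    fix C Y assume eq: "\<forall>C C'. strong_cover E w C \<longrightarrow> strong_cover E w C' \<longrightarrow> card C = card C'"
      and C: "strong_cover E w C" and Y: "Y \<in> P"
    have "card M = card C" using eq C strong by blast
    then have sums: "(\<Sum>Y\<in>P. card (M \<inter> Y)) = (\<Sum>Y\<in>P. card (C \<inter> Y))"
      using card_partition[OF P, of M] card_partition[OF P, of C] by metis
    have "vertex_cover E C" using C by (simp add: strong_cover_def)
    then have "card (M \<inter> Y) \<le> card (C \<inter> Y)" if "Y \<in> P" for Y
      using tight_minimal[OF Q _ tightM[OF that]] that unfolding P_def by blast
    then have MC: "card (M \<inter> Y) = card (C \<inter> Y)" using sum_mono_inv[OF sums _ Y] by simp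
    show "tight (underlying E) Q C Y"
      unfolding tight_def
    proof (intro conjI impI notI)
      assume Y': "Y \<in> simplexes (underlying E) \<union> Q" "Y \<subseteq> C"
      then have CY: "C \<inter> Y = Y" by blast
      have "card (M \<inter> Y) = card Y" by (simp only: MC CY)
      then have "M \<inter> Y = Y" using card_subset_eq[of Y "M \<inter> Y"] by simp
      then show False using tightM[OF Y] Y' by (auto simp: tight_def)
    next
      assume "Y \<in> basic_C5s (underlying E)"
      then show "card (C \<inter> Y) \<le> 3" using tightM[OF Y] MC by (simp add: tight_def)
    qed
  next
    fix C C' assume t: "\<forall>C. strong_cover E w C \<longrightarrow> (\<forall>Y\<in>P. tight (underlying E) Q C Y)"
      and C: "strong_cover E w C" "strong_cover E w C'"
    have cov: "vertex_cover E C" "vertex_cover E C'" using C by (simp_all add: strong_cover_def)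
    have "card (C \<inter> Y) = card (C' \<inter> Y)" if Y: "Y \<in> P" for Y
    proof -
      have "tight (underlying E) Q C Y" "tight (underlying E) Q C' Y" using t C Y by simp_all
      then show ?thesis using tight_minimal[OF Q] Y cov unfolding P_def by (meson antisym)
    qed
    then show "card C = card C'" using card_partition[OF P] by (metis (no_types, lifting) sum.cong)
  qed
qed

lemma same_card_iff_conditions:
  fixes E :: "('v::finite \<times> 'v) set"
  assumes asym: "asym E" and pos: "\<And>x. 1 \<le> w x" and src: "\<And>x. is_source E x \<Longrightarrow> w x = 1"
    and scq: "SCQ_witness (underlying E) Q"
  shows "(\<forall>C C'. strong_cover E w C \<longrightarrow> strong_cover E w C' \<longrightarrow> card C = card C') \<longleftrightarrow>
      (\<forall>C \<in> basic_C5s (underlying E). star_property E w C) \<and>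
      (\<forall>K \<in> simplexes (underlying E). \<nexists>H. generating_star_semi_forest E w K H) \<and>
      (\<forall>a b b'. a \<in> Vplus w \<and> {b, b'} \<in> Q \<and> b' \<in> outN E a \<longrightarrow> nbrs E b \<subseteq> outN E a)"
proof -
  let ?G = "underlying E"
  have Q: "matching ?G Q" and QP: "\<And>e. e \<in> Q \<Longrightarrow> property_P ?G e"
    using scq by (auto simp: SCQ_witness_def)
  have a: "(\<forall>C. strong_cover E w C \<longrightarrow> card (C \<inter> V) \<le> 3) \<longleftrightarrow> star_property E w V" if VB: "V \<in> basic_C5s ?G" for V
  proof -
    have "star_property E w V" if "\<And>C. strong_cover E w C \<Longrightarrow> card (C \<inter> V) \<le> 3"
      by (rule C5_strong_cover_imp_star[OF asym pos]) (erule src, rule basic_C5sD(2)[OF VB], assumption+, erule that)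
    then show ?thesis using basic_C5_strong_cover[OF asym VB] by blast
  qed
  have b: "(\<forall>C. strong_cover E w C \<longrightarrow> \<not> K \<subseteq> C) \<longleftrightarrow> (\<nexists>H. generating_star_semi_forest E w K H)"
    if K: "K \<in> simplexes ?G" for K
  proof -
    have "complete_on ?G K" using K by (auto simp: simplexes_def simplicial_def)
    moreover have "\<exists>C. strong_cover E w C \<and> verts H \<subseteq> C" if "star_semi_forest E w H" for H
      by (rule star_semi_forest_imp_strong_cover[OF asym _ that]) (rule pos)
    ultimately show ?thesis
      using strong_cover_imp_star_semi_forest[OF asym, of K w]
      unfolding generating_star_semi_forest_def by blast
  qed
  have c: "(\<forall>e\<in>Q. \<forall>C. strong_cover E w C \<longrightarrow> \<not> e \<subseteq> C) \<longleftrightarrow>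
     (\<forall>a b b'. a \<in> Vplus w \<and> {b, b'} \<in> Q \<and> b' \<in> outN E a \<longrightarrow> nbrs E b \<subseteq> outN E a)"
    (is "?L \<longleftrightarrow> ?R")
  proof -
    have iff: "(\<forall>C. strong_cover E w C \<longrightarrow> \<not> {b, b'} \<subseteq> C) \<longleftrightarrow>
      (\<forall>a\<in>Vplus w. (b' \<in> outN E a \<longrightarrow> nbrs E b \<subseteq> outN E a) \<and> (b \<in> outN E a \<longrightarrow> nbrs E b' \<subseteq> outN E a))"
      if "{b, b'} \<in> Q" for b b'
      by (rule edge_strong_cover_iff[OF asym]) (rule QP[OF that])
    show ?thesis
    proof
      assume ?L
      then show ?R using iff by blast
    next
      assume R: ?R
      show ?L
      proof
        fix e assume e: "e \<in> Q"
        then have "e \<in> ?G" using Q by (auto simp: matching_def)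
        then obtain x y where xy: "e = {x, y}" by (auto simp: underlying_def)
        \<comment> \<open>The condition in \<open>?R\<close> is read for both orders of the
          edge.\<close>
        moreover have "{x, y} \<in> Q" "{y, x} \<in> Q" using e xy by (auto simp: insert_commute)
        ultimately show "\<forall>C. strong_cover E w C \<longrightarrow> \<not> e \<subseteq> C" using iff[of x y] R by blast
      qed
    qed
  qed
  have "(\<forall>C. strong_cover E w C \<longrightarrow> (\<forall>Y \<in> simplexes ?G \<union> basic_C5s ?G \<union> Q. tight ?G Q C Y)) \<longleftrightarrow>
    (\<forall>V\<in>basic_C5s ?G. \<forall>C. strong_cover E w C \<longrightarrow> card (C \<inter> V) \<le> 3) \<and>
    (\<forall>K\<in>simplexes ?G. \<forall>C. strong_cover E w C \<longrightarrow> \<not> K \<subseteq> C) \<and>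
    (\<forall>e\<in>Q. \<forall>C. strong_cover E w C \<longrightarrow> \<not> e \<subseteq> C)"
    unfolding tight_def by (intro iffI conjI ballI allI impI; simp; blast)
  then show ?thesis unfolding same_card_iff_tight[OF asym scq] c using a b by simp
qed

section \<open>Polynomials and prime ideals\<close>

abbreviation lookup :: "('a \<Rightarrow>\<^sub>0 'b::zero) \<Rightarrow> 'a \<Rightarrow> 'b" where "lookup \<equiv> Poly_Mapping.lookup"

abbreviation keys :: "('a \<Rightarrow>\<^sub>0 'b::zero) \<Rightarrow> 'a set" where "keys \<equiv> Poly_Mapping.keys"

lemma poly_mapping_expand:
  "f = (\<Sum>k\<in>keys f. Poly_Mapping.single k (lookup f k))"
proof (rule poly_mapping_eqI)
  fix k
  have "lookup (\<Sum>k\<in>keys f. Poly_Mapping.single k (lookup f k)) k = (\<Sum>l\<in>keys f. if l = k then lookup f k else 0)"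
    by (simp add: lookup_sum lookup_single when_def cong: if_cong)
  then show "lookup f k = lookup (\<Sum>k\<in>keys f. Poly_Mapping.single k (lookup f k)) k"
    by (simp add: in_keys_iff)
qed

lemma lookup_mult_sum:
  fixes f g :: "'a::monoid_add \<Rightarrow>\<^sub>0 'b::semiring_0"
  shows
  "lookup (f * g) m = (\<Sum>k\<in>keys f. \<Sum>l\<in>keys g. if k + l = m then lookup f k * lookup g l else 0)"
proof -
  have "f * g = (\<Sum>k\<in>keys f. Poly_Mapping.single k (lookup f k)) * (\<Sum>l\<in>keys g. Poly_Mapping.single l (lookup g l))"
    using poly_mapping_expand[of f] poly_mapping_expand[of g] by simp
  also have "\<dots> = (\<Sum>k\<in>keys f. \<Sum>l\<in>keys g. Poly_Mapping.single (k + l) (lookup f k * lookup g l))"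
    by (simp add: sum_product mult_single)
  finally show ?thesis by (simp add: lookup_sum lookup_single when_def)
qed

lemma keys_monomial_mult:
  fixes f :: "'a::cancel_comm_monoid_add \<Rightarrow>\<^sub>0 'b::semiring_1"
  shows "keys (Poly_Mapping.single m 1 * f) = (+) m ` keys f"
proof -
  have keys1: "keys (Poly_Mapping.single m (1::'b)) = {m}" by simp
  have look: "lookup (Poly_Mapping.single m 1 * f) (m + l) = lookup f l" for l
    unfolding lookup_mult_sum keys1 by (simp add: in_keys_iff)
  have "n \<in> (+) m ` keys f" if "n \<in> keys (Poly_Mapping.single m 1 * f)" for n
    using that keys_mult[of "Poly_Mapping.single m 1" f] by auto
  then show ?thesis using look by (auto simp: in_keys_iff)
qed

definition poly_restrict :: "'a set \<Rightarrow> ('a \<Rightarrow>\<^sub>0 'b::comm_monoid_add) \<Rightarrow> ('a \<Rightarrow>\<^sub>0 'b)" where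
  "poly_restrict S f = (\<Sum>k\<in>keys f \<inter> S. Poly_Mapping.single k (lookup f k))"

lemma lookup_poly_restrict: "lookup (poly_restrict S f) k = (if k \<in> S then lookup f k else 0)"
proof -
  have "lookup (poly_restrict S f) k = (\<Sum>l\<in>keys f \<inter> S. if l = k then lookup f k else 0)"
    unfolding poly_restrict_def by (auto simp: lookup_sum lookup_single when_def intro: sum.cong)
  then show ?thesis by (auto simp: in_keys_iff)
qed

lemma keys_poly_restrict: "keys (poly_restrict S f) = keys f \<inter> S"
  by (auto simp: in_keys_iff lookup_poly_restrict split: if_splits)

lemma poly_restrict_split: "f = poly_restrict S f + poly_restrict (- S) f"
  by (rule poly_mapping_eqI) (simp add: lookup_add lookup_poly_restrict)

text \<open>
  Exponent vectors are ordered by transporting them along an additive injection into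
  \<open>nat \<Rightarrow>\<^sub>0 nat\<close>, whose lexicographic order is compatible with addition.
\<close>

lemma exists_monomial_order_embedding:
  "\<exists>\<phi> :: ('v::finite \<Rightarrow>\<^sub>0 nat) \<Rightarrow> (nat \<Rightarrow>\<^sub>0 nat). inj \<phi> \<and> (\<forall>m n. \<phi> (m + n) = \<phi> m + \<phi> n)"
proof -
  obtain idx :: "'v \<Rightarrow> nat" where idx: "inj idx"
    using finite_imp_inj_to_nat_seg[of "UNIV :: 'v set"] by auto
  define \<phi> :: "('v \<Rightarrow>\<^sub>0 nat) \<Rightarrow> (nat \<Rightarrow>\<^sub>0 nat)" where
    "\<phi> m = (\<Sum>v\<in>UNIV. Poly_Mapping.single (idx v) (lookup m v))" for m
  have look: "lookup (\<phi> m) (idx v) = lookup m v" for m v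
  proof -
    have "lookup (\<phi> m) (idx v) = (\<Sum>u\<in>UNIV. if u = v then lookup m v else 0)"
      unfolding \<phi>_def lookup_sum lookup_single when_def
      using idx by (intro sum.cong) (auto dest: injD)
    then show ?thesis by simp
  qed
  have "inj \<phi>"
  proof (rule injI, rule poly_mapping_eqI)
    fix m n :: "'v \<Rightarrow>\<^sub>0 nat" and v
    assume "\<phi> m = \<phi> n"
    then show "lookup m v = lookup n v" using look by metis
  qed
  moreover have "\<phi> (m + n) = \<phi> m + \<phi> n" for m n
    by (simp add: \<phi>_def lookup_add single_add sum.distrib)
  ultimately show ?thesis by blast
qed

text \<open>In the transported order the leading monomials \<open>m\<close> and \<open>n\<close> are
  the only pair of monomials with sum \<open>m + n\<close>, so the leading terms cannot
  cancel.\<close>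

lemma poly_mult_nonzero:
  fixes f g :: "('v::finite \<Rightarrow>\<^sub>0 nat) \<Rightarrow>\<^sub>0 'k::field"
  assumes "f \<noteq> 0" "g \<noteq> 0"
  shows "f * g \<noteq> 0"
proof -
  obtain \<phi> :: "('v \<Rightarrow>\<^sub>0 nat) \<Rightarrow> (nat \<Rightarrow>\<^sub>0 nat)"
    where inj: "inj \<phi>" and add: "\<And>m n. \<phi> (m + n) = \<phi> m + \<phi> n"
    using exists_monomial_order_embedding by blast
  have top: "\<exists>m\<in>keys h. \<forall>k\<in>keys h. \<phi> k \<le> \<phi> m" if h: "h \<noteq> 0" for h :: "('v \<Rightarrow>\<^sub>0 nat) \<Rightarrow>\<^sub>0 'k"
  proof -
    have "keys h \<noteq> {}" using h by simp
    then have "Max (\<phi> ` keys h) \<in> \<phi> ` keys h" by (intro Max_in) auto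
    then obtain m where "m \<in> keys h" "Max (\<phi> ` keys h) = \<phi> m" by auto
    then show ?thesis by (metis Max_ge finite_imageI finite_keys imageI)
  qed
  obtain m where m: "m \<in> keys f" "\<And>k. k \<in> keys f \<Longrightarrow> \<phi> k \<le> \<phi> m" using top[OF assms(1)] by blast
  obtain n where n: "n \<in> keys g" "\<And>k. k \<in> keys g \<Longrightarrow> \<phi> k \<le> \<phi> n" using top[OF assms(2)] by blast
  have uniq: "k = m \<and> l = n" if kl: "k \<in> keys f" "l \<in> keys g" "k + l = m + n" for k l
  proof -
    have eq: "\<phi> k + \<phi> l = \<phi> m + \<phi> n" using kl(3) add by metis
    have le: "\<phi> k \<le> \<phi> m" "\<phi> l \<le> \<phi> n" using kl m n by auto
    have "\<phi> k = \<phi> m"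
    proof (rule ccontr)
      assume "\<phi> k \<noteq> \<phi> m"
      then have "\<phi> k + \<phi> l < \<phi> m + \<phi> n" using le by (intro add_less_le_mono) auto
      then show False using eq by simp
    qed
    then have "k = m" using inj by (simp add: inj_eq)
    then show ?thesis using kl(3) by simp
  qed
  have "lookup (f * g) (m + n) = (\<Sum>k\<in>keys f. \<Sum>l\<in>keys g. if k = m \<and> l = n then lookup f m * lookup g n else 0)"
    unfolding lookup_mult_sum
  proof (intro sum.cong refl)
    fix k l assume "k \<in> keys f" "l \<in> keys g"
    then show "(if k + l = m + n then lookup f k * lookup g l else 0) = (if k = m \<and> l = n then lookup f m * lookup g n else 0)"
      using uniq[of k l] by auto
  qed
  also have "\<dots> = (\<Sum>k\<in>keys f. if k = m then lookup f m * lookup g n else 0)"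
    using n(1) by (intro sum.cong refl) auto
  also have "\<dots> = lookup f m * lookup g n" using m(1) by simp
  also have "\<dots> \<noteq> 0" using m(1) n(1) by (simp add: in_keys_iff)
  finally show ?thesis by auto
qed

text \<open>Carrier-free form of \<open>ideal\<close> for a ring given by a type, so that
  calculations can use the type class operations.\<close>

definition ideal_set :: "'a::comm_ring_1 set \<Rightarrow> bool" where
  "ideal_set P \<longleftrightarrow> 0 \<in> P \<and> (\<forall>x\<in>P. \<forall>y\<in>P. x + y \<in> P) \<and> (\<forall>r. \<forall>x\<in>P. r * x \<in> P)"

definition prime_set :: "'a::comm_ring_1 set \<Rightarrow> bool" where
  "prime_set P \<longleftrightarrow> ideal_set P \<and> 1 \<notin> P \<and> (\<forall>x y. x * y \<in> P \<longrightarrow> x \<in> P \<or> y \<in> P)"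

lemma ideal_setD:
  assumes "ideal_set P"
  shows "0 \<in> P" "x \<in> P \<Longrightarrow> y \<in> P \<Longrightarrow> x + y \<in> P" "x \<in> P \<Longrightarrow> r * x \<in> P" "x \<in> P \<Longrightarrow> x * r \<in> P"
    "x \<in> P \<Longrightarrow> - x \<in> P" "x \<in> P \<Longrightarrow> y \<in> P \<Longrightarrow> x - y \<in> P"
proof -
  show 0: "0 \<in> P" and add: "x \<in> P \<Longrightarrow> y \<in> P \<Longrightarrow> x + y \<in> P" and mult: "x \<in> P \<Longrightarrow> r * x \<in> P" for x y r
    using assms by (auto simp: ideal_set_def)
  show "x \<in> P \<Longrightarrow> x * r \<in> P" using mult[of x r] by (simp add: mult.commute)
  have neg: "y \<in> P \<Longrightarrow> - y \<in> P" for y using mult[of y "-1"] by simp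
  then show "x \<in> P \<Longrightarrow> - x \<in> P" by simp
  show "x \<in> P \<Longrightarrow> y \<in> P \<Longrightarrow> x - y \<in> P" using add[of x "- y"] neg[of y] by simp
qed

lemma ideal_set_sum: "ideal_set P \<Longrightarrow> (\<And>i. i \<in> I \<Longrightarrow> f i \<in> P) \<Longrightarrow> sum f I \<in> P"
  by (induction I rule: infinite_finite_induct) (auto intro: ideal_setD)

lemma ring_of_type_simps:
  "carrier ring_of_type_algebra = UNIV" "x \<otimes>\<^bsub>ring_of_type_algebra\<^esub> y = x * y"
  "x \<oplus>\<^bsub>ring_of_type_algebra\<^esub> y = x + y" "\<zero>\<^bsub>ring_of_type_algebra\<^esub> = 0" "\<one>\<^bsub>ring_of_type_algebra\<^esub> = 1"
  by (simp_all add: ring_of_type_algebra_def)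

lemma ideal_ring_of_type_iff: "ideal P (ring_of_type_algebra :: 'a::comm_ring_1 ring) \<longleftrightarrow> ideal_set P"
proof
  assume "ideal P (ring_of_type_algebra :: 'a ring)"
  then interpret ideal P "ring_of_type_algebra :: 'a ring" .
  show "ideal_set P" unfolding ideal_set_def
    using additive_subgroup.zero_closed[OF is_additive_subgroup]
      additive_subgroup.a_closed[OF is_additive_subgroup] I_l_closed by (simp add: ring_of_type_simps)
next
  assume P: "ideal_set P"
  interpret cring "ring_of_type_algebra :: 'a ring" by (rule cring_from_type_algebra)
  show "ideal P (ring_of_type_algebra :: 'a ring)"
  proof (rule idealI)
    show "ring (ring_of_type_algebra :: 'a ring)" by (rule ring_from_type_algebra)
    show "subgroup P (add_monoid (ring_of_type_algebra :: 'a ring))"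
    proof
      fix x assume x: "x \<in> P"
      have "inv\<^bsub>add_monoid (ring_of_type_algebra :: 'a ring)\<^esub> x = - x"
        using minus_equality[of "- x" x] by (simp add: ring_of_type_simps a_inv_def)
      then show "inv\<^bsub>add_monoid (ring_of_type_algebra :: 'a ring)\<^esub> x \<in> P" using ideal_setD(5)[OF P x] by simp
    qed (use ideal_setD[OF P] in \<open>simp_all add: ring_of_type_simps\<close>)
  qed (use ideal_setD[OF P] in \<open>simp_all add: ring_of_type_simps\<close>)
qed

lemma primeideal_ring_of_type_iff:
  "primeideal P (ring_of_type_algebra :: 'a::comm_ring_1 ring) \<longleftrightarrow> prime_set P"
proof
  assume "primeideal P (ring_of_type_algebra :: 'a ring)"
  then interpret primeideal P "ring_of_type_algebra :: 'a ring" .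
  have "1 \<notin> P" using one_imp_carrier I_notcarr by (auto simp: ring_of_type_simps)
  moreover have "ideal_set P" using is_ideal ideal_ring_of_type_iff by blast
  ultimately show "prime_set P" unfolding prime_set_def using I_prime by (simp add: ring_of_type_simps)
next
  assume P: "prime_set P"
  then have "ideal P (ring_of_type_algebra :: 'a ring)" by (simp add: ideal_ring_of_type_iff prime_set_def)
  moreover have "cring (ring_of_type_algebra :: 'a ring)" by (rule cring_from_type_algebra)
  ultimately show "primeideal P (ring_of_type_algebra :: 'a ring)"
    using P by (intro primeidealI) (auto simp: ring_of_type_simps prime_set_def)
qed

section \<open>Algebraic dependence modulo a prime\<close>

text \<open>\<open>A\<close> is the ring of coefficients, later the polynomials in an independent
  set of variables. Multipliers from \<open>A\<close> outside \<open>P\<close> act as denominators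
  and replace the fraction field of \<open>A\<close> modulo \<open>P\<close>.\<close>

locale subring_mod_prime =
  fixes A P :: "'a::comm_ring_1 set"
  assumes prime: "prime_set P" and A1: "1 \<in> A" and A_add: "x \<in> A \<Longrightarrow> y \<in> A \<Longrightarrow> x + y \<in> A"
    and A_mult: "x \<in> A \<Longrightarrow> y \<in> A \<Longrightarrow> x * y \<in> A" and A_neg: "x \<in> A \<Longrightarrow> - x \<in> A"
begin

lemma ideal: "ideal_set P" and one_notin: "1 \<notin> P"
  and prime_mult: "x \<notin> P \<Longrightarrow> y \<notin> P \<Longrightarrow> x * y \<notin> P"
  using prime by (auto simp: prime_set_def)

lemmas P_simps = ideal_setD[OF ideal]

lemma A0: "0 \<in> A" using A_add[OF A1 A_neg[OF A1]] by simp

lemma A_sum: "(\<And>i. i \<in> I \<Longrightarrow> f i \<in> A) \<Longrightarrow> sum f I \<in> A"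
  by (induction I rule: infinite_finite_induct) (auto intro: A0 A_add)

lemma A_diff: "x \<in> A \<Longrightarrow> y \<in> A \<Longrightarrow> x - y \<in> A"
  using A_add[of x "- y"] A_neg[of y] by simp

text \<open>Fraction-free Gaussian elimination.\<close>

lemma linear_dependence:
  assumes "finite I" "finite J" "card I < card J" "\<And>j i. j \<in> J \<Longrightarrow> i \<in> I \<Longrightarrow> v j i \<in> A"
  shows "\<exists>l. (\<forall>j\<in>J. l j \<in> A) \<and> (\<exists>j\<in>J. l j \<notin> P) \<and> (\<forall>i\<in>I. (\<Sum>j\<in>J. l j * v j i) \<in> P)"
  using assms
proof (induction I arbitrary: J v rule: finite_induct)
  case empty
  then obtain j where "j \<in> J" by fastforce
  then show ?case using A1 one_notin by (intro exI[of _ "\<lambda>_. 1"]) auto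
next
  case (insert i0 I)
  show ?case
  proof (cases "\<forall>j\<in>J. v j i0 \<in> P")
    case True
    obtain l where l: "\<forall>j\<in>J. l j \<in> A" "\<exists>j\<in>J. l j \<notin> P" "\<forall>i\<in>I. (\<Sum>j\<in>J. l j * v j i) \<in> P"
      using insert.IH[of J v] insert.prems insert.hyps by auto
    moreover have "(\<Sum>j\<in>J. l j * v j i0) \<in> P"
      using True P_simps by (intro ideal_set_sum[OF ideal]) auto
    ultimately show ?thesis by (intro exI[of _ l]) auto
  next
    case False
    then obtain j0 where j0: "j0 \<in> J" "v j0 i0 \<notin> P" by blast
    define J' where "J' = J - {j0}"
    have J: "J = insert j0 J'" "j0 \<notin> J'" "finite J'" using j0 insert.prems(1) by (auto simp: J'_def)
    have vA: "v j i \<in> A" if "j \<in> J" "i \<in> insert i0 I" for i j using insert.prems(3) that by blast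
    \<comment> \<open>Column \<open>i0\<close> is eliminated with the pivot \<open>v j0 i0\<close>,
      which is outside \<open>P\<close>; cross-multiplication avoids division.\<close>
    define u where "u j i = v j0 i0 * v j i - v j i0 * v j0 i" for j i
    have "card I < card J'" using insert.prems(2) insert.hyps J by simp
    moreover have "u j i \<in> A" if "j \<in> J'" "i \<in> I" for j i
      unfolding u_def using that J j0 by (intro A_diff A_mult vA) auto
    ultimately obtain m where m: "\<forall>j\<in>J'. m j \<in> A" "\<exists>j\<in>J'. m j \<notin> P" "\<forall>i\<in>I. (\<Sum>j\<in>J'. m j * u j i) \<in> P"
      using insert.IH[of J' u] J(3) by blast
    \<comment> \<open>Scaling by the pivot keeps a coefficient outside \<open>P\<close> because
      \<open>P\<close> is prime; the coefficient at \<open>j0\<close> turns the combination of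
      reduced rows into one of the original rows.\<close>
    define l where "l j = (if j = j0 then - (\<Sum>j\<in>J'. m j * v j i0) else m j * v j0 i0)" for j
    have sum: "(\<Sum>j\<in>J. l j * v j i) = (\<Sum>j\<in>J'. m j * u j i)" for i
    proof -
      have "(\<Sum>j\<in>J'. l j * v j i) = (\<Sum>j\<in>J'. m j * v j0 i0 * v j i)"
        using J(2) by (intro sum.cong refl) (auto simp: l_def)
      moreover have "l j0 * v j0 i = - (\<Sum>j\<in>J'. m j * v j i0 * v j0 i)"
        by (simp add: l_def sum_distrib_right)
      ultimately have "(\<Sum>j\<in>J. l j * v j i) = (\<Sum>j\<in>J'. m j * v j0 i0 * v j i) - (\<Sum>j\<in>J'. m j * v j i0 * v j0 i)"
        using J by simp
      also have "\<dots> = (\<Sum>j\<in>J'. m j * u j i)"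
        unfolding u_def by (simp add: sum_subtractf algebra_simps)
      finally show ?thesis .
    qed
    have "l j \<in> A" if "j \<in> J" for j
      unfolding l_def using m(1) that J j0(1) by (auto intro!: A_neg A_sum A_mult vA)
    moreover have "\<exists>j\<in>J. l j \<notin> P"
    proof -
      obtain j where "j \<in> J'" "m j \<notin> P" using m(2) by blast
      then show ?thesis using j0(2) J prime_mult by (intro bexI[of _ j]) (auto simp: l_def)
    qed
    moreover have "(\<Sum>j\<in>J'. m j * u j i0) = 0" by (intro sum.neutral) (simp add: u_def mult.commute)
    then have "\<forall>i\<in>insert i0 I. (\<Sum>j\<in>J. l j * v j i) \<in> P"
      unfolding sum using m(3) P_simps(1) by auto
    ultimately show ?thesis by blast
  qed
qed

text \<open>The span of \<open>B\<close> over the fraction field of \<open>A\<close> modulo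
  \<open>P\<close>, with the common denominator \<open>c\<close> cleared.\<close>

definition L :: "'a set \<Rightarrow> 'a set" where
  "L B = {f. \<exists>c a. c \<in> A \<and> c \<notin> P \<and> (\<forall>b. a b \<in> A) \<and> c * f - (\<Sum>b\<in>B. a b * b) \<in> P}"

lemma L_mem: "c \<in> A \<Longrightarrow> c \<notin> P \<Longrightarrow> (\<And>b. a b \<in> A) \<Longrightarrow> c * f - (\<Sum>b\<in>B. a b * b) \<in> P \<Longrightarrow> f \<in> L B"
  unfolding L_def by blast

lemma L_base: assumes "finite B" "b \<in> B" shows "b \<in> L B"
proof (rule L_mem[of 1 "\<lambda>x. if x = b then 1 else 0"])
  have "(\<Sum>x\<in>B. (if x = b then 1 else 0) * x) = (\<Sum>x\<in>B. if x = b then b else 0)"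
    by (intro sum.cong) auto
  also have "\<dots> = b" using assms by simp
  finally show "1 * b - (\<Sum>x\<in>B. (if x = b then 1 else 0) * x) \<in> P" using P_simps(1) by simp
qed (use A1 A0 one_notin in auto)

lemma L_P: "f \<in> P \<Longrightarrow> f \<in> L B"
  by (rule L_mem[of 1 "\<lambda>_. 0"]) (use A1 A0 one_notin in auto)

lemma L_add: assumes "f \<in> L B" "g \<in> L B" shows "f + g \<in> L B"
proof -
  obtain c a where c: "c \<in> A" "c \<notin> P" "\<And>b. a b \<in> A" "c * f - (\<Sum>b\<in>B. a b * b) \<in> P"
    using assms(1) unfolding L_def by blast
  obtain d e where d: "d \<in> A" "d \<notin> P" "\<And>b. e b \<in> A" "d * g - (\<Sum>b\<in>B. e b * b) \<in> P"
    using assms(2) unfolding L_def by blast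
  have "d * (c * f - (\<Sum>b\<in>B. a b * b)) + c * (d * g - (\<Sum>b\<in>B. e b * b)) \<in> P"
    using P_simps c d by blast
  moreover have "d * (c * f - (\<Sum>b\<in>B. a b * b)) + c * (d * g - (\<Sum>b\<in>B. e b * b)) =
    (c * d) * (f + g) - (\<Sum>b\<in>B. (d * a b + c * e b) * b)"
    by (simp add: algebra_simps sum.distrib sum_distrib_left)
  ultimately show ?thesis using c d prime_mult
    by (intro L_mem[of "c * d" "\<lambda>b. d * a b + c * e b"]) (auto intro: A_mult A_add)
qed

lemma L_scale: assumes "f \<in> L B" "r \<in> A" shows "r * f \<in> L B"
proof -
  obtain c a where c: "c \<in> A" "c \<notin> P" "\<And>b. a b \<in> A" "c * f - (\<Sum>b\<in>B. a b * b) \<in> P"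
    using assms(1) unfolding L_def by blast
  have "r * (c * f - (\<Sum>b\<in>B. a b * b)) \<in> P" using P_simps c by blast
  moreover have "r * (c * f - (\<Sum>b\<in>B. a b * b)) = c * (r * f) - (\<Sum>b\<in>B. (r * a b) * b)"
    by (simp add: algebra_simps sum_distrib_left)
  ultimately show ?thesis using c assms(2) by (intro L_mem[of c "\<lambda>b. r * a b"]) (auto intro: A_mult)
qed

lemma L_cancel: assumes "r * f \<in> L B" "r \<in> A" "r \<notin> P" shows "f \<in> L B"
proof -
  obtain c a where c: "c \<in> A" "c \<notin> P" "\<And>b. a b \<in> A" "c * (r * f) - (\<Sum>b\<in>B. a b * b) \<in> P"
    using assms(1) unfolding L_def by blast
  then show ?thesis using assms prime_mult
    by (intro L_mem[of "c * r" a]) (auto intro: A_mult simp: mult.assoc)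
qed

lemma L_sum: "(\<And>i. i \<in> I \<Longrightarrow> f i \<in> L B) \<Longrightarrow> sum f I \<in> L B"
  by (induction I rule: infinite_finite_induct) (auto intro: L_add L_P P_simps)

lemma L_mult:
  assumes "f \<in> L B" "g \<in> L B'" "finite B" "finite B'"
  shows "f * g \<in> L ((\<lambda>(b, b'). b * b') ` (B \<times> B'))" (is "_ \<in> L ?BB")
proof -
  obtain c a where c: "c \<in> A" "c \<notin> P" "\<And>b. a b \<in> A" "c * f - (\<Sum>b\<in>B. a b * b) \<in> P"
    using assms(1) unfolding L_def by blast
  obtain d e where d: "d \<in> A" "d \<notin> P" "\<And>b. e b \<in> A" "d * g - (\<Sum>b\<in>B'. e b * b) \<in> P"
    using assms(2) unfolding L_def by blast
  let ?s = "\<Sum>b\<in>B. a b * b" and ?t = "\<Sum>b\<in>B'. e b * b"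
  have "?s * ?t = (\<Sum>b\<in>B. \<Sum>b'\<in>B'. (a b * e b') * (b * b'))"
    by (simp add: sum_product algebra_simps)
  also have "\<dots> \<in> L ?BB"
    using assms(3,4) c(3) d(3) by (intro L_sum L_scale L_base A_mult) auto
  finally have st: "?s * ?t \<in> L ?BB" .
  have "(c * f - ?s) * (d * g) + ?s * (d * g - ?t) \<in> P" using P_simps c d by blast
  then have "?s * ?t + ((c * f - ?s) * (d * g) + ?s * (d * g - ?t)) \<in> L ?BB"
    using st L_P L_add by blast
  moreover have "?s * ?t + ((c * f - ?s) * (d * g) + ?s * (d * g - ?t)) = (c * d) * (f * g)"
    by (simp add: algebra_simps)
  ultimately have "(c * d) * (f * g) \<in> L ?BB" by simp
  then show ?thesis by (rule L_cancel) (use c d prime_mult A_mult in auto)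
qed

text \<open>The leading coefficient \<open>a n\<close>, being outside \<open>P\<close>, can be
  cancelled in \<open>L\<close>, so the relation rewrites \<open>y ^ n\<close>, and inductively all
  higher powers, by lower ones.\<close>

lemma L_powers:
  assumes a: "\<And>i. i \<le> n \<Longrightarrow> a i \<in> A" "a n \<notin> P" "(\<Sum>i\<le>n. a i * y ^ i) \<in> P"
  shows "y ^ j \<in> L ((\<lambda>i. y ^ i) ` {..<n})"
proof (induction j rule: less_induct)
  case (less j)
  show ?case
  proof (cases "j < n")
    case True
    then show ?thesis by (intro L_base) auto
  next
    case False
    have "(\<Sum>i\<le>n. a i * y ^ i) = (\<Sum>i<n. a i * y ^ i) + a n * y ^ n"
      by (simp add: lessThan_Suc_atMost[symmetric])
    then have eq: "a n * y ^ j = y ^ (j - n) * (\<Sum>i\<le>n. a i * y ^ i) + (\<Sum>i<n. - a i * y ^ (i + (j - n)))"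
      using False by (simp add: algebra_simps sum_distrib_left sum_negf power_add[symmetric])
    have "y ^ (i + (j - n)) \<in> L ((\<lambda>i. y ^ i) ` {..<n})" if "i < n" for i
      using less.IH[of "i + (j - n)"] that False by simp
    then have "(\<Sum>i<n. - a i * y ^ (i + (j - n))) \<in> L ((\<lambda>i. y ^ i) ` {..<n})"
      by (intro L_sum L_scale A_neg a(1)) auto
    moreover have "y ^ (j - n) * (\<Sum>i\<le>n. a i * y ^ i) \<in> L ((\<lambda>i. y ^ i) ` {..<n})"
      using a(3) by (intro L_P P_simps(3))
    ultimately have "a n * y ^ j \<in> L ((\<lambda>i. y ^ i) ` {..<n})" unfolding eq by (rule L_add[rotated])
    then show ?thesis by (rule L_cancel) (use a in auto)
  qed
qed

text \<open>All powers of \<open>f\<close> lie in a span of dimension at most \<open>card B\<close>,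
  so \<open>card B + 1\<close> of them are linearly dependent.\<close>

lemma algebraic_relation:
  assumes "finite B" "\<And>j. f ^ j \<in> L B"
  shows "\<exists>n l. (\<forall>j\<le>n. l j \<in> A) \<and> (\<exists>j\<le>n. l j \<notin> P) \<and> (\<Sum>j\<le>n. l j * f ^ j) \<in> P"
proof -
  have "\<forall>j. \<exists>c a. c \<in> A \<and> c \<notin> P \<and> (\<forall>b. a b \<in> A) \<and> c * f ^ j - (\<Sum>b\<in>B. a b * b) \<in> P"
    using assms(2) unfolding L_def by blast
  then obtain c a where c: "\<And>j. c j \<in> A" "\<And>j. c j \<notin> P" "\<And>j b. a j b \<in> A"
    "\<And>j. c j * f ^ j - (\<Sum>b\<in>B. a j b * b) \<in> P" by metis
  obtain l where l: "\<forall>j\<le>card B. l j \<in> A" "\<exists>j\<le>card B. l j \<notin> P" "\<forall>b\<in>B. (\<Sum>j\<le>card B. l j * a j b) \<in> P"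
    using linear_dependence[of B "{..card B}" a] assms(1) c(3) by auto
  have "(\<Sum>j\<le>card B. l j * (c j * f ^ j - (\<Sum>b\<in>B. a j b * b))) + (\<Sum>b\<in>B. b * (\<Sum>j\<le>card B. l j * a j b)) \<in> P"
  proof (rule P_simps(2))
    show "(\<Sum>j\<le>card B. l j * (c j * f ^ j - (\<Sum>b\<in>B. a j b * b))) \<in> P"
      by (rule ideal_set_sum[OF ideal]) (rule P_simps(3)[OF c(4)])
    show "(\<Sum>b\<in>B. b * (\<Sum>j\<le>card B. l j * a j b)) \<in> P"
      by (rule ideal_set_sum[OF ideal], rule P_simps(3)) (use l(3) in blast)
  qed
  moreover have "(\<Sum>b\<in>B. b * (\<Sum>j\<le>card B. l j * a j b)) = (\<Sum>j\<le>card B. l j * (\<Sum>b\<in>B. a j b * b))"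
    unfolding sum_distrib_left by (subst sum.swap) (simp add: algebra_simps)
  ultimately have "(\<Sum>j\<le>card B. (l j * c j) * f ^ j) \<in> P"
    by (simp add: sum.distrib[symmetric] algebra_simps)
  moreover have "\<exists>j\<le>card B. l j * c j \<notin> P" using l(2) c(2) prime_mult by blast
  ultimately show ?thesis using l(1) c(1) A_mult
    by (intro exI[of _ "card B"] exI[of _ "\<lambda>j. l j * c j"]) auto
qed

text \<open>In a relation of minimal degree for \<open>f \<notin> P\<close> the constant coefficient is not in \<open>P\<close>.\<close>

lemma relation_in_larger_ideal:
  assumes Q: "ideal_set Q" "P \<subseteq> Q" "f \<in> Q" "f \<notin> P"
    and rel: "\<exists>n l. (\<forall>j\<le>n. l j \<in> A) \<and> (\<exists>j\<le>n. l j \<notin> P) \<and> (\<Sum>j\<le>n. l j * f ^ j) \<in> P"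
  shows "\<exists>g\<in>A \<inter> Q. g \<notin> P"
proof -
  define R where "R n \<longleftrightarrow> (\<exists>l. (\<forall>j\<le>n. l j \<in> A) \<and> (\<exists>j\<le>n. l j \<notin> P) \<and> (\<Sum>j\<le>n. l j * f ^ j) \<in> P)" for n
  define n where "n = (LEAST n. R n)"
  have "\<exists>n. R n" using rel unfolding R_def by blast
  then have "R n" unfolding n_def by (rule LeastI_ex)
  then obtain l where l: "\<forall>j\<le>n. l j \<in> A" "\<exists>j\<le>n. l j \<notin> P" "(\<Sum>j\<le>n. l j * f ^ j) \<in> P"
    unfolding R_def by blast
  \<comment> \<open>Otherwise \<open>l 0\<close> could be dropped and \<open>f\<close> cancelled,
    leaving a relation of degree smaller by one.\<close>
  have l0: "l 0 \<notin> P"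
  proof
    assume 0: "l 0 \<in> P"
    then have "n \<noteq> 0" using l(2) by (metis le_zero_eq)
    then obtain m where m: "n = Suc m" by (cases n) auto
    have split: "(\<Sum>j\<le>n. l j * f ^ j) = l 0 + f * (\<Sum>j\<le>m. l (Suc j) * f ^ j)"
      unfolding m sum.atMost_Suc_shift by (simp add: sum_distrib_left algebra_simps)
    have "(l 0 + f * (\<Sum>j\<le>m. l (Suc j) * f ^ j)) - l 0 \<in> P"
      using l(3) 0 unfolding split by (rule P_simps(6))
    then have "f * (\<Sum>j\<le>m. l (Suc j) * f ^ j) \<in> P" by simp
    then have "(\<Sum>j\<le>m. l (Suc j) * f ^ j) \<in> P" using prime_mult Q(4) by blast
    moreover have "\<exists>j\<le>m. l (Suc j) \<notin> P"
    proof -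
      obtain j where "j \<le> n" "l j \<notin> P" using l(2) by blast
      then show ?thesis using 0 m by (cases j) auto
    qed
    ultimately have "R m" unfolding R_def using l(1) m by (intro exI[of _ "\<lambda>j. l (Suc j)"]) auto
    then show False using not_less_Least[of m R] m by (simp add: n_def[symmetric])
  qed
  \<comment> \<open>\<open>l 0\<close> is the value of the relation, which lies in \<open>P\<close>,
    minus a multiple of \<open>f\<close>.\<close>
  have "l 0 \<in> Q"
  proof (cases n)
    case 0
    then show ?thesis using l(3) Q(2) by auto
  next
    case (Suc m)
    have "(\<Sum>j\<le>n. l j * f ^ j) = l 0 + f * (\<Sum>j\<le>m. l (Suc j) * f ^ j)"
      unfolding Suc sum.atMost_Suc_shift by (simp add: sum_distrib_left algebra_simps)
    then have "l 0 = (\<Sum>j\<le>n. l j * f ^ j) - f * (\<Sum>j\<le>m. l (Suc j) * f ^ j)" by simp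
    moreover have "(\<Sum>j\<le>n. l j * f ^ j) \<in> Q" using l(3) Q(2) by blast
    moreover have "f * (\<Sum>j\<le>m. l (Suc j) * f ^ j) \<in> Q" using Q(3) by (rule ideal_setD(4)[OF Q(1)])
    ultimately show ?thesis using ideal_setD(6)[OF Q(1)] by metis
  qed
  then show ?thesis using l0 l(1) by blast
qed

end

section \<open>Ideals generated by variables\<close>

definition mono_ideal :: "'a set \<Rightarrow> ('a \<Rightarrow>\<^sub>0 'b::zero) set" where
  "mono_ideal U = {f. keys f \<subseteq> U}"

lemma mono_ideal_set:
  fixes U :: "'a::comm_monoid_add set"
  assumes "\<And>m n. m \<in> U \<Longrightarrow> n + m \<in> U"
  shows "ideal_set (mono_ideal U :: ('a \<Rightarrow>\<^sub>0 'b::comm_ring_1) set)"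
  unfolding ideal_set_def mono_ideal_def
proof (intro conjI ballI allI)
  fix f g :: "'a \<Rightarrow>\<^sub>0 'b" assume "f \<in> {f. keys f \<subseteq> U}" "g \<in> {f. keys f \<subseteq> U}"
  then show "f + g \<in> {f. keys f \<subseteq> U}" using Poly_Mapping.keys_add[of f g] by auto
next
  fix f r :: "'a \<Rightarrow>\<^sub>0 'b" assume "f \<in> {f. keys f \<subseteq> U}"
  then show "r * f \<in> {f. keys f \<subseteq> U}" using keys_mult[of r f] assms by fastforce
qed simp

definition var_monos :: "'v set \<Rightarrow> ('v \<Rightarrow>\<^sub>0 nat) set" where
  "var_monos C = {m. \<exists>x\<in>C. lookup m x \<noteq> 0}"

abbreviation var_ideal :: "'v set \<Rightarrow> (('v \<Rightarrow>\<^sub>0 nat) \<Rightarrow>\<^sub>0 'k::field) set" where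
  "var_ideal C \<equiv> mono_ideal (var_monos C)"

lemma var_monos_add: "m + n \<in> var_monos C \<longleftrightarrow> m \<in> var_monos C \<or> n \<in> var_monos C"
  by (auto simp: var_monos_def lookup_add)

lemma var_ideal_ideal: "ideal_set (var_ideal C :: (('v \<Rightarrow>\<^sub>0 nat) \<Rightarrow>\<^sub>0 'k::field) set)"
  by (rule mono_ideal_set) (simp add: var_monos_add)

text \<open>Modulo the ideal both factors reduce to their parts free of the variables in
  \<open>C\<close>. The product of these parts is free of them too, so it lies in the ideal only if
  it is 0, and there are no zero divisors.\<close>

lemma prime_var_ideal:
  "prime_set (var_ideal C :: (('v::finite \<Rightarrow>\<^sub>0 nat) \<Rightarrow>\<^sub>0 'k::field) set)" (is "prime_set ?P")
  unfolding prime_set_def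
proof (intro conjI allI impI)
  let ?U = "var_monos C"
  note P = ideal_setD[OF var_ideal_ideal[of C]]
  show "ideal_set ?P" by (rule var_ideal_ideal)
  show "1 \<notin> ?P" by (simp add: mono_ideal_def var_monos_def)
  fix f g :: "('v \<Rightarrow>\<^sub>0 nat) \<Rightarrow>\<^sub>0 'k"
  assume fg: "f * g \<in> ?P"
  define f1 f2 where "f1 = poly_restrict (- ?U) f" and "f2 = poly_restrict ?U f"
  define g1 g2 where "g1 = poly_restrict (- ?U) g" and "g2 = poly_restrict ?U g"
  have f: "f = f2 + f1" and g: "g = g2 + g1"
    unfolding f1_def f2_def g1_def g2_def by (rule poly_restrict_split)+
  have 2: "f2 \<in> ?P" "g2 \<in> ?P" by (auto simp: mono_ideal_def f2_def g2_def keys_poly_restrict)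
  have "f1 * g1 = f * g - (f2 * g + f1 * g2)" unfolding f g by (simp add: algebra_simps)
  also have "\<dots> \<in> ?P" by (rule P(6)[OF fg P(2)[OF P(4)[OF 2(1)] P(3)[OF 2(2)]]])
  finally have "keys (f1 * g1) \<subseteq> ?U" by (simp add: mono_ideal_def)
  moreover have "keys (f1 * g1) \<subseteq> - ?U"
    using keys_mult[of f1 g1] by (auto simp: f1_def g1_def keys_poly_restrict var_monos_add)
  ultimately have "f1 * g1 = 0" by (metis Compl_disjoint Int_greatest keys_eq_empty subset_empty)
  then have "f1 = 0 \<or> g1 = 0" using poly_mult_nonzero by blast
  moreover have "f \<in> ?P" if "f1 = 0"
  proof -
    have "f = f2" by (subst f, subst that, rule add_0_right)
    then show ?thesis using 2(1) by simp
  qed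
  moreover have "g \<in> ?P" if "g1 = 0"
  proof -
    have "g = g2" by (subst g, subst that, rule add_0_right)
    then show ?thesis using 2(2) by simp
  qed
  ultimately show "f \<in> ?P \<or> g \<in> ?P" by blast
qed

section \<open>Variables independent modulo a prime, and heights\<close>

definition poly_sub :: "'v set \<Rightarrow> (('v \<Rightarrow>\<^sub>0 nat) \<Rightarrow>\<^sub>0 'k::field) set" where
  "poly_sub S = {f. \<forall>k\<in>keys f. keys k \<subseteq> S}"

lemma pvar_power: "pvar y ^ j = (Poly_Mapping.single (Poly_Mapping.single y j) 1 :: ('v \<Rightarrow>\<^sub>0 nat) \<Rightarrow>\<^sub>0 'k::field)"
proof (induction j)
  case 0
  show ?case by (simp add: single_one)
next
  case (Suc j)
  then show ?case by (simp add: pvar_def mult_single single_add[symmetric])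
qed

lemma monomial_split:
  fixes k :: "'v \<Rightarrow>\<^sub>0 nat"
  shows "(k - Poly_Mapping.single y (lookup k y)) + Poly_Mapping.single y (lookup k y) = k"
    "keys (k - Poly_Mapping.single y (lookup k y)) = keys k - {y}"
proof -
  show "(k - Poly_Mapping.single y (lookup k y)) + Poly_Mapping.single y (lookup k y) = k"
    by (rule poly_mapping_eqI) (auto simp: lookup_add lookup_minus lookup_single when_def)
  show "keys (k - Poly_Mapping.single y (lookup k y)) = keys k - {y}"
    by (auto simp: in_keys_iff lookup_minus lookup_single when_def split: if_splits)
qed

lemma poly_sub_sum: "(\<And>i. i \<in> I \<Longrightarrow> f i \<in> poly_sub S) \<Longrightarrow> sum f I \<in> poly_sub S"
proof (induction I rule: infinite_finite_induct)
  case (insert x F)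
  then show ?case using Poly_Mapping.keys_add[of "f x" "sum f F"] by (auto simp: poly_sub_def)
qed (auto simp: poly_sub_def)

lemma poly_sub_mult:
  fixes f g :: "('v \<Rightarrow>\<^sub>0 nat) \<Rightarrow>\<^sub>0 'k::field"
  assumes "f \<in> poly_sub S" "g \<in> poly_sub S"
  shows "f * g \<in> poly_sub S"
proof -
  have "keys (m + n) \<subseteq> S" if "m \<in> keys f" "n \<in> keys g" for m n :: "'v \<Rightarrow>\<^sub>0 nat"
  proof -
    have "keys m \<subseteq> S" "keys n \<subseteq> S" using that assms by (auto simp: poly_sub_def)
    then show ?thesis using Poly_Mapping.keys_add[of m n] by blast
  qed
  then show ?thesis unfolding poly_sub_def using keys_mult[of f g] by blast
qed

lemma subring_poly_sub:
  fixes P :: "(('v \<Rightarrow>\<^sub>0 nat) \<Rightarrow>\<^sub>0 'k::field) set"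
  assumes "prime_set P"
  shows "subring_mod_prime (poly_sub S) P"
proof
  show "1 \<in> poly_sub S" by (simp add: poly_sub_def)
  show "f + g \<in> poly_sub S" if "f \<in> poly_sub S" "g \<in> poly_sub S" for f g :: "('v \<Rightarrow>\<^sub>0 nat) \<Rightarrow>\<^sub>0 'k"
    using that Poly_Mapping.keys_add[of f g] by (auto simp: poly_sub_def)
  show "f * g \<in> poly_sub S" if "f \<in> poly_sub S" "g \<in> poly_sub S" for f g :: "('v \<Rightarrow>\<^sub>0 nat) \<Rightarrow>\<^sub>0 'k"
    using that by (rule poly_sub_mult)
  show "- f \<in> poly_sub S" if "f \<in> poly_sub S" for f :: "('v \<Rightarrow>\<^sub>0 nat) \<Rightarrow>\<^sub>0 'k"
    using that by (simp add: poly_sub_def in_keys_iff)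
qed (fact assms)

lemma poly_in_one_variable:
  fixes h :: "('v \<Rightarrow>\<^sub>0 nat) \<Rightarrow>\<^sub>0 'k::field"
  assumes "h \<in> poly_sub (insert y S)"
  shows "\<exists>N a. (\<forall>i. a i \<in> poly_sub S) \<and> h = (\<Sum>i\<le>N. a i * pvar y ^ i)"
proof -
  \<comment> \<open>A crude bound for the degree in \<open>y\<close>.\<close>
  define N where "N = (\<Sum>k\<in>keys h. lookup k y)"
  define a where "a i = (\<Sum>k\<in>{k\<in>keys h. lookup k y = i}. Poly_Mapping.single (k - Poly_Mapping.single y i) (lookup h k))" for i
  have aS: "a i \<in> poly_sub S" for i
    unfolding a_def
  proof (rule poly_sub_sum)
    fix k assume "k \<in> {k \<in> keys h. lookup k y = i}"
    then have "keys (k - Poly_Mapping.single y i) \<subseteq> S"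
      using monomial_split(2)[of k y] assms by (auto simp: poly_sub_def)
    then show "Poly_Mapping.single (k - Poly_Mapping.single y i) (lookup h k) \<in> poly_sub S"
      by (simp add: poly_sub_def)
  qed
  have ay: "a i * pvar y ^ i = (\<Sum>k\<in>{k\<in>keys h. lookup k y = i}. Poly_Mapping.single k (lookup h k))" for i
    unfolding a_def sum_distrib_right
  proof (rule sum.cong)
    fix k assume "k \<in> {k \<in> keys h. lookup k y = i}"
    then show "Poly_Mapping.single (k - Poly_Mapping.single y i) (lookup h k) * pvar y ^ i = Poly_Mapping.single k (lookup h k)"
      using monomial_split(1)[of k y] by (simp add: pvar_power mult_single)
  qed simp
  have "lookup k y \<le> N" if "k \<in> keys h" for k
    unfolding N_def using that by (intro member_le_sum) auto
  then have "(\<Sum>i\<le>N. a i * pvar y ^ i) = (\<Sum>k\<in>keys h. Poly_Mapping.single k (lookup h k))"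
    unfolding ay by (intro sum.group) auto
  also have "\<dots> = h" by (rule poly_mapping_expand[symmetric])
  finally show ?thesis using aS by metis
qed

text \<open>When \<open>h\<close> is grouped by powers of \<open>y\<close>, some coefficient is
  nonzero and so outside \<open>P\<close> by independence of \<open>S\<close>. Truncating after the
  last such coefficient changes the sum only by an element of \<open>P\<close>.\<close>

lemma dependent_variable:
  fixes P :: "(('v \<Rightarrow>\<^sub>0 nat) \<Rightarrow>\<^sub>0 'k::field) set"
  assumes P: "prime_set P" and S: "poly_sub S \<inter> P \<subseteq> {0}" and h: "h \<in> poly_sub (insert y S)" "h \<in> P" "h \<noteq> 0"
  shows "\<exists>n a. (\<forall>i. a i \<in> poly_sub S) \<and> a n \<notin> P \<and> (\<Sum>i\<le>n. a i * pvar y ^ i) \<in> P"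
proof -
  have ideal: "ideal_set P" using P by (simp add: prime_set_def)
  obtain N a where a: "\<And>i. a i \<in> poly_sub S" "h = (\<Sum>i\<le>N. a i * pvar y ^ i)"
    using poly_in_one_variable[OF h(1)] by blast
  define J where "J = {i. i \<le> N \<and> a i \<notin> P}"
  have "J \<noteq> {}"
  proof
    assume "J = {}"
    then have "a i = 0" if "i \<le> N" for i using that S a(1)[of i] by (auto simp: J_def)
    then show False using a(2) h(3) by simp
  qed
  moreover have "finite J" by (simp add: J_def)
  ultimately have n: "Max J \<in> J" "\<And>i. i \<in> J \<Longrightarrow> i \<le> Max J" by auto
  define n where "n = Max J"
  have "n \<le> N" "a n \<notin> P" using n by (auto simp: J_def n_def)
  let ?s = "\<Sum>i\<le>n. a i * pvar y ^ i" and ?t = "\<Sum>i\<in>{n<..N}. a i * pvar y ^ i"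
  have "h = ?s + ?t"
  proof -
    have "{..N} = {..n} \<union> {n<..N}" using \<open>n \<le> N\<close> by auto
    moreover have "(\<Sum>i\<in>{..n} \<union> {n<..N}. a i * pvar y ^ i) =
      (\<Sum>i\<le>n. a i * pvar y ^ i) + (\<Sum>i\<in>{n<..N}. a i * pvar y ^ i)"
      by (rule sum.union_disjoint) auto
    ultimately show ?thesis unfolding a(2) by simp
  qed
  then have st: "?s = h - ?t" by simp
  have t: "?t \<in> P"
  proof (rule ideal_set_sum[OF ideal])
    fix i assume i: "i \<in> {n<..N}"
    then have "i \<notin> J" using n(2)[of i] unfolding n_def by auto
    then have "a i \<in> P" using i by (simp add: J_def)
    then show "a i * pvar y ^ i \<in> P" by (rule ideal_setD(4)[OF ideal])
  qed
  have "?s \<in> P" unfolding st by (rule ideal_setD(6)[OF ideal h(2) t])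
  then show ?thesis using a(1) \<open>a n \<notin> P\<close> by blast
qed

text \<open>If no variable could be added to \<open>S\<close>, each would be algebraic over
  \<open>poly_sub S\<close> modulo \<open>P\<close>, and finitely many elements would span the whole
  ring in the sense of \<open>L\<close>. An element of \<open>Q\<close> outside \<open>P\<close>
  would then satisfy a relation, and the constant coefficient of a minimal one is a nonzero element
  of \<open>poly_sub S\<close> in \<open>Q\<close>.\<close>

lemma independent_set_grows:
  fixes P Q :: "(('v::finite \<Rightarrow>\<^sub>0 nat) \<Rightarrow>\<^sub>0 'k::field) set"
  assumes P: "prime_set P" and Q: "prime_set Q" and PQ: "P \<subset> Q" and S: "poly_sub S \<inter> Q \<subseteq> {0}"
  shows "\<exists>S'. Suc (card S) \<le> card S' \<and> poly_sub S' \<inter> P \<subseteq> {0}"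
proof (rule ccontr)
  assume neg: "\<not> ?thesis"
  have dep: "\<exists>h. h \<in> poly_sub (insert y S) \<and> h \<in> P \<and> h \<noteq> 0" if "y \<notin> S" for y
  proof -
    have "Suc (card S) \<le> card (insert y S)" using that by simp
    then show ?thesis using neg by blast
  qed
  interpret subring_mod_prime "poly_sub S" P by (rule subring_poly_sub[OF P])
  have SP: "poly_sub S \<inter> P \<subseteq> {0}" using S PQ by blast
  \<comment> \<open>Variables outside \<open>S\<close> are adjoined one at a time; a monomial
    factors into a power of \<open>y\<close> and the rest.\<close>
  have mono: "\<exists>B. finite B \<and> (\<forall>m. keys m \<subseteq> S \<union> Y \<longrightarrow> Poly_Mapping.single m 1 \<in> L B)"
    if "finite Y" "Y \<inter> S = {}" for Y
    using that
  proof (induction Y rule: finite_induct)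
    case empty
    have "Poly_Mapping.single m 1 \<in> L {1}" if "keys m \<subseteq> S" for m
    proof -
      have "(Poly_Mapping.single m 1 :: ('v \<Rightarrow>\<^sub>0 nat) \<Rightarrow>\<^sub>0 'k) * 1 \<in> L {1}"
        using that by (intro L_scale L_base) (auto simp: poly_sub_def)
      then show ?thesis by simp
    qed
    then show ?case by (intro exI[of _ "{1}"]) simp
  next
    case (insert y Y)
    obtain B where B: "finite B" "\<And>m. keys m \<subseteq> S \<union> Y \<Longrightarrow> Poly_Mapping.single m 1 \<in> L B"
      using insert by auto
    obtain h where h: "h \<in> poly_sub (insert y S)" "h \<in> P" "h \<noteq> 0" using dep[of y] insert.prems by auto
    obtain n a where a: "\<And>i. a i \<in> poly_sub S" "a n \<notin> P" "(\<Sum>i\<le>n. a i * pvar y ^ i) \<in> P"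
      using dependent_variable[OF P SP h] by blast
    define B' where "B' = (\<lambda>(b, b'). b * b') ` (B \<times> (\<lambda>i. pvar y ^ i) ` {..<n})"
    have "Poly_Mapping.single m 1 \<in> L B'" if m: "keys m \<subseteq> S \<union> insert y Y" for m
    proof -
      let ?m = "m - Poly_Mapping.single y (lookup m y)"
      have "Poly_Mapping.single ?m 1 \<in> L B" using monomial_split(2)[of m y] m by (intro B) auto
      moreover have "pvar y ^ lookup m y \<in> L ((\<lambda>i. pvar y ^ i) ` {..<n})"
        using a by (intro L_powers) auto
      ultimately have "Poly_Mapping.single ?m 1 * pvar y ^ lookup m y \<in> L B'"
        unfolding B'_def using B(1) by (intro L_mult) auto
      moreover have "(Poly_Mapping.single ?m 1 :: ('v \<Rightarrow>\<^sub>0 nat) \<Rightarrow>\<^sub>0 'k) * pvar y ^ lookup m y = Poly_Mapping.single m 1"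
        by (simp add: pvar_power mult_single monomial_split(1))
      ultimately show ?thesis by simp
    qed
    moreover have "finite B'" using B(1) by (simp add: B'_def)
    ultimately show ?case by blast
  qed
  obtain B where B: "finite B" "\<And>m. Poly_Mapping.single m 1 \<in> L B"
    using mono[of "- S"] by auto
  have all: "g \<in> L B" for g
  proof -
    have "(\<Sum>k\<in>keys g. Poly_Mapping.single 0 (lookup g k) * Poly_Mapping.single k 1) \<in> L B"
      by (intro L_sum L_scale B) (simp add: poly_sub_def)
    moreover have "(\<Sum>k\<in>keys g. Poly_Mapping.single 0 (lookup g k) * Poly_Mapping.single k 1) = g"
      using poly_mapping_expand[of g] by (simp add: mult_single)
    ultimately show ?thesis by simp
  qed
  obtain f where f: "f \<in> Q" "f \<notin> P" using PQ by blast
  have "\<exists>g\<in>poly_sub S \<inter> Q. g \<notin> P"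
    using Q PQ f by (intro relation_in_larger_ideal algebraic_relation[OF B(1)] all) (auto simp: prime_set_def)
  then show False using S P_simps(1) by blast
qed

text \<open>The variables outside \<open>C\<close> are independent modulo
  \<open>var_ideal C\<close>. Each step down a chain of primes yields a larger independent set,
  whose size is bounded by the number of variables. Adjoining the variables of \<open>C\<close> one
  by one gives a chain of length \<open>card C\<close>.\<close>

lemma height_var_ideal:
  "height ring_of_type_algebra (var_ideal C :: (('v::finite \<Rightarrow>\<^sub>0 nat) \<Rightarrow>\<^sub>0 'k::field) set) = enat (card C)"
proof -
  let ?chain = "\<lambda>n c. (\<forall>i\<le>n. prime_set (c i)) \<and> (\<forall>i<n. c i \<subset> c (Suc i)) \<and>
    c n = (var_ideal C :: (('v \<Rightarrow>\<^sub>0 nat) \<Rightarrow>\<^sub>0 'k) set)"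
  have upper: "n \<le> card C" if c: "?chain n c" for n c
  proof -
    have "\<exists>S. card (- C) + i \<le> card S \<and> poly_sub S \<inter> c (n - i) \<subseteq> {0}" if "i \<le> n" for i
      using that
    proof (induction i)
      case 0
      have "f = 0" if f: "f \<in> poly_sub (- C)" "f \<in> var_ideal C" for f :: "('v \<Rightarrow>\<^sub>0 nat) \<Rightarrow>\<^sub>0 'k"
      proof (rule ccontr)
        assume "f \<noteq> 0"
        then have "keys f \<noteq> {}" by simp
        then obtain k where k: "k \<in> keys f" by blast
        then have "keys k \<subseteq> - C" using f by (auto simp: poly_sub_def)
        moreover have "k \<in> var_monos C" using f k by (auto simp: mono_ideal_def)
        then obtain x where "x \<in> C" "x \<in> keys k" by (auto simp: var_monos_def in_keys_iff)
        ultimately show False by blast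
      qed
      then show ?case using c by (intro exI[of _ "- C"]) auto
    next
      case (Suc i)
      then obtain S where S: "card (- C) + i \<le> card S" "poly_sub S \<inter> c (n - i) \<subseteq> {0}" by auto
      have j: "n - Suc i < n" "Suc (n - Suc i) = n - i" using Suc.prems by auto
      then have "c (n - Suc i) \<subset> c (n - i)" using c by metis
      then obtain S' where "Suc (card S) \<le> card S'" "poly_sub S' \<inter> c (n - Suc i) \<subseteq> {0}"
        using independent_set_grows[OF _ _ _ S(2)] c by (metis diff_le_self)
      then show ?case using S(1) by (intro exI[of _ S']) auto
    qed
    from this[of n] obtain S :: "'v set" where "card (- C) + n \<le> card S" by auto
    also have "card S \<le> card (UNIV :: 'v set)" by (rule card_mono) auto
    also have "\<dots> = card (- C) + card C"
      by (metis Compl_partition2 Compl_disjoint2 card_Un_disjoint finite)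
    finally show ?thesis by simp
  qed
  have lower: "\<exists>c. ?chain (card C) c"
  proof -
    obtain xs where xs: "set xs = C" "distinct xs" using finite_distinct_list[of C] by auto
    define c :: "nat \<Rightarrow> (('v \<Rightarrow>\<^sub>0 nat) \<Rightarrow>\<^sub>0 'k) set" where "c i = var_ideal (set (take i xs))" for i
    have len: "length xs = card C" using xs distinct_card by fastforce
    have "c i \<subset> c (Suc i)" if i: "i < card C" for i
    proof -
      have i': "i < length xs" using i len by simp
      have s: "set (take (Suc i) xs) = insert (xs ! i) (set (take i xs))"
        using i' by (simp add: take_Suc_conv_app_nth)
      then have "c i \<subseteq> c (Suc i)" by (auto simp: c_def mono_ideal_def var_monos_def)
      moreover have "xs ! i \<notin> set (take i xs)"
        using xs(2) i' by (auto simp: in_set_conv_nth nth_eq_iff_index_eq)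
      then have "pvar (xs ! i) \<notin> c i" "pvar (xs ! i) \<in> c (Suc i)"
        unfolding c_def s by (auto simp: pvar_def mono_ideal_def var_monos_def lookup_single when_def)
      ultimately show ?thesis by blast
    qed
    moreover have "c (card C) = var_ideal C" by (simp add: c_def len[symmetric] xs(1))
    moreover have "prime_set (c i)" for i unfolding c_def by (rule prime_var_ideal)
    ultimately show ?thesis by blast
  qed
  have "height ring_of_type_algebra (var_ideal C :: (('v \<Rightarrow>\<^sub>0 nat) \<Rightarrow>\<^sub>0 'k) set) = Sup {enat n | n. \<exists>c. ?chain n c}"
    by (simp add: height_def primeideal_ring_of_type_iff)
  also have "\<dots> = enat (card C)"
    using lower upper by (intro Sup_eqI) auto
  finally show ?thesis .
qed

section \<open>Associated primes of the edge ideal\<close>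

text \<open>Divisibility by a generator of the edge ideal; testing the two exponents separately is
  right because the ends of an arc differ.\<close>

definition edge_monos :: "('v \<times> 'v) set \<Rightarrow> ('v \<Rightarrow> nat) \<Rightarrow> ('v \<Rightarrow>\<^sub>0 nat) set" where
  "edge_monos E w = {m. \<exists>a b. (a, b) \<in> E \<and> 1 \<le> lookup m a \<and> w b \<le> lookup m b}"

lemma edge_monos_add: "m \<in> edge_monos E w \<Longrightarrow> n + m \<in> edge_monos E w"
  unfolding edge_monos_def by (fastforce simp: lookup_add)

lemma edge_ideal_eq:
  assumes asym: "asym E"
  shows "(edge_ideal E w :: (('v \<Rightarrow>\<^sub>0 nat) \<Rightarrow>\<^sub>0 'k::field) set) = mono_ideal (edge_monos E w)"
proof
  let ?G = "{pvar a * pvar b ^ w b | a b. (a, b) \<in> E} :: (('v \<Rightarrow>\<^sub>0 nat) \<Rightarrow>\<^sub>0 'k) set"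
  have gen: "pvar a * pvar b ^ w b = (Poly_Mapping.single (Poly_Mapping.single a 1 + Poly_Mapping.single b (w b)) 1 :: ('v \<Rightarrow>\<^sub>0 nat) \<Rightarrow>\<^sub>0 'k)" for a b
    unfolding pvar_power by (simp add: pvar_def mult_single)
  have "?G \<subseteq> mono_ideal (edge_monos E w)"
  proof
    fix f :: "('v \<Rightarrow>\<^sub>0 nat) \<Rightarrow>\<^sub>0 'k" assume "f \<in> ?G"
    then obtain a b where ab: "(a, b) \<in> E" "f = pvar a * pvar b ^ w b" by blast
    have "Poly_Mapping.single a 1 + Poly_Mapping.single b (w b) \<in> edge_monos E w"
      unfolding edge_monos_def mem_Collect_eq using ab(1)
      by (intro exI[of _ a] exI[of _ b] conjI) (simp_all add: lookup_add)
    then show "f \<in> mono_ideal (edge_monos E w)" unfolding ab(2) gen by (simp add: mono_ideal_def)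
  qed
  moreover have "ideal (mono_ideal (edge_monos E w)) (ring_of_type_algebra :: (('v \<Rightarrow>\<^sub>0 nat) \<Rightarrow>\<^sub>0 'k) ring)"
    unfolding ideal_ring_of_type_iff by (rule mono_ideal_set) (rule edge_monos_add)
  ultimately show "edge_ideal E w \<subseteq> (mono_ideal (edge_monos E w) :: (('v \<Rightarrow>\<^sub>0 nat) \<Rightarrow>\<^sub>0 'k) set)"
    unfolding edge_ideal_def genideal_def by blast
  show "(mono_ideal (edge_monos E w) :: (('v \<Rightarrow>\<^sub>0 nat) \<Rightarrow>\<^sub>0 'k) set) \<subseteq> edge_ideal E w"
    unfolding edge_ideal_def genideal_def
  proof (intro subsetI InterI, elim CollectE conjE)
    fix f J assume f: "f \<in> (mono_ideal (edge_monos E w) :: (('v \<Rightarrow>\<^sub>0 nat) \<Rightarrow>\<^sub>0 'k) set)"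
      and "ideal J (ring_of_type_algebra :: (('v \<Rightarrow>\<^sub>0 nat) \<Rightarrow>\<^sub>0 'k) ring)" and G: "?G \<subseteq> J"
    then have J: "ideal_set J" by (simp add: ideal_ring_of_type_iff)
    have "Poly_Mapping.single k (lookup f k) \<in> J" if k: "k \<in> keys f" for k
    proof -
      have "k \<in> edge_monos E w" using f k by (auto simp: mono_ideal_def)
      then obtain a b where ab: "(a, b) \<in> E" "1 \<le> lookup k a" "w b \<le> lookup k b" by (auto simp: edge_monos_def)
      have "a \<noteq> b" using ab(1) asym by (meson asymD)
      let ?g = "Poly_Mapping.single a 1 + Poly_Mapping.single b (w b)"
      have "(k - ?g) + ?g = k"
        using ab \<open>a \<noteq> b\<close> by (intro poly_mapping_eqI) (auto simp: lookup_add lookup_minus lookup_single when_def)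
      then have "Poly_Mapping.single k (lookup f k) = Poly_Mapping.single (k - ?g) (lookup f k) * (pvar a * pvar b ^ w b)"
        unfolding gen by (simp add: mult_single)
      moreover have "pvar a * pvar b ^ w b \<in> J" using G ab(1) by blast
      ultimately show ?thesis using ideal_setD(3)[OF J] by metis
    qed
    then have "(\<Sum>k\<in>keys f. Poly_Mapping.single k (lookup f k)) \<in> J" by (rule ideal_set_sum[OF J])
    then show "f \<in> J" using poly_mapping_expand[of f] by simp
  qed
qed

lemma monomial_quotient:
  fixes g :: "('v \<Rightarrow>\<^sub>0 nat) \<Rightarrow>\<^sub>0 'k::field"
  shows "g * Poly_Mapping.single m 1 \<in> mono_ideal U \<longleftrightarrow> (\<forall>k\<in>keys g. m + k \<in> U)"
  using keys_monomial_mult[of m g] by (auto simp: mono_ideal_def mult.commute[of g])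

lemma strong_cover_associated:
  fixes E :: "('v::finite \<times> 'v) set"
  assumes asym: "asym E" and pos: "\<And>x. 1 \<le> w x" and C: "strong_cover E w C"
  shows "\<exists>f. (var_ideal C :: (('v \<Rightarrow>\<^sub>0 nat) \<Rightarrow>\<^sub>0 'k::field) set) = {g. g * f \<in> mono_ideal (edge_monos E w)}"
proof -
  \<comment> \<open>Outside \<open>C\<close> the exponent is at least every weight. A vertex of
    \<open>C\<close> with an out-neighbour outside \<open>C\<close> gets 0, since a positive
    exponent would complete the generator of that arc; the other vertices of \<open>C\<close> get
    one less than their weight.\<close>
  define e where "e x = (if x \<notin> C then sum w UNIV else if outN E x \<subseteq> C then w x - 1 else 0)" for x
  define m where "m = Abs_poly_mapping e"
  have m: "lookup m x = e x" for x unfolding m_def by simp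
  have le: "w x \<le> sum w UNIV" for x by (rule member_le_sum) auto
  have cov: "x \<in> C \<or> y \<in> C" if "(x, y) \<in> E" for x y
    using C that by (simp add: strong_cover_def vertex_cover_def)
  have "m + k \<in> edge_monos E w \<longleftrightarrow> k \<in> var_monos C" for k
  proof
    assume "m + k \<in> edge_monos E w"
    then obtain a b where ab: "(a, b) \<in> E" "1 \<le> e a + lookup k a" "w b \<le> e b + lookup k b"
      by (auto simp: edge_monos_def lookup_add m)
    show "k \<in> var_monos C"
    proof (rule ccontr)
      assume k: "k \<notin> var_monos C"
      then have k0: "lookup k x = 0" if "x \<in> C" for x using that by (auto simp: var_monos_def)
      have "b \<notin> C"
      proof
        assume "b \<in> C"
        then have "w b \<le> e b" using ab(3) k0 by simp
        then show False using pos[of b] \<open>b \<in> C\<close> by (auto simp: e_def split: if_splits)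
      qed
      then have "a \<in> C" "\<not> outN E a \<subseteq> C" using cov[OF ab(1)] ab(1) by (auto simp: outN_def)
      then show False using ab(2) k0 by (simp add: e_def)
    qed
  next
    assume "k \<in> var_monos C"
    then obtain x where x: "x \<in> C" "1 \<le> lookup k x" by (auto simp: var_monos_def)
    \<comment> \<open>In the three cases the factor \<open>x\<close> completes an arc to a vertex
      outside \<open>C\<close>, from a vertex outside \<open>C\<close>, or from the weighted vertex
      supplied by strongness.\<close>
    consider "\<not> outN E x \<subseteq> C" | "outN E x \<subseteq> C" "\<not> nbrs E x \<subseteq> C" | "nbrs E x \<subseteq> C" by blast
    then have "\<exists>a b. (a, b) \<in> E \<and> 1 \<le> e a + lookup k a \<and> w b \<le> e b + lookup k b"
    proof cases
      case 1
      then obtain y where y: "(x, y) \<in> E" "y \<notin> C" by (auto simp: outN_def)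
      then have "w y \<le> e y" using le by (simp add: e_def)
      then show ?thesis using y(1) x(2) by (intro exI[of _ x] exI[of _ y]) auto
    next
      case 2
      then obtain y where y: "(y, x) \<in> E" "y \<notin> C" by (auto simp: nbrs_def inN_def)
      then have "w y \<le> e y" using le by (simp add: e_def)
      then have "1 \<le> e y" using pos[of y] by simp
      moreover have "e x = w x - 1" using 2 x by (simp add: e_def)
      ultimately show ?thesis using y(1) x(2) by (intro exI[of _ y] exI[of _ x]) auto
    next
      case 3
      obtain y where y: "(y, x) \<in> E" "y \<in> C" "y \<in> Vplus w" "outN E y \<subseteq> C"
        using strong_coverD[OF C x(1) 3] by metis
      then have "1 \<le> e y" by (simp add: e_def Vplus_def)
      moreover have "outN E x \<subseteq> C" using 3 by (simp add: nbrs_def)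
      then have "e x = w x - 1" using x by (simp add: e_def)
      ultimately show ?thesis using y(1) x(2) by (intro exI[of _ y] exI[of _ x]) auto
    qed
    then show "m + k \<in> edge_monos E w" by (auto simp: edge_monos_def lookup_add m)
  qed
  then have "g \<in> var_ideal C \<longleftrightarrow> g * Poly_Mapping.single m 1 \<in> mono_ideal (edge_monos E w)" for g :: "('v \<Rightarrow>\<^sub>0 nat) \<Rightarrow>\<^sub>0 'k"
    unfolding monomial_quotient by (auto simp: mono_ideal_def)
  then show ?thesis by blast
qed

text \<open>
  Multiplying \<open>f\<close> by high powers of the variables outside \<open>P\<close> and deleting its terms in the ideal changes
  neither \<open>P\<close> nor the hypothesis; afterwards every term \<open>m\<close> of \<open>f\<close> satisfies \<open>(I : m) = var_ideal C\<close>.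
\<close>

lemma associated_strong_cover:
  fixes E :: "('v::finite \<times> 'v) set" and P :: "(('v \<Rightarrow>\<^sub>0 nat) \<Rightarrow>\<^sub>0 'k::field) set"
  assumes asym: "asym E" and pos: "\<And>x. 1 \<le> w x" and P: "prime_set P"
    and f: "P = {g. g * f \<in> mono_ideal (edge_monos E w)}"
  shows "\<exists>C. strong_cover E w C \<and> P = var_ideal C"
proof -
  let ?U = "edge_monos E w"
  let ?I = "mono_ideal ?U :: (('v \<Rightarrow>\<^sub>0 nat) \<Rightarrow>\<^sub>0 'k) set"
  have I: "ideal_set ?I" by (rule mono_ideal_set) (rule edge_monos_add)
  have idP: "ideal_set P" and one: "1 \<notin> P" and pr: "\<And>g h. g * h \<in> P \<Longrightarrow> g \<in> P \<or> h \<in> P"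
    using P by (auto simp: prime_set_def)
  define C where "C = {x. pvar x \<in> P}"
  define M where "M = sum w UNIV"
  have le: "w x \<le> M" for x unfolding M_def by (rule member_le_sum) auto
  \<comment> \<open>\<open>M\<close> is at least every weight, so multiplication by \<open>u\<close>
    fills all exponents outside \<open>C\<close> that a generator could ask for.\<close>
  define u where "u = Abs_poly_mapping (\<lambda>x. if x \<in> C then 0 else M)"
  have u: "lookup u x = (if x \<in> C then 0 else M)" for x unfolding u_def by simp
  \<comment> \<open>A prime containing a monomial contains one of its variables.\<close>
  have monoP: "\<exists>x\<in>C. lookup m x \<noteq> 0" if "Poly_Mapping.single m 1 \<in> P" for m
    using that
  proof (induction "\<Sum>x\<in>UNIV. lookup m x" arbitrary: m rule: less_induct)
    case less
    show ?case
    proof (cases "m = 0")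
      case True
      then show ?thesis using less.prems one by simp
    next
      case False
      then obtain x where x: "lookup m x \<noteq> 0" by (metis lookup_zero poly_mapping_eqI)
      show ?thesis
      proof (cases "x \<in> C")
        case False
        let ?m = "m - Poly_Mapping.single x 1"
        have look: "lookup ?m y = (if y = x then lookup m x - 1 else lookup m y)" for y
          by (simp add: lookup_minus lookup_single when_def)
        have "?m + Poly_Mapping.single x 1 = m"
          using x by (intro poly_mapping_eqI) (auto simp: lookup_add lookup_minus lookup_single when_def)
        then have "Poly_Mapping.single ?m 1 * pvar x = (Poly_Mapping.single m 1 :: ('v \<Rightarrow>\<^sub>0 nat) \<Rightarrow>\<^sub>0 'k)"
          by (simp add: pvar_def mult_single)
        then have "Poly_Mapping.single ?m 1 * pvar x \<in> P" using less.prems by (simp only:)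
        from pr[OF this] have "Poly_Mapping.single ?m 1 \<in> P" using False unfolding C_def by blast
        moreover have "(\<Sum>y\<in>UNIV. lookup ?m y) < (\<Sum>y\<in>UNIV. lookup m y)"
        proof (rule sum_strict_mono_ex1)
          show "\<forall>y\<in>UNIV. lookup ?m y \<le> lookup m y" unfolding look by simp
          show "\<exists>y\<in>UNIV. lookup ?m y < lookup m y" unfolding look using x by (intro bexI[of _ x]) auto
        qed simp
        ultimately obtain y where "y \<in> C" "lookup ?m y \<noteq> 0" using less.hyps by blast
        then show ?thesis using False unfolding look by (auto split: if_splits)
      qed (use x in blast)
    qed
  qed
  have uP: "Poly_Mapping.single u 1 \<notin> P" using monoP[of u] by (auto simp: u)
  define f' where "f' = poly_restrict (- ?U) (Poly_Mapping.single u 1 * f)"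
  have P_iff: "g \<in> P \<longleftrightarrow> g * f' \<in> ?I" for g
  proof -
    have "g \<in> P \<longleftrightarrow> g * Poly_Mapping.single u 1 \<in> P"
      using pr uP ideal_setD(4)[OF idP] by blast
    also have "\<dots> \<longleftrightarrow> g * (Poly_Mapping.single u 1 * f) \<in> ?I" by (simp add: f mult.assoc)
    also have "\<dots> \<longleftrightarrow> g * f' \<in> ?I"
    proof -
      let ?r = "poly_restrict ?U (Poly_Mapping.single u 1 * f)"
      have split: "Poly_Mapping.single u 1 * f = ?r + f'"
        unfolding f'_def by (rule poly_restrict_split)
      have "?r \<in> ?I" by (simp add: mono_ideal_def keys_poly_restrict)
      then have r: "g * ?r \<in> ?I" by (rule ideal_setD(3)[OF I])
      have "g * (Poly_Mapping.single u 1 * f) = g * ?r + g * f'"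
        by (subst split) (simp add: distrib_left)
      then show ?thesis using ideal_setD(2,6)[OF I] r by (metis add_diff_cancel_left')
    qed
    finally show ?thesis .
  qed
  have keys: "m \<notin> ?U \<and> (\<forall>x. x \<notin> C \<longrightarrow> M \<le> lookup m x)" if "m \<in> keys f'" for m
  proof -
    have "m \<in> keys (Poly_Mapping.single u 1 * f)" "m \<notin> ?U" using that by (auto simp: f'_def keys_poly_restrict)
    moreover from this obtain k where "m = u + k" using keys_monomial_mult[of u f] by auto
    ultimately show ?thesis by (simp add: lookup_add u)
  qed
  have f'0: "f' \<noteq> 0"
  proof
    assume "f' = 0"
    then show False using P_iff[of 1] one ideal_setD(1)[OF I] by simp
  qed
  then obtain m where m: "m \<in> keys f'" by (metis keys_eq_empty ex_in_conv)
  note mU = keys[OF m]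
  have CP: "var_ideal C \<subseteq> P"
  proof
    fix g :: "('v \<Rightarrow>\<^sub>0 nat) \<Rightarrow>\<^sub>0 'k" assume g: "g \<in> var_ideal C"
    have "Poly_Mapping.single k (lookup g k) \<in> P" if k: "k \<in> keys g" for k
    proof -
      obtain x where x: "x \<in> C" "lookup k x \<noteq> 0" using g k by (auto simp: mono_ideal_def var_monos_def)
      have "(k - Poly_Mapping.single x 1) + Poly_Mapping.single x 1 = k"
        using x by (intro poly_mapping_eqI) (auto simp: lookup_add lookup_minus lookup_single when_def)
      then have "Poly_Mapping.single k (lookup g k) = Poly_Mapping.single (k - Poly_Mapping.single x 1) (lookup g k) * pvar x"
        by (simp add: pvar_def mult_single)
      moreover have "pvar x \<in> P" using x by (simp add: C_def)
      ultimately show ?thesis using ideal_setD(3)[OF idP] by metis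
    qed
    then have "(\<Sum>k\<in>keys g. Poly_Mapping.single k (lookup g k)) \<in> P" by (rule ideal_set_sum[OF idP])
    then show "g \<in> P" using poly_mapping_expand[of g] by simp
  qed
  \<comment> \<open>The part \<open>g'\<close> of \<open>g\<close> free of the variables in
    \<open>C\<close> raises no exponent inside \<open>C\<close>, and those outside are already large
    enough; so no product of monomials of \<open>g'\<close> and \<open>f'\<close> lies in the ideal,
    and \<open>g' * f'\<close> must vanish.\<close>
  have PC: "P \<subseteq> var_ideal C"
  proof
    fix g assume g: "g \<in> P"
    define g' where "g' = poly_restrict (- var_monos C) g"
    have split: "g = poly_restrict (var_monos C) g + g'" unfolding g'_def by (rule poly_restrict_split)
    have r: "poly_restrict (var_monos C) g \<in> var_ideal C" by (simp add: mono_ideal_def keys_poly_restrict)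
    have "g' = g - poly_restrict (var_monos C) g" using split by (metis add_diff_cancel_left')
    then have "g' \<in> P" using ideal_setD(6)[OF idP g] r CP by blast
    then have sub: "keys (g' * f') \<subseteq> ?U" using P_iff by (simp add: mono_ideal_def)
    have "k + m' \<notin> ?U" if k: "k \<in> keys g'" and m': "m' \<in> keys f'" for k m'
    proof
      assume "k + m' \<in> ?U"
      then obtain a b where ab: "(a, b) \<in> E" "1 \<le> lookup k a + lookup m' a" "w b \<le> lookup k b + lookup m' b"
        by (auto simp: edge_monos_def lookup_add)
      have kC: "lookup k x = 0" if "x \<in> C" for x using k that by (auto simp: g'_def keys_poly_restrict var_monos_def)
      have "1 \<le> lookup m' a"
      proof (cases "a \<in> C")
        case False
        then have "M \<le> lookup m' a" using keys[OF m'] by blast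
        then show ?thesis using pos[of a] le[of a] by linarith
      qed (use ab kC in simp)
      moreover have "w b \<le> lookup m' b"
      proof (cases "b \<in> C")
        case False
        then have "M \<le> lookup m' b" using keys[OF m'] by blast
        then show ?thesis using le[of b] by linarith
      qed (use ab kC in simp)
      ultimately have "m' \<in> ?U" using ab(1) by (auto simp: edge_monos_def)
      then show False using keys[OF m'] by blast
    qed
    then have "keys (g' * f') \<subseteq> - ?U" using keys_mult[of g' f'] by blast
    then have "g' * f' = 0" using sub by (metis Compl_disjoint Int_greatest keys_eq_empty subset_empty)
    then have "g' = 0" using poly_mult_nonzero f'0 by blast
    then have "g = poly_restrict (var_monos C) g" using split by (metis add.right_neutral)
    then show "g \<in> var_ideal C" using r by simp
  qed
  have irr: "(x, x) \<notin> E" for x using asym by (meson asymD)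
  \<comment> \<open>\<open>m\<close> enters the ideal only after multiplication by \<open>x\<close>,
    so \<open>x\<close> is an end of the arc concerned and its exponent in \<open>m\<close> is
    exactly one short.\<close>
  have step: "(\<exists>b. (x, b) \<in> E \<and> w b \<le> lookup m b \<and> lookup m x = 0) \<or>
      (\<exists>a. (a, x) \<in> E \<and> 1 \<le> lookup m a \<and> lookup m x = w x - 1)" if x: "x \<in> C" for x
  proof -
    have "pvar x * f' \<in> ?I" using x P_iff by (simp add: C_def)
    then have "Poly_Mapping.single x 1 + m \<in> ?U"
      unfolding pvar_def using m keys_monomial_mult[of "Poly_Mapping.single x 1" f'] by (auto simp: mono_ideal_def)
    then obtain a b where ab: "(a, b) \<in> E" "1 \<le> lookup (Poly_Mapping.single x 1) a + lookup m a"
      "w b \<le> lookup (Poly_Mapping.single x 1) b + lookup m b"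
      by (auto simp: edge_monos_def lookup_add)
    have nm: "\<not> (1 \<le> lookup m a \<and> w b \<le> lookup m b)" using mU ab(1) by (auto simp: edge_monos_def)
    have "a \<noteq> b" using ab(1) irr by auto
    consider "x = a" | "x = b" | "x \<noteq> a" "x \<noteq> b" by blast
    then show ?thesis
    proof cases
      case 1
      then have "w b \<le> lookup m b" using ab(3) \<open>a \<noteq> b\<close> by (simp add: lookup_single when_def)
      moreover from this have "lookup m a = 0" using nm by auto
      ultimately show ?thesis using 1 ab(1) by blast
    next
      case 2
      then have "1 \<le> lookup m a" using ab(2) \<open>a \<noteq> b\<close> by (simp add: lookup_single when_def)
      moreover from this have "lookup m x = w x - 1" using nm ab(3) 2 by auto
      ultimately show ?thesis using 2 ab(1) by blast
    next
      case 3
      then show ?thesis using nm ab by (simp add: lookup_single when_def)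
    qed
  qed
  have small: "lookup m x \<le> w x - 1" if "x \<in> C" for x using step[OF that] by auto
  have "vertex_cover E C"
    unfolding vertex_cover_def
  proof (intro allI impI, rule ccontr)
    fix a b assume ab: "(a, b) \<in> E" "\<not> (a \<in> C \<or> b \<in> C)"
    then have "M \<le> lookup m a" "M \<le> lookup m b" using mU by auto
    then have "1 \<le> lookup m a" "w b \<le> lookup m b" using le[of a] le[of b] pos[of a] by linarith+
    then show False using mU ab(1) by (auto simp: edge_monos_def)
  qed
  \<comment> \<open>The first alternative contradicts \<open>small\<close> at \<open>b\<close>. In
    the second, an exponent between 1 and \<open>w a - 1\<close> makes \<open>a\<close> weighted,
    and an out-neighbour of \<open>a\<close> outside \<open>C\<close> would put \<open>m\<close>
    into the ideal.\<close>
  moreover have "\<exists>y \<in> inN E x \<inter> Vplus w. outN E y \<subseteq> C" if x: "x \<in> C" "nbrs E x \<subseteq> C" for x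
    using step[OF x(1)]
  proof
    assume "\<exists>b. (x, b) \<in> E \<and> w b \<le> lookup m b \<and> lookup m x = 0"
    then obtain b where b: "(x, b) \<in> E" "w b \<le> lookup m b" by blast
    then have "b \<in> C" using x(2) by (auto simp: mem_nbrs_iff)
    then show ?thesis using small[of b] b(2) pos[of b] by simp
  next
    assume "\<exists>a. (a, x) \<in> E \<and> 1 \<le> lookup m a \<and> lookup m x = w x - 1"
    then obtain a where a: "(a, x) \<in> E" "1 \<le> lookup m a" by blast
    then have "a \<in> C" using x(2) by (auto simp: mem_nbrs_iff)
    then have "a \<in> Vplus w" using small[of a] a(2) by (simp add: Vplus_def)
    moreover have "y \<in> C" if "(a, y) \<in> E" for y
    proof (rule ccontr)
      assume "y \<notin> C"
      then have "M \<le> lookup m y" using mU by auto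
      then have "w y \<le> lookup m y" using le[of y] by linarith
      then show False using mU that a(2) by (auto simp: edge_monos_def)
    qed
    ultimately show ?thesis using a(1) by (intro bexI[of _ a]) (auto simp: inN_def outN_def)
  qed
  ultimately show ?thesis using PC CP by (intro exI[of _ C]) (auto simp: strong_cover_def)
qed

lemma unmixed_iff_same_card:
  fixes E :: "('v::finite \<times> 'v) set"
  assumes asym: "asym E" and pos: "\<And>x. 1 \<le> w x"
  shows "unmixed ring_of_type_algebra (edge_ideal E w :: (('v \<Rightarrow>\<^sub>0 nat) \<Rightarrow>\<^sub>0 'k::field) set) \<longleftrightarrow>
    (\<forall>C C'. strong_cover E w C \<longrightarrow> strong_cover E w C' \<longrightarrow> card C = card C')"
proof -
  let ?I = "mono_ideal (edge_monos E w) :: (('v \<Rightarrow>\<^sub>0 nat) \<Rightarrow>\<^sub>0 'k) set"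
  have assoc: "associated_primes ring_of_type_algebra ?I = {var_ideal C | C. strong_cover E w C}"
  proof (intro equalityI subsetI)
    fix P assume "P \<in> associated_primes ring_of_type_algebra ?I"
    then obtain f where "prime_set P" "P = {g. g * f \<in> ?I}"
      by (auto simp: associated_primes_def ring_of_type_simps primeideal_ring_of_type_iff)
    then obtain C where "strong_cover E w C" "P = var_ideal C"
      using associated_strong_cover[OF asym, of w P f] pos by blast
    then show "P \<in> {var_ideal C | C. strong_cover E w C}" by blast
  next
    fix P :: "(('v \<Rightarrow>\<^sub>0 nat) \<Rightarrow>\<^sub>0 'k) set" assume "P \<in> {var_ideal C | C. strong_cover E w C}"
    then obtain C where C: "strong_cover E w C" "P = var_ideal C" by blast
    have "\<exists>f. P = {g. g * f \<in> ?I}"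
      unfolding C(2) by (rule strong_cover_associated[OF asym _ C(1)]) (rule pos)
    then show "P \<in> associated_primes ring_of_type_algebra ?I"
      using prime_var_ideal[of C] C(2)
      by (simp add: associated_primes_def ring_of_type_simps primeideal_ring_of_type_iff)
  qed
  have "unmixed ring_of_type_algebra ?I \<longleftrightarrow>
    (\<forall>C C'. strong_cover E w C \<longrightarrow> strong_cover E w C' \<longrightarrow>
      height ring_of_type_algebra (var_ideal C :: (('v \<Rightarrow>\<^sub>0 nat) \<Rightarrow>\<^sub>0 'k) set) =
      height ring_of_type_algebra (var_ideal C' :: (('v \<Rightarrow>\<^sub>0 nat) \<Rightarrow>\<^sub>0 'k) set))"
    unfolding unmixed_def assoc by blast
  then show ?thesis unfolding edge_ideal_eq[OF asym] height_var_ideal by simp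
qed

theorem theorem4p8:
  fixes E :: "('v::finite \<times> 'v) set" and w :: "'v \<Rightarrow> nat" and Q :: "'v set set"
  assumes "weighted_oriented_graph E w"
    and "\<And>x. is_source E x \<Longrightarrow> w x = 1"
    and "SCQ_witness (underlying E) Q"
  shows "unmixed ring_of_type_algebra (edge_ideal E w :: (('v \<Rightarrow>\<^sub>0 nat) \<Rightarrow>\<^sub>0 'k::field) set) \<longleftrightarrow>
      (\<forall>C \<in> basic_C5s (underlying E). star_property E w C) \<and>
      (\<forall>K \<in> simplexes (underlying E). \<nexists>H. generating_star_semi_forest E w K H) \<and>
      (\<forall>a b b'. a \<in> Vplus w \<and> {b, b'} \<in> Q \<and> b' \<in> outN E a \<longrightarrow> nbrs E b \<subseteq> outN E a)"
proof -
  have "asym E" "\<And>x. 1 \<le> w x" using assms(1) by (auto simp: weighted_oriented_graph_def)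
  then show ?thesis
    using unmixed_iff_same_card[of E w] same_card_iff_conditions[of E w Q] assms(2,3) by simp
qed

end
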